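(* Let $\mathbb F\in\{\mathbb R,\mathbb C\}$ and let $\mathcal A,\mathcal B\in\mathbb F^{I_1\times I_2\times I_3}$. Assume that $\mathbf A_{(2,3;1)}$ and $\mathbf A_{(1,3;2)}$ have full column rank and that there exist matrices $\mathbf M_1\in\mathbb F^{I_1\times I_1}$ and $\mathbf M_2\in\mathbb F^{I_2\times I_2}$ such that $$\mathbf B_{(2,3;1)}=\mathbf A_{(2,3;1)}\mathbf M_1\quad\text{and}\quad \mathbf B_{(1,3;2)}=\mathbf A_{(1,3;2)}\mathbf M_2.$$ Then the following statements hold. 1. The matrices $\mathbf M_1$ and $\mathbf M_2$ have the same minimal polynomial $q(x)$. 2. Consider the factorization $q(x)=p_1(x)^{\mu_1}\cdots p_R(x)^{\mu_R}$ with distinct polynomials $p_r(x)$ that are irreducible over $\mathbb F$, and set $L_{1r}:=\dim\operatorname{Null}(p_r(\mathbf M_1)^{\mu_r})$, $L_{2r}:=\dim\operatorname{Null}(p_r(\mathbf M_2)^{\mu_r})$, $1\le r\le R$. Let $$\mathbf M_1=\mathbf S_1\operatorname{Bdiag}(\mathbf T_{11},\dots,\mathbf T_{1R})\mathbf S_1^{-1},\quad \mathbf S_1=[\mathbf S_{11}\ \dots\ \mathbf S_{1R}],\quad \mathbf S_{1r}\in\mathbb F^{I_1\times L_{1r}},$$ $$\mathbf M_2=\mathbf S_2\operatorname{Bdiag}(\mathbf T_{21},\dots,\mathbf T_{2R})\mathbf S_2^{-1},\quad \mathbf S_2=[\mathbf S_{21}\ \dots\ \mathbf S_{2R}],\quad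 \mathbf S_{2r}\in\mathbb F^{I_2\times L_{2r}},$$ be the primary decompositions of $\mathbf M_1$ and $\mathbf M_2$, respectively, such that the minimal polynomials of $\mathbf T_{1r}$ and $\mathbf T_{2r}$ are equal to $p_r(x)^{\mu_r}$ for each $r=1,\dots,R$. Then the matrices $\mathbf D_i:=\mathbf S_1^T\mathbf A_i\mathbf S_2$, where $\mathbf A_i:=\mathcal A(:,:,i)$, $i=1,\dots,I_3$, are block-diagonal, $\mathbf D_i=\operatorname{Bdiag}(\mathbf D_{i,11},\dots,\mathbf D_{i,RR})$ with $\mathbf D_{i,rr}\in\mathbb F^{L_{1r}\times L_{2r}}$, and $$\mathbf T_{1r}^T\mathbf D_{i,rr}=\mathbf D_{i,rr}\mathbf T_{2r},\qquad i=1,\dots,I_3,\ r=1,\dots,R.$$ 3. Let $\mathcal D_r\in\mathbb F^{L_{1r}\times L_{2r}\times I_3}$ denote the tensor with frontal slices $\mathbf D_{1,rr},\dots,\mathbf D_{I_3,rr}$, and let $\mathbf X^{(1)}:=\mathbf S_1^{-T}=[\mathbf X^{(1)}_1\ \dots\ \mathbf X^{(1)}_R]$ with $\mathbf X^{(1)}_r\in\mathbb F^{I_1\times L_{1r}}$ and $\mathbf X^{(2)}:=\mathbf S_2^{-T}=[\mathbf X^{(2)}_1\ \dots\ \mathbf X^{(2)}_R]$ with $\mathbf X^{(2)}_r\in\mathbb F^{I_2\times L_{2r}}$. Then the tensors $\mathcal A$ and $\mathcal B$ admit decompositions into ML rank-$(L_{1r},L_{2r},\cdot)$ terms which are connected as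 follows: $$\mathcal A=\sum_{r=1}^R\mathcal D_r\bullet_1\mathbf X^{(1)}_r\bullet_2\mathbf X^{(2)}_r=:\sum_{r=1}^R\mathcal A_r,$$ $$\mathcal B=\sum_{r=1}^R(\mathcal D_r\bullet_1\mathbf T_{1r}^T)\bullet_1\mathbf X^{(1)}_r\bullet_2\mathbf X^{(2)}_r=:\sum_{r=1}^R\mathcal B_r,$$ and $$\mathcal D_r\bullet_1\mathbf T_{1r}^T=\mathcal D_r\bullet_2\mathbf T_{2r}^T,\qquad r=1,\dots,R.$$ 4. If $I_1=I_2$ and if there exists a linear combination of $\mathbf A_1,\dots,\mathbf A_{I_3}$ that is nonsingular, then $\mathbf M_1$ is similar to $\mathbf M_2$. 5. If $\mathbf M_1$ is similar to $\mathbf M_2$, then $L_{1r}=L_{2r}$ for all $r$, and the matrices $\mathbf S_1$ and $\mathbf S_2$ in the primary decompositions in statement 2 can be chosen such that $\mathbf T_{1r}=\mathbf T_{2r}$ for all $r$. 6. If, for some $r$, the matrix $\mathbf T_{1r}$ (or $\mathbf T_{2r}$) is a scalar multiple of the identity matrix, i.e., if $\mathbf T_{1r}=\lambda_r\mathbf I_{L_{1r}}$ (or $\mathbf T_{2r}=\lambda_r\mathbf I_{L_{2r}}$), then $\mathcal B_r=\lambda_r\mathcal A_r$. 7. If $\mathbf T_{1r}=\lambda_r\mathbf I_{L_{1r}}$ (or $\mathbf T_{2r}=\lambda_r\mathbf I_{L_{2r}}$) for all $r$, then $\mathcal A$ and $\mathcal B$ consist of the same ML rank-$(L_{1r},L_{2r},\cdot)$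 terms, possibly differently scaled.
   Context: Matrix representations: for $\mathcal A\in\mathbb F^{I_1\times I_2\times I_3}$ with frontal slices $\mathbf A_i=\mathcal A(:,:,i)\in\mathbb F^{I_1\times I_2}$, $\mathbf A_{(2,3;1)}=[\mathbf A_1\ \dots\ \mathbf A_{I_3}]^T\in\mathbb F^{I_2I_3\times I_1}$ and $\mathbf A_{(1,3;2)}=[\mathbf A_1^T\ \dots\ \mathbf A_{I_3}^T]^T\in\mathbb F^{I_1I_3\times I_2}$. Mode-$n$ product: $\mathcal D\bullet_1\mathbf X$ (resp. $\mathcal D\bullet_2\mathbf X$) is the tensor whose $i$th frontal slice is $\mathbf X\mathcal D(:,:,i)$ (resp. $\mathcal D(:,:,i)\mathbf X^T$). Successive products are taken from left to right. ML rank: a third-order tensor $\mathcal A$ is ML (multilinear) rank-$(L_1,L_2,\cdot)$ if $\operatorname{rank}\mathbf A_{(2,3;1)}=L_1$ and $\operatorname{rank}\mathbf A_{(1,3;2)}=L_2$. The minimal polynomial of a matrix is the polynomial over $\mathbb F$ of least degree with leading coefficient $1$ that annihilates it. Primary decomposition: if the minimal polynomial of $\mathbf M\in\mathbb F^{I\times I}$ is $q=p_1^{\mu_1}\cdots p_R^{\mu_R}$ with distinct irreducible $p_r$, a primary decomposition of $\mathbf M$ is a factorization $\mathbf M=\mathbf S\operatorname{Bdiag}(\mathbf T_1,\dots,\mathbf T_R)\mathbf S^{-1}$, $\mathbf S=[\mathbf S_1\ \dots\ \mathbf S_R]$ nonsingular, where the columns of $\mathbf S_r$ form a basis of the $\mathbf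 M$-invariant subspace $\operatorname{Null}(p_r(\mathbf M)^{\mu_r})$ and $\mathbf M\mathbf S_r=\mathbf S_r\mathbf T_r$. $\operatorname{Bdiag}(\cdot)$ denotes a block-diagonal matrix with the given (possibly rectangular) diagonal blocks; $\mathbf I_L$ is the $L\times L$ identity; ${}^T$ is the (non-conjugate) transpose, and ${}^{-T}$ the inverse of the transpose.
   Formalization: In statement 3 the terms B_r are shown to be exactly ML rank-(L_1r,L_2r,·) only when p_r(x) ≠ x; for p_r(x) = x only the upper bounds on the ranks are stated, since exactness then fails (e.g. A=[1], B=[0], M_1=M_2=0). *)

theory Defs
  imports
    "Jordan_Normal_Form.Matrix_Kernel"
    "Jordan_Normal_Form.DL_Rank"
    "Jordan_Normal_Form.Jordan_Normal_Form_Existence"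
begin

(* The ground field is the real or the complex field. The class contains, up to field
   isomorphism, exactly these two fields, so a theorem about 'a :: real_or_complex
   is a theorem about both of them and about nothing else. *)
class real_or_complex = field +
  assumes real_or_complex:
    "(\<exists>h :: 'a \<Rightarrow> real. bij h \<and> (\<forall>x y. h (x + y) = h x + h y) \<and> (\<forall>x y. h (x * y) = h x * h y)) \<or>
     (\<exists>h :: 'a \<Rightarrow> complex. bij h \<and> (\<forall>x y. h (x + y) = h x + h y) \<and> (\<forall>x y. h (x * y) = h x * h y))"

instance real :: real_or_complex
  by standard (rule disjI1, rule exI[of _ id], simp)

instance complex :: real_or_complex
  by standard (rule disjI2, rule exI[of _ id], simp)

(* A third-order tensor is the list of its frontal slices. The first two dimensions cannot be
   read off from an empty list and are therefore passed explicitly where they are needed. *)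
type_synonym 'a tensor3 = "'a mat list"

definition carrier_tensor3 :: "nat \<Rightarrow> nat \<Rightarrow> nat \<Rightarrow> 'a tensor3 set" where
  "carrier_tensor3 n1 n2 n3 = {\<A>. length \<A> = n3 \<and> set \<A> \<subseteq> carrier_mat n1 n2}"

(* [A_1 ... A_k] for matrices with n rows each *)
definition hcat :: "nat \<Rightarrow> 'a mat list \<Rightarrow> 'a mat" where
  "hcat n As = mat_of_cols n (concat (map cols As))"

(* The matrix representations A_(2,3;1) = [A_1 ... A_k]^T and A_(1,3;2) = [A_1^T ... A_k^T]^T;
   n1 is the number of rows and n2 the number of columns of the slices. *)
definition unfold_23_1 :: "nat \<Rightarrow> 'a tensor3 \<Rightarrow> 'a mat" where
  "unfold_23_1 n1 \<A> = transpose_mat (hcat n1 \<A>)"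

definition unfold_13_2 :: "nat \<Rightarrow> 'a tensor3 \<Rightarrow> 'a mat" where
  "unfold_13_2 n2 \<A> = transpose_mat (hcat n2 (map transpose_mat \<A>))"

definition mode1_prod :: "'a :: semiring_0 tensor3 \<Rightarrow> 'a mat \<Rightarrow> 'a tensor3"
    (infixl "\<bullet>\<^sub>1" 75) where
  "\<D> \<bullet>\<^sub>1 X = map (\<lambda>D. X * D) \<D>"

definition mode2_prod :: "'a :: semiring_0 tensor3 \<Rightarrow> 'a mat \<Rightarrow> 'a tensor3"
    (infixl "\<bullet>\<^sub>2" 75) where
  "\<D> \<bullet>\<^sub>2 X = map (\<lambda>D. D * transpose_mat X) \<D>"

definition smult_tensor3 :: "'a :: times \<Rightarrow> 'a tensor3 \<Rightarrow> 'a tensor3" where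
  "smult_tensor3 c \<A> = map (\<lambda>A. c \<cdot>\<^sub>m A) \<A>"

(* the sum of the n1 x n2 x n3 tensors \<A> 0, ..., \<A> (R - 1) *)
definition sum_tensor3 :: "nat \<Rightarrow> nat \<Rightarrow> nat \<Rightarrow> nat \<Rightarrow> (nat \<Rightarrow> 'a :: comm_monoid_add tensor3) \<Rightarrow> 'a tensor3"
  where
  "sum_tensor3 n1 n2 n3 R \<A> =
     map (\<lambda>i. mat n1 n2 (\<lambda>jk. \<Sum>r<R. (\<A> r ! i) $$ jk)) [0..<n3]"

definition slice_combination :: "nat \<Rightarrow> nat \<Rightarrow> 'a tensor3 \<Rightarrow> (nat \<Rightarrow> 'a :: semiring_0) \<Rightarrow> 'a mat" where
  "slice_combination n1 n2 \<A> c = mat n1 n2 (\<lambda>jk. \<Sum>i<length \<A>. c i * (\<A> ! i) $$ jk)"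

definition mat_rank :: "'a :: field mat \<Rightarrow> nat" where
  "mat_rank A = vec_space.rank (dim_row A) A"

definition full_column_rank :: "'a :: field mat \<Rightarrow> bool" where
  "full_column_rank A \<longleftrightarrow> mat_rank A = dim_col A"

(* the n1 x n2 x n3 tensor \<A> is ML rank-(L1,L2,.) *)
definition is_ml_rank :: "nat \<Rightarrow> nat \<Rightarrow> 'a :: field tensor3 \<Rightarrow> nat \<Rightarrow> nat \<Rightarrow> bool" where
  "is_ml_rank n1 n2 \<A> L1 L2 \<longleftrightarrow>
     mat_rank (unfold_23_1 n1 \<A>) = L1 \<and> mat_rank (unfold_13_2 n2 \<A>) = L2"

(* the inverse of an invertible matrix; the value is unspecified otherwise *)
definition mat_inv :: "'a :: field mat \<Rightarrow> 'a mat" where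
  "mat_inv A = the (mat_inverse A)"

(* p(M); note that M ^\<^sub>m 0 is the identity of the size of M *)
definition poly_mat :: "'a :: comm_semiring_1 poly \<Rightarrow> 'a mat \<Rightarrow> 'a mat" where
  "poly_mat p M =
     mat (dim_row M) (dim_row M) (\<lambda>ij. \<Sum>k\<le>degree p. coeff p k * (M ^\<^sub>m k) $$ ij)"

definition is_min_poly :: "'a :: field mat \<Rightarrow> 'a poly \<Rightarrow> bool" where
  "is_min_poly M q \<longleftrightarrow>
     lead_coeff q = 1 \<and> poly_mat q M = 0\<^sub>m (dim_row M) (dim_row M) \<and>
     (\<forall>p. lead_coeff p = 1 \<and> poly_mat p M = 0\<^sub>m (dim_row M) (dim_row M) \<longrightarrow> degree q \<le> degree p)"

(* The irreducible factors are normalized to be monic: distinct then means non-associated. *)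
definition irreducible_factorization ::
    "'a :: field poly \<Rightarrow> nat \<Rightarrow> (nat \<Rightarrow> 'a poly) \<Rightarrow> (nat \<Rightarrow> nat) \<Rightarrow> bool" where
  "irreducible_factorization q R p \<mu> \<longleftrightarrow>
     (\<forall>r<R. irreducible (p r) \<and> lead_coeff (p r) = 1 \<and> 0 < \<mu> r) \<and>
     inj_on p {..<R} \<and> q = (\<Prod>r<R. p r ^ \<mu> r)"


definition primary_dim :: "'a :: field mat \<Rightarrow> 'a poly \<Rightarrow> nat \<Rightarrow> nat" where
  "primary_dim M p m = kernel_dim (poly_mat p M ^\<^sub>m m)"

definition cols_form_kernel_basis :: "'a :: field mat \<Rightarrow> 'a mat \<Rightarrow> bool" where
  "cols_form_kernel_basis S K \<longleftrightarrow> distinct (cols S) \<and> kernel.basis (dim_col K) K (set (cols S))"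

(* M = S Bdiag(T_0, ..., T_(R-1)) S^(-1) with S = [S_0 ... S_(R-1)], where the minimal polynomial
   of M is the product of the powers p_r^(\<mu>_r) *)
definition primary_decomposition ::
    "'a :: field mat \<Rightarrow> nat \<Rightarrow> (nat \<Rightarrow> 'a poly) \<Rightarrow> (nat \<Rightarrow> nat) \<Rightarrow>
     (nat \<Rightarrow> 'a mat) \<Rightarrow> (nat \<Rightarrow> 'a mat) \<Rightarrow> bool" where
  "primary_decomposition M R p \<mu> S T \<longleftrightarrow>
     (let n = dim_row M; L = (\<lambda>r. primary_dim M (p r) (\<mu> r)); SS = hcat n (map S [0..<R]) in
       (\<forall>r<R. S r \<in> carrier_mat n (L r) \<and> T r \<in> carrier_mat (L r) (L r) \<and>
              cols_form_kernel_basis (S r) (poly_mat (p r) M ^\<^sub>m \<mu> r) \<and>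
              M * S r = S r * T r) \<and>
       invertible_mat SS \<and>
       M = SS * diag_block_mat (map T [0..<R]) * mat_inv SS)"

end

theory Submission
  imports Defs
begin

text \<open>Comparing slices, the two hypotheses say that M1^T A_i = B_i = A_i M2 for all i. Hence
  f(M1)^T A_i = A_i f(M2) for every polynomial f, and full column rank of the unfoldings makes M1 and
  M2 annihilated by the same polynomials. The block D = S_{1r}^T A_i S_{2s} satisfies
  T_{1r}^T D = D T_{2s}, so it vanishes for r \<noteq> s because p_r^\<mu>_r and p_s^\<mu>_s are comaximal.
  Consequently the r-th term of the decomposition of A is both X_{1r} S_{1r}^T A_i and
  A_i S_{2r} X_{2r}^T, its unfoldings are those of A multiplied by S_{1r} X_{1r}^T and S_{2r} X_{2r}^T,
  and the ranks can be read off; for B the factors T_{1r} and T_{2r} are inserted in the middle.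
  A nonsingular combination of the slices makes M1^T similar to M2, and M1 is similar to M1^T by the
  Jordan normal form over the complex numbers.\<close>

section \<open>Polynomials in a matrix\<close>

text \<open>Coprimality is used as a Bezout identity, which can be evaluated at a matrix. The same
  device yields the vanishing of the off-diagonal blocks, the projections onto the primary subspaces
  and the inverse of a primary block. The terms of B need care. The r-th one contains T_1r, which is
  nilpotent of positive size, hence singular, when p_r is the polynomial X. Its ML rank is then
  smaller than (L_1r, L_2r), as the case T_1r = 0 shows. The bound by (L_1r, L_2r) holds always;
  equality holds when p_r differs from X. Statement 5 asserts existence, so a primary decomposition
  has to be constructed from the minimal polynomial and then carried from M1 to M2 along a
  similarity. In statement 4 the Jordan form lives over the complex numbers only, while the ground
  field is known through a bijection onto the real or the complex numbers. Hence two descents: from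
  complex to real similarity, and from there to the ground field.\<close>

lemma poly_mat_carrier [simp]:
  "M \<in> carrier_mat n n \<Longrightarrow> poly_mat p M \<in> carrier_mat n n"
  by (auto simp: poly_mat_def)

lemma poly_mat_dim [simp]:
  "dim_row (poly_mat p M) = dim_row M" "dim_col (poly_mat p M) = dim_row M"
  by (auto simp: poly_mat_def)

lemma poly_mat_0 [simp]: "M \<in> carrier_mat n n \<Longrightarrow> poly_mat 0 M = 0\<^sub>m n n"
  by (rule eq_matI) (auto simp: poly_mat_def)

lemma pow_mat_Suc_left:
  assumes "M \<in> carrier_mat n n"
  shows "M ^\<^sub>m Suc k = M * M ^\<^sub>m k"
proof (induction k)
  case 0
  then show ?case using assms by simp
next
  case (Suc k)
  then show ?case
    using assms by (simp add: assoc_mult_mat[of M n n "M ^\<^sub>m k" n M n])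
qed

text \<open>Horner's scheme. It replaces the sum up to the degree by a recursion, from which the
  rules for sums, products, intertwining and transposes follow by induction on the
  polynomial.\<close>

lemma poly_mat_pCons:
  assumes M: "M \<in> carrier_mat n n"
  shows "poly_mat (pCons a p) M = a \<cdot>\<^sub>m 1\<^sub>m n + M * poly_mat p M"
proof (rule eq_matI)
  fix i j assume "i < dim_row (a \<cdot>\<^sub>m 1\<^sub>m n + M * poly_mat p M)"
    and "j < dim_col (a \<cdot>\<^sub>m 1\<^sub>m n + M * poly_mat p M)"
  with M have i: "i < n" and j: "j < n" by auto
  have "poly_mat (pCons a p) M $$ (i, j) =
      (\<Sum>k\<le>degree (pCons a p). coeff (pCons a p) k * (M ^\<^sub>m k) $$ (i, j))"
    using i j M by (simp add: poly_mat_def)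
  \<comment> \<open>For \<open>p = 0\<close> the degree of \<open>pCons a p\<close> stays 0; the
    extra summand then has coefficient 0.\<close>
  also have "\<dots> = (\<Sum>k\<le>Suc (degree p). coeff (pCons a p) k * (M ^\<^sub>m k) $$ (i, j))"
    by (rule sum.mono_neutral_left) (auto simp: coeff_eq_0)
  also have "\<dots> = a * (M ^\<^sub>m 0) $$ (i, j) + (\<Sum>k\<le>degree p. coeff p k * (M ^\<^sub>m Suc k) $$ (i, j))"
    by (simp only: sum.atMost_Suc_shift coeff_pCons_0 coeff_pCons_Suc)
  also have "(\<Sum>k\<le>degree p. coeff p k * (M ^\<^sub>m Suc k) $$ (i, j)) =
      (\<Sum>k\<le>degree p. \<Sum>l<n. M $$ (i, l) * (coeff p k * (M ^\<^sub>m k) $$ (l, j)))"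
    unfolding pow_mat_Suc_left[OF M] using i j M
    by (intro sum.cong)
      (auto simp: scalar_prod_def sum_distrib_left atLeast0LessThan ac_simps intro!: sum.cong)
  also have "\<dots> = (\<Sum>l<n. \<Sum>k\<le>degree p. M $$ (i, l) * (coeff p k * (M ^\<^sub>m k) $$ (l, j)))"
    by (rule sum.swap)
  also have "\<dots> = (\<Sum>l<n. M $$ (i, l) * poly_mat p M $$ (l, j))"
    using j M by (simp add: poly_mat_def sum_distrib_left)
  also have "\<dots> = (M * poly_mat p M) $$ (i, j)"
    using i j M by (simp add: scalar_prod_def atLeast0LessThan)
  finally show "poly_mat (pCons a p) M $$ (i, j) = (a \<cdot>\<^sub>m 1\<^sub>m n + M * poly_mat p M) $$ (i, j)"
    using i j M by simp
qed (use M in auto)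

lemma poly_mat_add:
  assumes M: "M \<in> carrier_mat n n"
  shows "poly_mat (p + q) M = poly_mat p M + poly_mat q M"
proof (induction p q rule: poly_induct2)
  case 0
  then show ?case using M by simp
next
  case (pCons a p b q)
  note [simp] = poly_mat_carrier[OF M]
  have "M * (poly_mat p M + poly_mat q M) = M * poly_mat p M + M * poly_mat q M"
    by (rule mult_add_distrib_mat[OF M]) (use M in auto)
  with pCons show ?case
    using M by (intro eq_matI) (auto simp: poly_mat_pCons[OF M] algebra_simps)
qed

lemma poly_mat_smult:
  fixes M :: "'a :: comm_ring_1 mat"
  assumes M: "M \<in> carrier_mat n n"
  shows "poly_mat (smult c p) M = c \<cdot>\<^sub>m poly_mat p M"
proof (induction p)
  case 0
  then show ?case using M by simp
next
  case (pCons a p)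
  have "M * (c \<cdot>\<^sub>m poly_mat p M) = c \<cdot>\<^sub>m (M * poly_mat p M)"
    by (rule mult_smult_distrib[OF M poly_mat_carrier[OF M]])
  with pCons show ?case
    using M by (intro eq_matI) (auto simp: poly_mat_pCons[OF M] algebra_simps)
qed

lemma poly_mat_mult:
  fixes M :: "'a :: comm_ring_1 mat"
  assumes M: "M \<in> carrier_mat n n"
  shows "poly_mat (p * q) M = poly_mat p M * poly_mat q M"
proof (induction p)
  case 0
  then show ?case using M by simp
next
  case (pCons a p)
  note c = poly_mat_carrier[OF M]
  have "poly_mat (pCons a p * q) M = a \<cdot>\<^sub>m poly_mat q M + (0 \<cdot>\<^sub>m 1\<^sub>m n + M * (poly_mat p M * poly_mat q M))"
    by (simp add: poly_mat_add[OF M] poly_mat_smult[OF M] poly_mat_pCons[OF M] pCons.IH)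
  also have "\<dots> = a \<cdot>\<^sub>m poly_mat q M + M * (poly_mat p M * poly_mat q M)"
    using M by (intro eq_matI) auto
  also have "M * (poly_mat p M * poly_mat q M) = M * poly_mat p M * poly_mat q M"
    by (rule assoc_mult_mat[symmetric, OF M c c])
  also have "a \<cdot>\<^sub>m poly_mat q M = (a \<cdot>\<^sub>m 1\<^sub>m n) * poly_mat q M"
    using M mult_smult_assoc_mat[OF one_carrier_mat c, of a q] left_mult_one_mat[OF c] by simp
  also have "(a \<cdot>\<^sub>m 1\<^sub>m n) * poly_mat q M + M * poly_mat p M * poly_mat q M =
      poly_mat (pCons a p) M * poly_mat q M"
    unfolding poly_mat_pCons[OF M]
    by (rule add_mult_distrib_mat[symmetric, OF _ _ c]) (use M c in auto)
  finally show ?case .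
qed

lemma poly_mat_1:
  fixes M :: "'a :: comm_ring_1 mat"
  assumes M: "M \<in> carrier_mat n n"
  shows "poly_mat 1 M = 1\<^sub>m n"
  using M by (intro eq_matI) (auto simp: poly_mat_def)

lemma poly_mat_X:
  fixes M :: "'a :: comm_ring_1 mat"
  assumes M: "M \<in> carrier_mat n n"
  shows "poly_mat [:0, 1:] M = M"
  using M by (intro eq_matI) (auto simp: poly_mat_def)

lemma poly_mat_power:
  fixes M :: "'a :: comm_ring_1 mat"
  assumes M: "M \<in> carrier_mat n n"
  shows "poly_mat (p ^ k) M = poly_mat p M ^\<^sub>m k"
proof (induction k)
  case 0
  then show ?case using M by (simp add: poly_mat_1)
next
  case (Suc k)
  then show ?case
    using M by (simp only: power_Suc2 poly_mat_mult[OF M] pow_mat.simps)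
qed

lemma poly_mat_diff:
  fixes M :: "'a :: comm_ring_1 mat"
  assumes M: "M \<in> carrier_mat n n"
  shows "poly_mat (p - q) M = poly_mat p M - poly_mat q M"
proof -
  have "p - q = p + smult (-1) q" by simp
  then show ?thesis
    using M by (intro eq_matI) (auto simp only: poly_mat_add[OF M] poly_mat_smult[OF M], auto)
qed

lemma poly_mat_commute:
  fixes M :: "'a :: comm_ring_1 mat"
  assumes M: "M \<in> carrier_mat n n"
  shows "poly_mat p M * poly_mat q M = poly_mat q M * poly_mat p M"
  by (simp add: poly_mat_mult[OF M, symmetric] mult.commute)

text \<open>Each Horner step preserves the relation. It serves four situations:
  \<open>transpose_mat M1\<close> and \<open>M2\<close> with a slice between them, \<open>M\<close>
  and \<open>T r\<close> with \<open>S r\<close>, two primary blocks with a block of a slice, and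
  two similar matrices with the transition matrix.\<close>

lemma poly_mat_intertwine:
  fixes A :: "'a :: comm_ring_1 mat"
  assumes A: "A \<in> carrier_mat m m" and B: "B \<in> carrier_mat n n" and C: "C \<in> carrier_mat m n"
    and AC: "A * C = C * B"
  shows "poly_mat p A * C = C * poly_mat p B"
proof (induction p)
  case 0
  then show ?case using assms by simp
next
  case (pCons a p)
  note cA = poly_mat_carrier[OF A, of p] and cB = poly_mat_carrier[OF B, of p]
  have "A * poly_mat p A * C = A * (C * poly_mat p B)"
    using pCons.IH assoc_mult_mat[OF A cA C] by simp
  also have "\<dots> = C * (B * poly_mat p B)"
    using assoc_mult_mat[OF A C cB] assoc_mult_mat[OF C B cB] AC by simp
  finally have *: "A * poly_mat p A * C = C * (B * poly_mat p B)" .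
  have "poly_mat (pCons a p) A * C = (a \<cdot>\<^sub>m 1\<^sub>m m) * C + A * poly_mat p A * C"
    unfolding poly_mat_pCons[OF A] by (rule add_mult_distrib_mat[OF _ _ C]) (use A cA in auto)
  also have "(a \<cdot>\<^sub>m 1\<^sub>m m) * C = C * (a \<cdot>\<^sub>m 1\<^sub>m n)"
    using mult_smult_assoc_mat[OF one_carrier_mat C, of a] mult_smult_distrib[OF C one_carrier_mat, of a] C
    by simp
  also have "\<dots> + A * poly_mat p A * C = C * poly_mat (pCons a p) B"
    unfolding poly_mat_pCons[OF B] * by (rule mult_add_distrib_mat[symmetric, OF C]) (use B cB in auto)
  finally show ?case .
qed

lemma poly_mat_transpose:
  fixes M :: "'a :: comm_ring_1 mat"
  assumes M: "M \<in> carrier_mat n n"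
  shows "poly_mat p (transpose_mat M) = transpose_mat (poly_mat p M)"
proof (induction p)
  case 0
  then show ?case using M by simp
next
  case (pCons a p)
  have MT: "transpose_mat M \<in> carrier_mat n n" using M by simp
  note c = poly_mat_carrier[OF M, of p]
  \<comment> \<open>Transposition reverses products, so the factor \<open>M\<close> of the recursion
    has to be moved to the other side first.\<close>
  have "M * poly_mat p M = poly_mat p M * M"
    using poly_mat_commute[OF M, of "[:0, 1:]" p] by (simp add: poly_mat_X[OF M])
  then have "transpose_mat (M * poly_mat p M) = transpose_mat M * transpose_mat (poly_mat p M)"
    using transpose_mult[OF c M] by simp
  then show ?case
    unfolding poly_mat_pCons[OF M] poly_mat_pCons[OF MT] pCons.IH
    using M c by (subst transpose_add[of _ n n]) (auto intro!: eq_matI)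
qed

text \<open>A dimension count: the n*n + 1 powers M^0, ..., M^(n*n) live in a space of dimension
  n*n, so a nontrivial combination of them vanishes.\<close>

lemma exists_annihilating_poly:
  fixes M :: "'a :: field mat"
  assumes M: "M \<in> carrier_mat n n"
  shows "\<exists>p. lead_coeff p = 1 \<and> poly_mat p M = 0\<^sub>m n n"
proof -
  define N where "N = Suc (n * n)"
  \<comment> \<open>Column k lists the entries of M^k row by row. The additional zero row makes the
    matrix square with determinant 0; the entries of a nonzero kernel vector become the coefficients
    of the polynomial.\<close>
  define A where "A = mat N N (\<lambda>(r, k). if r < n * n then (M ^\<^sub>m k) $$ (r div n, r mod n) else 0)"
  have A: "A \<in> carrier_mat N N" by (simp add: A_def)
  have "A = mat\<^sub>r N N (\<lambda>r. if r = n * n then 0\<^sub>v N else row A r)"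
    by (rule eq_matI) (auto simp: A_def N_def)
  moreover have "det \<dots> = 0"
    by (rule det_row_0) (auto simp: A_def N_def)
  ultimately have "det A = 0" by simp
  then obtain v where v: "v \<in> carrier_vec N" "v \<noteq> 0\<^sub>v N" "A *\<^sub>v v = 0\<^sub>v N"
    using det_0_iff_vec_prod_zero_field[OF A] by auto
  define p where "p = Poly (list_of_vec v)"
  have cp: "coeff p k = (if k < N then v $ k else 0)" for k
    using v(1) by (auto simp: p_def nth_default_def list_of_vec_index)
  have "p \<noteq> 0"
  proof
    assume "p = 0"
    then have "v $ k = 0" if "k < N" for k using cp[of k] that by simp
    then have "v = 0\<^sub>v N" using v(1) by (intro eq_vecI) auto
    with v(2) show False by simp
  qed
  have "degree p < N"
    using cp[of "degree p"] \<open>p \<noteq> 0\<close> by (metis leading_coeff_0_iff)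
  have "poly_mat p M = 0\<^sub>m n n"
  proof (rule eq_matI)
    fix i j assume "i < dim_row (0\<^sub>m n n :: 'a mat)" "j < dim_col (0\<^sub>m n n :: 'a mat)"
    then have i: "i < n" and j: "j < n" by auto
    have r: "i * n + j < n * n"
    proof -
      have "i * n + j < Suc i * n" using j by simp
      also have "\<dots> \<le> n * n" using i by (intro mult_le_mono1) simp
      finally show ?thesis .
    qed
    have "poly_mat p M $$ (i, j) = (\<Sum>k\<le>degree p. coeff p k * (M ^\<^sub>m k) $$ (i, j))"
      using i j M by (simp add: poly_mat_def)
    also have "\<dots> = (\<Sum>k<N. coeff p k * (M ^\<^sub>m k) $$ (i, j))"
      using \<open>degree p < N\<close> by (intro sum.mono_neutral_left) (auto simp: coeff_eq_0)
    also have "\<dots> = (A *\<^sub>v v) $ (i * n + j)"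
      using v(1) i j r unfolding A_def
      by (auto simp: N_def scalar_prod_def atLeast0LessThan cp[unfolded N_def] intro!: sum.cong)
    finally show "poly_mat p M $$ (i, j) = 0\<^sub>m n n $$ (i, j)"
      using v(3) i j r by (simp add: N_def)
  qed (use M in auto)
  then have "poly_mat (smult (inverse (lead_coeff p)) p) M = 0\<^sub>m n n"
    by (simp add: poly_mat_smult[OF M])
  moreover have "lead_coeff (smult (inverse (lead_coeff p)) p) = 1"
    using \<open>p \<noteq> 0\<close> by simp
  ultimately show ?thesis by blast
qed

lemma exists_min_poly:
  fixes M :: "'a :: field mat"
  assumes M: "M \<in> carrier_mat n n"
  shows "\<exists>q. is_min_poly M q"
proof -
  let ?P = "\<lambda>p. lead_coeff p = 1 \<and> poly_mat p M = 0\<^sub>m n n"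
  obtain p where "?P p" using exists_annihilating_poly[OF M] by blast
  then have "?P (arg_min degree ?P)" by (rule arg_min_natI)
  moreover have "degree (arg_min degree ?P) \<le> degree p" if "?P p" for p
    using that by (rule arg_min_nat_le)
  ultimately show ?thesis using M unfolding is_min_poly_def by auto
qed

section \<open>Block matrices and unfoldings\<close>

lemma hcat_carrier:
  "hcat n As \<in> carrier_mat n (sum_list (map dim_col As))"
proof (rule carrier_matI)
  show "dim_col (hcat n As) = sum_list (map dim_col As)"
    by (induction As) (auto simp: hcat_def)
qed (simp add: hcat_def)

lemma hcat_dim_row [simp]: "dim_row (hcat n As) = n"
  using hcat_carrier[of n As] by auto

lemma hcat_Nil [simp]: "hcat n [] = 0\<^sub>m n 0"
  using hcat_carrier[of n "[]"] by (intro eq_matI) auto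

lemma hcat_map_carrier:
  assumes "\<And>r. r \<in> set rs \<Longrightarrow> f r \<in> carrier_mat n (l r)"
  shows "hcat n (map f rs) \<in> carrier_mat n (sum_list (map l rs))"
proof -
  have "map dim_col (map f rs) = map l rs" using assms by auto
  then show ?thesis using hcat_carrier[of n "map f rs"] by metis
qed

text \<open>The two lower blocks have no rows. In this form concatenation falls under the
  multiplication and transposition rules for block matrices.\<close>

lemma hcat_Cons:
  assumes A: "A \<in> carrier_mat n k" and As: "hcat n As \<in> carrier_mat n l"
  shows "hcat n (A # As) = four_block_mat A (hcat n As) (0\<^sub>m 0 k) (0\<^sub>m 0 l)"
proof (rule eq_matI)
  fix i j assume "i < dim_row (four_block_mat A (hcat n As) (0\<^sub>m 0 k) (0\<^sub>m 0 l))"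
    and "j < dim_col (four_block_mat A (hcat n As) (0\<^sub>m 0 k) (0\<^sub>m 0 l))"
  with A As have i: "i < n" and j: "j < k + l" by auto
  have l: "length (concat (map cols As)) = l"
    using As by (auto simp: hcat_def)
  show "hcat n (A # As) $$ (i, j) = four_block_mat A (hcat n As) (0\<^sub>m 0 k) (0\<^sub>m 0 l) $$ (i, j)"
    using A As i j l by (auto simp: hcat_def mat_of_cols_index nth_append)
next
  show "dim_col (hcat n (A # As)) = dim_col (four_block_mat A (hcat n As) (0\<^sub>m 0 k) (0\<^sub>m 0 l))"
    using A As by (auto simp: hcat_def)
qed (use A in auto)

lemma set_cols_subset:
  assumes "\<And>r. r \<in> set rs \<Longrightarrow> f r \<in> carrier_mat n (l r)"
  shows "set (concat (map cols (map f rs))) \<subseteq> carrier_vec n"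
proof
  fix v assume "v \<in> set (concat (map cols (map f rs)))"
  then obtain r where "r \<in> set rs" "v \<in> set (cols (f r))" by auto
  then show "v \<in> carrier_vec n" using assms[of r] cols_dim[of "f r"] by auto
qed

lemma mult_hcat:
  fixes N :: "'a :: semiring_0 mat"
  assumes N: "N \<in> carrier_mat k n"
    and f: "\<And>r. r \<in> set rs \<Longrightarrow> f r \<in> carrier_mat n (l r)"
  shows "N * hcat n (map f rs) = hcat k (map (\<lambda>r. N * f r) rs)"
proof -
  have *: "N * mat_of_cols n vs = mat_of_cols k (map ((*\<^sub>v) N) vs)" if vs: "set vs \<subseteq> carrier_vec n" for vs
  proof -
    have "col (mat_of_cols n vs) j = vs ! j" if "j < length vs" for j
      using that vs by (intro col_mat_of_cols) auto
    then show ?thesis using N by (intro eq_matI) (auto simp: mat_of_cols_index)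
  qed
  have "cols (N * f r) = map ((*\<^sub>v) N) (cols (f r))" if "r \<in> set rs" for r
    using N f[OF that] by (auto simp: cols_def intro!: eq_vecI)
  then have "concat (map cols (map (\<lambda>r. N * f r) rs)) = map ((*\<^sub>v) N) (concat (map cols (map f rs)))"
    by (induction rs) auto
  moreover have "set (concat (map cols (map f rs))) \<subseteq> carrier_vec n"
    using f by (rule set_cols_subset)
  ultimately show ?thesis unfolding hcat_def by (simp add: *)
qed

text \<open>Blocks in the same place have equal width, so the common list of columns can be cut in
  only one way.\<close>

lemma hcat_eq_iff:
  assumes "\<And>r. r \<in> set rs \<Longrightarrow> f r \<in> carrier_mat n (l r)"
    and "\<And>r. r \<in> set rs \<Longrightarrow> g r \<in> carrier_mat n (l r)"
  shows "hcat n (map f rs) = hcat n (map g rs) \<longleftrightarrow> (\<forall>r\<in>set rs. f r = g r)"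
proof
  assume eq: "hcat n (map f rs) = hcat n (map g rs)"
  have c: "set (concat (map cols (map f rs))) \<subseteq> carrier_vec n"
    "set (concat (map cols (map g rs))) \<subseteq> carrier_vec n"
    using assms set_cols_subset by blast+
  have "concat (map cols (map f rs)) = concat (map cols (map g rs))"
    using eq unfolding hcat_def by (metis c cols_mat_of_cols)
  moreover have "\<forall>(x, y)\<in>set (zip (map cols (map f rs)) (map cols (map g rs))). length x = length y"
  proof -
    have "length (cols (f r)) = length (cols (g r))" if "r \<in> set rs" for r
      using assms[OF that] by simp
    then show ?thesis by (auto simp: set_zip)
  qed
  ultimately have "map cols (map f rs) = map cols (map g rs)"
    by (intro concat_injective) auto
  then have "cols (f r) = cols (g r)" if "r \<in> set rs" for r using that by simp
  then show "\<forall>r\<in>set rs. f r = g r"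
    using assms by (metis carrier_matD(1) mat_of_cols_cols)
next
  assume "\<forall>r\<in>set rs. f r = g r"
  then show "hcat n (map f rs) = hcat n (map g rs)" by (metis map_eq_conv)
qed

lemma hcat_zero: "hcat n (map (\<lambda>r. 0\<^sub>m n (l r)) rs) = 0\<^sub>m n (sum_list (map l rs))"
proof (induction rs)
  case Nil
  then show ?case by simp
next
  case (Cons r rs)
  then show ?case
    by (subst list.map, subst hcat_Cons[of _ n "l r" _ "sum_list (map l rs)"]) (auto intro!: eq_matI)
qed

lemma four_block_mat_inject:
  assumes "A \<in> carrier_mat m n" "A' \<in> carrier_mat m n"
    and "B \<in> carrier_mat m n'" "B' \<in> carrier_mat m n'"
    and "C \<in> carrier_mat m' n" "C' \<in> carrier_mat m' n"
    and "D \<in> carrier_mat m' n'" "D' \<in> carrier_mat m' n'"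
    and eq: "four_block_mat A B C D = four_block_mat A' B' C' D'"
  shows "A = A' \<and> B = B' \<and> C = C' \<and> D = D'"
proof -
  have e: "four_block_mat A B C D $$ (i, j) = four_block_mat A' B' C' D' $$ (i, j)" for i j
    using eq by simp
  have "A $$ (i, j) = A' $$ (i, j)" if "i < m" "j < n" for i j
    using e[of i j] assms(1-8) that by auto
  moreover have "B $$ (i, j) = B' $$ (i, j)" if "i < m" "j < n'" for i j
    using e[of i "j + n"] assms(1-8) that by auto
  moreover have "C $$ (i, j) = C' $$ (i, j)" if "i < m'" "j < n" for i j
    using e[of "i + m" j] assms(1-8) that by auto
  moreover have "D $$ (i, j) = D' $$ (i, j)" if "i < m'" "j < n'" for i j
    using e[of "i + m" "j + n"] assms(1-8) that by auto
  ultimately show ?thesis using assms(1-8) by (auto intro!: eq_matI)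
qed

lemma transpose_hcat_Cons:
  assumes A: "A \<in> carrier_mat n k" and As: "hcat n As \<in> carrier_mat n l"
  shows "transpose_mat (hcat n (A # As)) =
    four_block_mat (transpose_mat A) (0\<^sub>m k 0) (transpose_mat (hcat n As)) (0\<^sub>m l 0)"
  unfolding hcat_Cons[OF A As]
  by (subst transpose_four_block_mat[OF A As]) auto

lemma transpose_hcat_mult_Cons:
  fixes A B :: "'a :: semiring_0 mat"
  assumes A: "A \<in> carrier_mat n k" and As: "hcat n As \<in> carrier_mat n l"
    and B: "B \<in> carrier_mat n k'" and Bs: "hcat n Bs \<in> carrier_mat n l'"
  shows "transpose_mat (hcat n (A # As)) * hcat n (B # Bs) =
    four_block_mat (transpose_mat A * B) (transpose_mat A * hcat n Bs)
      (transpose_mat (hcat n As) * B) (transpose_mat (hcat n As) * hcat n Bs)"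
  unfolding transpose_hcat_Cons[OF A As] hcat_Cons[OF B Bs]
  by (subst mult_four_block_mat[of _ k n _ 0 _ l _ _ k' _ l']) (use assms in \<open>auto intro!: cong_four_block_mat\<close>)

lemma diag_block_mat_Cons:
  assumes "A \<in> carrier_mat k l" and "diag_block_mat As \<in> carrier_mat k' l'"
  shows "diag_block_mat (A # As) = four_block_mat A (0\<^sub>m k l') (0\<^sub>m k' l) (diag_block_mat As)"
  using assms by (auto simp: Let_def)

lemma diag_block_map_carrier:
  assumes "\<And>r. r \<in> set rs \<Longrightarrow> f r \<in> carrier_mat (k r) (l r)"
  shows "diag_block_mat (map f rs) \<in> carrier_mat (sum_list (map k rs)) (sum_list (map l rs))"
proof -
  have "map dim_row (map f rs) = map k rs" "map dim_col (map f rs) = map l rs"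
    using assms by auto
  then show ?thesis by (intro carrier_matI) (metis dim_diag_block_mat)+
qed

text \<open>Block (r, s) of the product is f_r^T g_s, and only the diagonal ones survive.\<close>

lemma transpose_hcat_mult_hcat:
  fixes f g :: "'b \<Rightarrow> 'a :: comm_semiring_0 mat"
  assumes "\<And>r. r \<in> set rs \<Longrightarrow> f r \<in> carrier_mat n (k r)"
    and "\<And>r. r \<in> set rs \<Longrightarrow> g r \<in> carrier_mat n (l r)"
    and "\<And>r s. r \<in> set rs \<Longrightarrow> s \<in> set rs \<Longrightarrow> r \<noteq> s \<Longrightarrow> transpose_mat (f r) * g s = 0\<^sub>m (k r) (l s)"
    and "distinct rs"
  shows "transpose_mat (hcat n (map f rs)) * hcat n (map g rs) =
    diag_block_mat (map (\<lambda>r. transpose_mat (f r) * g r) rs)"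
  using assms
proof (induction rs)
  case Nil
  then show ?case by simp
next
  case (Cons a rs)
  have fa: "f a \<in> carrier_mat n (k a)" and ga: "g a \<in> carrier_mat n (l a)"
    using Cons.prems by auto
  have F: "hcat n (map f rs) \<in> carrier_mat n (sum_list (map k rs))"
    and G: "hcat n (map g rs) \<in> carrier_mat n (sum_list (map l rs))"
    by (rule hcat_map_carrier; use Cons.prems in auto)+
  have D: "diag_block_mat (map (\<lambda>r. transpose_mat (f r) * g r) rs)
      \<in> carrier_mat (sum_list (map k rs)) (sum_list (map l rs))"
    by (rule diag_block_map_carrier) (use Cons.prems(1,2) in \<open>auto intro!: mult_carrier_mat[where n = n]\<close>)
  have "transpose_mat (f a) * hcat n (map g rs) = hcat (k a) (map (\<lambda>r. transpose_mat (f a) * g r) rs)"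
    by (rule mult_hcat) (use Cons.prems in auto)
  also have "\<dots> = hcat (k a) (map (\<lambda>r. 0\<^sub>m (k a) (l r)) rs)"
    using Cons.prems(1-3) fa \<open>distinct (a # rs)\<close>
    by (subst hcat_eq_iff[where l = l]) (auto intro!: mult_carrier_mat[where n = n])
  finally have 1: "transpose_mat (f a) * hcat n (map g rs) = 0\<^sub>m (k a) (sum_list (map l rs))"
    unfolding hcat_zero .
  \<comment> \<open>The first block column is treated as the transpose of a block row, because
    \<open>mult_hcat\<close> distributes a left factor over a concatenation.\<close>
  have "transpose_mat (g a) * hcat n (map f rs) = hcat (l a) (map (\<lambda>r. transpose_mat (g a) * f r) rs)"
    by (rule mult_hcat) (use Cons.prems in auto)
  also have "\<dots> = hcat (l a) (map (\<lambda>r. 0\<^sub>m (l a) (k r)) rs)"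
  proof (subst hcat_eq_iff[where l = k])
    show "\<forall>r\<in>set rs. transpose_mat (g a) * f r = 0\<^sub>m (l a) (k r)"
    proof
      fix r assume r: "r \<in> set rs"
      then have fr: "f r \<in> carrier_mat n (k r)" and ne: "r \<noteq> a" using Cons.prems by auto
      have "transpose_mat (g a) * f r = transpose_mat (transpose_mat (f r) * g a)"
        using transpose_mult[of "transpose_mat (f r)" "k r" n "g a" "l a"] fr ga by simp
      also have "transpose_mat (f r) * g a = 0\<^sub>m (k r) (l a)"
        using Cons.prems(3)[of r a] r ne by simp
      finally show "transpose_mat (g a) * f r = 0\<^sub>m (l a) (k r)" by simp
    qed
  qed (use ga Cons.prems(1) in \<open>auto intro!: mult_carrier_mat[where n = n]\<close>)
  finally have "transpose_mat (g a) * hcat n (map f rs) = 0\<^sub>m (l a) (sum_list (map k rs))"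
    unfolding hcat_zero .
  then have "transpose_mat (transpose_mat (g a) * hcat n (map f rs)) = 0\<^sub>m (sum_list (map k rs)) (l a)"
    by simp
  then have 2: "transpose_mat (hcat n (map f rs)) * g a = 0\<^sub>m (sum_list (map k rs)) (l a)"
    using transpose_mult[of "transpose_mat (g a)" "l a" n "hcat n (map f rs)"] F ga by simp
  have IH: "transpose_mat (hcat n (map f rs)) * hcat n (map g rs) =
      diag_block_mat (map (\<lambda>r. transpose_mat (f r) * g r) rs)"
    by (rule Cons.IH) (use Cons.prems in auto)
  show ?case
    unfolding list.map transpose_hcat_mult_Cons[OF fa F ga G] 1 2 IH
    by (rule diag_block_mat_Cons[symmetric, OF _ D]) (use fa ga in auto)
qed

text \<open>Comparing the blocks of the product with those of the identity: the block rows of an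
  inverse are biorthogonal to the block columns of the matrix.\<close>

lemma transpose_hcat_mult_hcat_one:
  fixes f g :: "'b \<Rightarrow> 'a :: comm_semiring_1 mat"
  assumes "\<And>r. r \<in> set rs \<Longrightarrow> f r \<in> carrier_mat n (l r)"
    and "\<And>r. r \<in> set rs \<Longrightarrow> g r \<in> carrier_mat n (l r)"
    and "distinct rs"
    and "transpose_mat (hcat n (map f rs)) * hcat n (map g rs) = 1\<^sub>m (sum_list (map l rs))"
    and "r \<in> set rs" "s \<in> set rs"
  shows "transpose_mat (f r) * g s = (if r = s then 1\<^sub>m (l r) else 0\<^sub>m (l r) (l s))"
  using assms
proof (induction rs arbitrary: r s)
  case Nil
  then show ?case by simp
next
  case (Cons a rs)
  let ?L = "sum_list (map l rs)"
  have fa: "f a \<in> carrier_mat n (l a)" and ga: "g a \<in> carrier_mat n (l a)"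
    using Cons.prems by auto
  have F: "hcat n (map f rs) \<in> carrier_mat n ?L"
    and G: "hcat n (map g rs) \<in> carrier_mat n ?L"
    by (rule hcat_map_carrier; use Cons.prems in auto)+
  have "four_block_mat (transpose_mat (f a) * g a) (transpose_mat (f a) * hcat n (map g rs))
      (transpose_mat (hcat n (map f rs)) * g a) (transpose_mat (hcat n (map f rs)) * hcat n (map g rs)) =
      four_block_mat (1\<^sub>m (l a)) (0\<^sub>m (l a) ?L) (0\<^sub>m ?L (l a)) (1\<^sub>m ?L)"
    using Cons.prems(4) unfolding list.map transpose_hcat_mult_Cons[OF fa F ga G] by simp
  then have "transpose_mat (f a) * g a = 1\<^sub>m (l a) \<and>
      transpose_mat (f a) * hcat n (map g rs) = 0\<^sub>m (l a) ?L \<and>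
      transpose_mat (hcat n (map f rs)) * g a = 0\<^sub>m ?L (l a) \<and>
      transpose_mat (hcat n (map f rs)) * hcat n (map g rs) = 1\<^sub>m ?L"
    by (rule four_block_mat_inject[rotated 8]) (use fa ga F G in auto)
  then have 1: "transpose_mat (f a) * g a = 1\<^sub>m (l a)"
    and 2: "transpose_mat (f a) * hcat n (map g rs) = 0\<^sub>m (l a) ?L"
    and 3: "transpose_mat (hcat n (map f rs)) * g a = 0\<^sub>m ?L (l a)"
    and 4: "transpose_mat (hcat n (map f rs)) * hcat n (map g rs) = 1\<^sub>m ?L" by blast+
  have "hcat (l a) (map (\<lambda>s. transpose_mat (f a) * g s) rs) = hcat (l a) (map (\<lambda>s. 0\<^sub>m (l a) (l s)) rs)"
    unfolding hcat_zero 2[symmetric] by (rule mult_hcat[symmetric]) (use Cons.prems in auto)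
  then have 5: "transpose_mat (f a) * g s = 0\<^sub>m (l a) (l s)" if "s \<in> set rs" for s
    using that fa ga Cons.prems(1,2)
    by (subst (asm) hcat_eq_iff[where l = l]) (auto intro!: mult_carrier_mat[where n = n])
  have "transpose_mat (g a) * hcat n (map f rs) = 0\<^sub>m (l a) ?L"
    using arg_cong[OF 3, of transpose_mat] F ga
    by (subst (asm) transpose_mult[of _ ?L n _ "l a"]) auto
  then have "hcat (l a) (map (\<lambda>s. transpose_mat (g a) * f s) rs) = hcat (l a) (map (\<lambda>s. 0\<^sub>m (l a) (l s)) rs)"
    unfolding hcat_zero by (subst mult_hcat[symmetric]) (use Cons.prems in auto)
  then have "transpose_mat (g a) * f s = 0\<^sub>m (l a) (l s)" if "s \<in> set rs" for s
    using that fa ga Cons.prems(1,2)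
    by (subst (asm) hcat_eq_iff[where l = l]) (auto intro!: mult_carrier_mat[where n = n])
  then have "transpose_mat (transpose_mat (g a) * f s) = 0\<^sub>m (l s) (l a)" if "s \<in> set rs" for s
    using that by simp
  then have 6: "transpose_mat (f s) * g a = 0\<^sub>m (l s) (l a)" if "s \<in> set rs" for s
    using that transpose_mult[of "transpose_mat (g a)" "l a" n "f s" "l s"] ga Cons.prems(1)[of s] by simp
  have "transpose_mat (f r) * g s = (if r = s then 1\<^sub>m (l r) else 0\<^sub>m (l r) (l s))"
    if "r \<in> set rs" "s \<in> set rs" for r s
    by (rule Cons.IH) (use Cons.prems 4 that in auto)
  then show ?case using 1 5 6 Cons.prems(3,5,6) by auto
qed

lemma hcat_mult_diag:
  fixes f g :: "'b \<Rightarrow> 'a :: semiring_1 mat"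
  assumes "\<And>r. r \<in> set rs \<Longrightarrow> f r \<in> carrier_mat n (k r)"
    and "\<And>r. r \<in> set rs \<Longrightarrow> g r \<in> carrier_mat (k r) (l r)"
  shows "hcat n (map f rs) * diag_block_mat (map g rs) = hcat n (map (\<lambda>r. f r * g r) rs)"
  using assms
proof (induction rs)
  case Nil
  then show ?case by simp
next
  case (Cons a rs)
  have fa: "f a \<in> carrier_mat n (k a)" and ga: "g a \<in> carrier_mat (k a) (l a)"
    using Cons.prems by auto
  have F: "hcat n (map f rs) \<in> carrier_mat n (sum_list (map k rs))"
    by (rule hcat_map_carrier) (use Cons.prems in auto)
  have G: "diag_block_mat (map g rs) \<in> carrier_mat (sum_list (map k rs)) (sum_list (map l rs))"
    by (rule diag_block_map_carrier) (use Cons.prems in auto)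
  have fg: "f a * g a \<in> carrier_mat n (l a)" using fa ga by simp
  have FG: "hcat n (map (\<lambda>r. f r * g r) rs) \<in> carrier_mat n (sum_list (map l rs))"
    by (rule hcat_map_carrier) (use Cons.prems in fastforce)
  have IH: "hcat n (map f rs) * diag_block_mat (map g rs) = hcat n (map (\<lambda>r. f r * g r) rs)"
    by (rule Cons.IH) (use Cons.prems in auto)
  show ?case
    unfolding list.map hcat_Cons[OF fa F] diag_block_mat_Cons[OF ga G] hcat_Cons[OF fg FG]
    by (subst mult_four_block_mat[of _ n "k a" _ "sum_list (map k rs)" _ 0 _ _ "l a" _ "sum_list (map l rs)"])
      (use fa ga F G FG IH in \<open>auto intro!: cong_four_block_mat\<close>)
qed

text \<open>A block row times a block column is a sum of products of blocks. The entrywise form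
  matches \<open>sum_tensor3\<close>.\<close>

lemma hcat_mult_transpose_hcat:
  fixes f g :: "'b \<Rightarrow> 'a :: comm_semiring_1 mat"
  assumes "\<And>r. r \<in> set rs \<Longrightarrow> f r \<in> carrier_mat n (l r)"
    and "\<And>r. r \<in> set rs \<Longrightarrow> g r \<in> carrier_mat m (l r)"
    and "i < n" "j < m"
  shows "(hcat n (map f rs) * transpose_mat (hcat m (map g rs))) $$ (i, j) =
    (\<Sum>r\<leftarrow>rs. (f r * transpose_mat (g r)) $$ (i, j))"
  using assms
proof (induction rs)
  case Nil
  show ?case using Nil.prems(3,4) by (simp add: scalar_prod_def)
next
  case (Cons a rs)
  have fa: "f a \<in> carrier_mat n (l a)" and ga: "g a \<in> carrier_mat m (l a)"
    using Cons.prems by auto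
  have F: "hcat n (map f rs) \<in> carrier_mat n (sum_list (map l rs))"
    and G: "hcat m (map g rs) \<in> carrier_mat m (sum_list (map l rs))"
    by (rule hcat_map_carrier; use Cons.prems in auto)+
  have IH: "(hcat n (map f rs) * transpose_mat (hcat m (map g rs))) $$ (i, j) =
    (\<Sum>r\<leftarrow>rs. (f r * transpose_mat (g r)) $$ (i, j))"
    by (rule Cons.IH) (use Cons.prems in auto)
  have "hcat n (map f (a # rs)) * transpose_mat (hcat m (map g (a # rs))) =
      four_block_mat (f a * transpose_mat (g a) + hcat n (map f rs) * transpose_mat (hcat m (map g rs)))
        (0\<^sub>m n 0) (0\<^sub>m 0 m) (0\<^sub>m 0 0)"
    unfolding list.map hcat_Cons[OF fa F] transpose_hcat_Cons[OF ga G]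
    by (subst mult_four_block_mat[of _ n "l a" _ "sum_list (map l rs)" _ 0 _ _ m _ 0])
      (use fa ga F G in \<open>auto intro!: cong_four_block_mat\<close>)
  then show ?case using Cons.prems fa ga F G IH by simp
qed

text \<open>Used to cut the inverse transpose of [S_0 ... S_(R-1)] into blocks of the same widths;
  these are the X_r of the decomposition.\<close>

lemma hcat_split:
  fixes Y :: "'a :: zero mat"
  assumes "distinct rs" and "Y \<in> carrier_mat n (sum_list (map l rs))"
  shows "\<exists>X. (\<forall>r\<in>set rs. X r \<in> carrier_mat n (l r)) \<and> hcat n (map X rs) = Y"
  using assms
proof (induction rs arbitrary: Y)
  case Nil
  then show ?case by (auto intro!: eq_matI)
next
  case (Cons a rs)
  let ?L = "sum_list (map l rs)"
  define Y1 where "Y1 = mat n (l a) (\<lambda>(i, j). Y $$ (i, j))"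
  define Y2 where "Y2 = mat n ?L (\<lambda>(i, j). Y $$ (i, j + l a))"
  have Y1: "Y1 \<in> carrier_mat n (l a)" and Y2: "Y2 \<in> carrier_mat n ?L"
    by (auto simp: Y1_def Y2_def)
  obtain X where X: "\<forall>r\<in>set rs. X r \<in> carrier_mat n (l r)" "hcat n (map X rs) = Y2"
    using Cons.IH[OF _ Y2] Cons.prems by auto
  let ?X = "X(a := Y1)"
  have m: "map ?X rs = map X rs" using Cons.prems(1) by auto
  have "hcat n (map ?X (a # rs)) = four_block_mat Y1 Y2 (0\<^sub>m 0 (l a)) (0\<^sub>m 0 ?L)"
    unfolding list.map m using hcat_Cons[OF Y1, of "map X rs" ?L] X(2) Y2 by simp
  also have "\<dots> = Y"
    using Cons.prems(2) by (intro eq_matI) (auto simp: Y1_def Y2_def)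
  finally have "hcat n (map ?X (a # rs)) = Y" .
  moreover have "\<forall>r\<in>set (a # rs). ?X r \<in> carrier_mat n (l r)" using X(1) Y1 by auto
  ultimately show ?case by blast
qed

section \<open>Unfoldings of a tensor and mode products\<close>

lemma unfold_13_2_eq: "unfold_13_2 n \<A> = unfold_23_1 n (map transpose_mat \<A>)"
  by (simp add: unfold_13_2_def unfold_23_1_def)

lemma carrier_tensor3_nth:
  "\<A> \<in> carrier_tensor3 n1 n2 n3 \<Longrightarrow> i < n3 \<Longrightarrow> \<A> ! i \<in> carrier_mat n1 n2"
  by (auto simp: carrier_tensor3_def)

lemma carrier_tensor3_length: "\<A> \<in> carrier_tensor3 n1 n2 n3 \<Longrightarrow> length \<A> = n3"
  by (simp add: carrier_tensor3_def)

lemma transpose_carrier_tensor3: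
  "\<A> \<in> carrier_tensor3 n1 n2 n3 \<Longrightarrow> map transpose_mat \<A> \<in> carrier_tensor3 n2 n1 n3"
  by (auto simp: carrier_tensor3_def)

lemma unfold_23_1_carrier:
  assumes "\<A> \<in> carrier_tensor3 n1 n2 n3"
  shows "unfold_23_1 n1 \<A> \<in> carrier_mat (sum_list (map dim_col \<A>)) n1"
  using hcat_carrier[of n1 \<A>] by (simp add: unfold_23_1_def)

text \<open>Mode-1 multiplication becomes multiplication of the unfolding from the right. Relations
  that hold for all slices thus turn into one matrix identity, in which an injective unfolding can
  be cancelled.\<close>

lemma unfold_23_1_mode1_prod:
  fixes N :: "'a :: comm_semiring_0 mat"
  assumes \<A>: "\<A> \<in> carrier_tensor3 n1 n2 n3" and N: "N \<in> carrier_mat m n1"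
  shows "unfold_23_1 m (\<A> \<bullet>\<^sub>1 N) = unfold_23_1 n1 \<A> * transpose_mat N"
proof -
  have "hcat m (map (\<lambda>D. N * D) \<A>) = N * hcat n1 (map (\<lambda>D. D) \<A>)"
    by (rule mult_hcat[symmetric, OF N, where l = "\<lambda>_. n2"])
      (use \<A> in \<open>auto simp: carrier_tensor3_def\<close>)
  then show ?thesis
    unfolding unfold_23_1_def mode1_prod_def
    using transpose_mult[OF N hcat_carrier[of n1 \<A>]] by simp
qed

text \<open>Transposing the slices exchanges the two modes, so results on mode 1 also cover mode
  2.\<close>

lemma mode1_prod_transpose:
  fixes N :: "'a :: comm_semiring_0 mat"
  assumes \<A>: "\<A> \<in> carrier_tensor3 n1 n2 n3" and N: "N \<in> carrier_mat m n2"
  shows "map transpose_mat (\<A> \<bullet>\<^sub>2 N) = map transpose_mat \<A> \<bullet>\<^sub>1 N"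
proof -
  have "transpose_mat (D * transpose_mat N) = N * transpose_mat D" if "D \<in> set \<A>" for D
    using transpose_mult[of D n1 n2 "transpose_mat N" m] that \<A> N
    by (auto simp: carrier_tensor3_def)
  then show ?thesis by (simp add: mode1_prod_def mode2_prod_def)
qed

lemma unfold_23_1_inject:
  assumes \<A>: "\<A> \<in> carrier_tensor3 n1 n2 n3" and \<B>: "\<B> \<in> carrier_tensor3 n1 n2 n3"
    and eq: "unfold_23_1 n1 \<A> = unfold_23_1 n1 \<B>"
  shows "\<A> = \<B>"
proof -
  have l: "length \<A> = n3" "length \<B> = n3" using \<A> \<B> by (auto simp: carrier_tensor3_def)
  have "hcat n1 \<A> = hcat n1 \<B>"
    using arg_cong[OF eq, of transpose_mat] by (simp add: unfold_23_1_def)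
  then have "hcat n1 (map ((!) \<A>) [0..<n3]) = hcat n1 (map ((!) \<B>) [0..<n3])"
    using l by (metis map_nth)
  then have "\<forall>i\<in>set [0..<n3]. \<A> ! i = \<B> ! i"
    by (subst (asm) hcat_eq_iff[where l = "\<lambda>_. n2"]) (use \<A> \<B> in \<open>auto simp: carrier_tensor3_nth\<close>)
  then show ?thesis using l by (intro nth_equalityI) auto
qed

section \<open>Rank, injectivity and kernel bases\<close>

text \<open>Full column rank as triviality of the kernel, the form that is stable under products and
  permits cancellation on the left.\<close>

definition injective_mat :: "'a :: semiring_0 mat \<Rightarrow> bool" where
  "injective_mat A \<longleftrightarrow>
     (\<forall>v\<in>carrier_vec (dim_col A). A *\<^sub>v v = 0\<^sub>v (dim_row A) \<longrightarrow> v = 0\<^sub>v (dim_col A))"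

lemma injective_matI:
  assumes "A \<in> carrier_mat m n"
    and "\<And>v. v \<in> carrier_vec n \<Longrightarrow> A *\<^sub>v v = 0\<^sub>v m \<Longrightarrow> v = 0\<^sub>v n"
  shows "injective_mat A"
  using assms by (auto simp: injective_mat_def)

lemma injective_matD:
  assumes "injective_mat A" "A \<in> carrier_mat m n" "v \<in> carrier_vec n" "A *\<^sub>v v = 0\<^sub>v m"
  shows "v = 0\<^sub>v n"
  using assms by (auto simp: injective_mat_def)

lemma injective_mat_mult:
  fixes A B :: "'a :: comm_semiring_0 mat"
  assumes "A \<in> carrier_mat m n" "B \<in> carrier_mat n k" "injective_mat A" "injective_mat B"
  shows "injective_mat (A * B)"
proof (rule injective_matI)
  show "A * B \<in> carrier_mat m k" using assms by simp
next
  fix v assume v: "v \<in> carrier_vec k" "(A * B) *\<^sub>v v = 0\<^sub>v m"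
  then have "A *\<^sub>v (B *\<^sub>v v) = 0\<^sub>v m" using assms by (simp add: assoc_mult_mat_vec)
  then have "B *\<^sub>v v = 0\<^sub>v n" by (rule injective_matD[OF assms(3,1), rotated]) (use assms v in auto)
  then show "v = 0\<^sub>v k" by (rule injective_matD[OF assms(4,2) v(1)])
qed

lemma injective_mat_left_inverse:
  fixes A B :: "'a :: comm_semiring_1 mat"
  assumes A: "A \<in> carrier_mat m n" and B: "B \<in> carrier_mat n m" and "B * A = 1\<^sub>m n"
  shows "injective_mat A"
proof (rule injective_matI[OF A])
  fix v assume v: "v \<in> carrier_vec n" "A *\<^sub>v v = 0\<^sub>v m"
  have "v = (B * A) *\<^sub>v v" using assms(3) v by simp
  also have "\<dots> = B *\<^sub>v (A *\<^sub>v v)" using A B v by (simp add: assoc_mult_mat_vec)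
  also have "\<dots> = 0\<^sub>v n" using v B by (intro eq_vecI) auto
  finally show "v = 0\<^sub>v n" .
qed

lemma injective_mat_cancel:
  fixes A :: "'a :: comm_ring_1 mat"
  assumes A: "A \<in> carrier_mat m n" and N: "N \<in> carrier_mat n k" "N' \<in> carrier_mat n k"
    and inj: "injective_mat A" and eq: "A * N = A * N'"
  shows "N = N'"
proof (rule eq_matI)
  fix i j assume "i < dim_row N'" "j < dim_col N'"
  with N have ij: "i < n" "j < k" by auto
  have "A *\<^sub>v col N j = A *\<^sub>v col N' j"
    using arg_cong[OF eq, of "\<lambda>X. col X j"] col_mult2[OF A N(1) ij(2)] col_mult2[OF A N(2) ij(2)]
    by simp
  then have "A *\<^sub>v (col N j - col N' j) = 0\<^sub>v m"
    using A N by (subst mult_minus_distrib_mat_vec[of _ m n]) auto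
  then have "col N j - col N' j = 0\<^sub>v n"
    by (rule injective_matD[OF inj A, rotated]) (use N in \<open>auto intro!: minus_carrier_vec\<close>)
  then have "(col N j - col N' j) $ i = 0" using ij by simp
  then show "N $$ (i, j) = N' $$ (i, j)" using ij N by simp
qed (use N in auto)

lemma injective_mat_mult_zero:
  fixes A :: "'a :: comm_ring_1 mat"
  assumes "A \<in> carrier_mat m n" "N \<in> carrier_mat n k" "injective_mat A" "A * N = 0\<^sub>m m k"
  shows "N = 0\<^sub>m n k"
  by (rule injective_mat_cancel[of A m n _ k]) (use assms in auto)

lemma mult_unit_vec_col:
  fixes A :: "'a :: semiring_1 mat"
  assumes "A \<in> carrier_mat m n" "j < n"
  shows "A *\<^sub>v unit_vec n j = col A j"
  using assms by (intro eq_vecI) auto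

lemma injective_mat_distinct_cols:
  fixes A :: "'a :: comm_ring_1 mat"
  assumes A: "A \<in> carrier_mat m n" and inj: "injective_mat A"
  shows "distinct (cols A)"
proof (unfold distinct_conv_nth, intro allI impI)
  fix i j assume "i < length (cols A)" "j < length (cols A)" "i \<noteq> j"
  with A have ij: "i < n" "j < n" "i \<noteq> j" by auto
  show "cols A ! i \<noteq> cols A ! j"
  proof
    assume "cols A ! i = cols A ! j"
    then have "col A i = col A j" using ij A by simp
    then have "A *\<^sub>v unit_vec n i - A *\<^sub>v unit_vec n j = 0\<^sub>v m"
      using A ij by (simp add: mult_unit_vec_col)
    then have "A *\<^sub>v (unit_vec n i - unit_vec n j) = 0\<^sub>v m"
      by (subst mult_minus_distrib_mat_vec[OF A]) simp_all
    then have "unit_vec n i - unit_vec n j = (0\<^sub>v n :: 'a vec)"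
      by (rule injective_matD[OF inj A, rotated]) simp
    then have "(unit_vec n i - unit_vec n j) $ i = (0\<^sub>v n :: 'a vec) $ i" by simp
    then show False using ij by simp
  qed
qed

text \<open>Linear dependence is a property of the set of columns, in which a repeated column leaves
  no trace; hence the condition on distinctness, which injective matrices satisfy by
  \<open>injective_mat_distinct_cols\<close>.\<close>

lemma lin_indpt_cols_iff:
  fixes A :: "'a :: field mat"
  assumes A: "A \<in> carrier_mat m n" and d: "distinct (cols A)"
  shows "module.lin_dep class_ring (module_vec TYPE('a) m) (set (cols A)) \<longleftrightarrow> \<not> injective_mat A"
proof -
  interpret vec_space "TYPE('a)" m .
  show ?thesis
    using lin_depI[OF A _ _ _ d] lin_depE[OF A _ d] A unfolding injective_mat_def by auto
qed

lemma full_column_rank_iff_injective: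
  fixes A :: "'a :: field mat"
  shows "full_column_rank A \<longleftrightarrow> injective_mat A"
proof -
  define m n where "m = dim_row A" and "n = dim_col A"
  have A: "A \<in> carrier_mat m n" by (simp add: m_def n_def)
  interpret vec_space "TYPE('a)" m .
  show ?thesis
  proof
    assume "full_column_rank A"
    then have r: "rank A = n" by (simp add: full_column_rank_def mat_rank_def m_def n_def)
    \<comment> \<open>The rank cannot exceed the number of different columns, so rank
      \<open>n\<close> forces the \<open>n\<close> columns to be pairwise distinct.\<close>
    have "rank A \<le> card (set (cols A))"
    proof -
      obtain S where S: "maximal S (\<lambda>T. T \<subseteq> set (cols A) \<and> lin_indpt T)"
        using maximal_exists_superset[of "set (cols A)" "\<lambda>T. T \<subseteq> set (cols A) \<and> lin_indpt T" "{}"]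
        by (auto simp: lin_dep_def)
      then have "rank A = card S" by (rule rank_card_indpt[OF A])
      moreover have "S \<subseteq> set (cols A)" using S by (simp add: maximal_def)
      ultimately show ?thesis by (simp add: card_mono)
    qed
    then have "distinct (cols A)"
      using r A card_length[of "cols A"] by (intro card_distinct) auto
    then show "injective_mat A"
      using full_rank_lin_indpt[OF A r] lin_indpt_cols_iff[OF A] by simp
  next
    assume inj: "injective_mat A"
    then have d: "distinct (cols A)" by (rule injective_mat_distinct_cols[OF A])
    with inj have "lin_indpt (set (cols A))" using lin_indpt_cols_iff[OF A] by simp
    then show "full_column_rank A"
      using lin_indpt_full_rank[OF A d] A by (simp add: full_column_rank_def mat_rank_def)
  qed
qed

text \<open>The columns of G * H lie in the span of the l columns of G, and the exchange theorem
  bounds the size of an independent set among them.\<close>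

lemma mat_rank_mult_le:
  fixes G H :: "'a :: field mat"
  assumes G: "G \<in> carrier_mat m l" and H: "H \<in> carrier_mat l n"
  shows "mat_rank (G * H) \<le> l"
proof -
  interpret vec_space "TYPE('a)" m .
  have GH: "G * H \<in> carrier_mat m n" using G H by simp
  obtain S where S: "maximal S (\<lambda>T. T \<subseteq> set (cols (G * H)) \<and> lin_indpt T)"
    using maximal_exists_superset[of "set (cols (G * H))"
        "\<lambda>T. T \<subseteq> set (cols (G * H)) \<and> lin_indpt T" "{}"]
    by (auto simp: lin_dep_def)
  have r: "rank (G * H) = card S" by (rule rank_card_indpt[OF GH S])
  have S': "S \<subseteq> set (cols (G * H))" "lin_indpt S" using S by (auto simp: maximal_def)
  have "set (cols (G * H)) \<subseteq> span (set (cols G))"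
  proof
    fix v assume "v \<in> set (cols (G * H))"
    then obtain j where j: "j < n" "v = col (G * H) j"
      using GH by (metis carrier_matD(2) cols_length cols_nth in_set_conv_nth)
    then have "v = G *\<^sub>v col H j" using G H by auto
    then have "v \<in> col_space G"
      using G H j unfolding col_space_eq[OF G] by auto
    then show "v \<in> span (set (cols G))" by (simp add: col_space_def)
  qed
  then have sp: "S \<subseteq> span (set (cols G))" using S'(1) by blast
  have "set (cols G) \<subseteq> carrier_vec m" using cols_dim[of G] G by simp
  from replacement[OF finite_subset[OF S'(1) finite_set] finite_set this S'(2) sp]
  obtain C :: "'a vec set" where "int (card C) \<le> int (card (set (cols G))) - int (card S)"
    by (elim exE conjE) (rule that)
  then have "card S \<le> card (set (cols G))" by linarith
  also have "\<dots> \<le> l" using card_length[of "cols G"] G by simp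
  finally show ?thesis using r G by (simp add: mat_rank_def)
qed

text \<open>The right inverse of H makes H surjective, so G * H and G have the same column space,
  and the l columns of G are independent.\<close>

lemma mat_rank_mult_eq:
  fixes G H :: "'a :: field mat"
  assumes G: "G \<in> carrier_mat m l" and H: "H \<in> carrier_mat l n" and K: "K \<in> carrier_mat n l"
    and inj: "injective_mat G" and HK: "H * K = 1\<^sub>m l"
  shows "mat_rank (G * H) = l"
proof -
  interpret vec_space "TYPE('a)" m .
  have GH: "G * H \<in> carrier_mat m n" using G H by simp
  have "col_space (G * H) = col_space G"
  proof (intro equalityI subsetI)
    fix v assume "v \<in> col_space (G * H)"
    then obtain w where "w \<in> carrier_vec n" "v = (G * H) *\<^sub>v w"
      unfolding col_space_eq[OF GH] using GH by auto
    then have "v = G *\<^sub>v (H *\<^sub>v w)" "H *\<^sub>v w \<in> carrier_vec l" "v \<in> carrier_vec m" using G H by auto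
    then show "v \<in> col_space G" unfolding col_space_eq[OF G] using G by auto
  next
    fix v assume "v \<in> col_space G"
    then obtain w where w: "w \<in> carrier_vec l" "v = G *\<^sub>v w"
      unfolding col_space_eq[OF G] using G by auto
    have "(G * H) *\<^sub>v (K *\<^sub>v w) = G *\<^sub>v ((H * K) *\<^sub>v w)"
      using G H K w by (simp add: assoc_mult_mat_vec[of _ _ l] assoc_mult_mat_vec[of _ _ n])
    also have "\<dots> = v" using HK w by simp
    finally show "v \<in> col_space (G * H)" unfolding col_space_eq[OF GH]
      using G H K w by (auto intro!: bexI[of _ "K *\<^sub>v w"])
  qed
  then have "rank (G * H) = rank G" by (simp add: rank_def col_space_def)
  also have "\<dots> = l"
    using inj G unfolding full_column_rank_iff_injective[symmetric] by (simp add: full_column_rank_def mat_rank_def)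
  finally show ?thesis using G by (simp add: mat_rank_def)
qed

text \<open>Each identity matrix factors through the other dimension, so each dimension bounds the
  other. This supplies the dimension count in the primary decomposition.\<close>

lemma inverse_pair_square:
  fixes A B :: "'a :: field mat"
  assumes A: "A \<in> carrier_mat m n" and B: "B \<in> carrier_mat n m"
    and "A * B = 1\<^sub>m m" "B * A = 1\<^sub>m n"
  shows "m = n"
proof -
  have r: "mat_rank (1\<^sub>m k :: 'a mat) = k" for k
    using mat_rank_mult_eq[of "1\<^sub>m k" k k "1\<^sub>m k" k "1\<^sub>m k"] injective_mat_left_inverse[of "1\<^sub>m k" k k "1\<^sub>m k"]
    by simp
  show ?thesis
    using mat_rank_mult_le[OF A B] mat_rank_mult_le[OF B A] r[of m] r[of n] assms(3,4) by simp
qed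

text \<open>Turns the locale notion of a basis of the kernel into matrix conditions, which can be
  checked after multiplication by a transition matrix.\<close>

lemma cols_form_kernel_basis_iff:
  fixes S K :: "'a :: field mat"
  assumes S: "S \<in> carrier_mat n l" and K: "K \<in> carrier_mat m n"
  shows "cols_form_kernel_basis S K \<longleftrightarrow> K * S = 0\<^sub>m m l \<and> injective_mat S \<and>
    (\<forall>v\<in>carrier_vec n. K *\<^sub>v v = 0\<^sub>v m \<longrightarrow> (\<exists>w\<in>carrier_vec l. v = S *\<^sub>v w))"
proof -
  interpret kernel m n K by unfold_locales (rule K)
  have sub: "set (cols S) \<subseteq> mat_kernel K \<longleftrightarrow> K * S = 0\<^sub>m m l"
  proof -
    have "set (cols S) \<subseteq> mat_kernel K \<longleftrightarrow> (\<forall>j<l. K *\<^sub>v col S j = 0\<^sub>v m)"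
    proof -
      have "set (cols S) = col S ` {..<l}" using S by (auto simp: cols_def)
      moreover have "col S j \<in> carrier_vec n" for j using S by auto
      ultimately show ?thesis unfolding mat_kernel[OF K] by (simp add: image_subset_iff Ball_def)
    qed
    also have "\<dots> \<longleftrightarrow> (\<forall>j<l. col (K * S) j = 0\<^sub>v m)"
      by (metis col_mult2[OF K S])
    also have "\<dots> \<longleftrightarrow> K * S = 0\<^sub>m m l"
    proof
      assume *: "\<forall>j<l. col (K * S) j = 0\<^sub>v m"
      show "K * S = 0\<^sub>m m l"
      proof (rule eq_matI)
        fix i j assume "i < dim_row (0\<^sub>m m l :: 'a mat)" "j < dim_col (0\<^sub>m m l :: 'a mat)"
        then have "col (K * S) j $ i = 0" "i < m" "j < l" using * by auto
        then show "(K * S) $$ (i, j) = 0\<^sub>m m l $$ (i, j)" using S K by simp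
      qed (use S K in auto)
    qed simp
    finally show ?thesis .
  qed
  have span: "span (set (cols S)) = {S *\<^sub>v w |w. w \<in> carrier_vec l}" if "set (cols S) \<subseteq> mat_kernel K"
  proof -
    have "span (set (cols S)) = NC.col_space S" unfolding span_same[OF that] NC.col_space_def ..
    also have "\<dots> = {S *\<^sub>v w |w. w \<in> carrier_vec l}" unfolding NC.col_space_eq[OF S] using S by auto
    finally show ?thesis .
  qed
  have "cols_form_kernel_basis S K \<longleftrightarrow> distinct (cols S) \<and> set (cols S) \<subseteq> mat_kernel K \<and>
      \<not> lin_dep (set (cols S)) \<and> span (set (cols S)) = mat_kernel K"
    using K by (auto simp: cols_form_kernel_basis_def Ker.basis_def)
  also have "\<dots> \<longleftrightarrow> set (cols S) \<subseteq> mat_kernel K \<and> injective_mat S \<and> mat_kernel K \<subseteq> {S *\<^sub>v w |w. w \<in> carrier_vec l}"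
  proof (cases "set (cols S) \<subseteq> mat_kernel K")
    case True
    have "span (set (cols S)) \<subseteq> mat_kernel K"
      using Ker.span_closed[OF True] by blast
    moreover have "distinct (cols S) \<and> \<not> lin_dep (set (cols S)) \<longleftrightarrow> injective_mat S"
      using lin_indpt_cols_iff[OF S] injective_mat_distinct_cols[OF S] unfolding lindep_same[OF True] by blast
    ultimately show ?thesis using True unfolding span[OF True] by blast
  qed auto
  also have "\<dots> \<longleftrightarrow> K * S = 0\<^sub>m m l \<and> injective_mat S \<and>
    (\<forall>v\<in>carrier_vec n. K *\<^sub>v v = 0\<^sub>v m \<longrightarrow> (\<exists>w\<in>carrier_vec l. v = S *\<^sub>v w))"
  proof -
    have "mat_kernel K \<subseteq> X \<longleftrightarrow> (\<forall>v\<in>carrier_vec n. K *\<^sub>v v = 0\<^sub>v m \<longrightarrow> v \<in> X)" for X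
      unfolding mat_kernel[OF K] by auto
    moreover have "v \<in> {S *\<^sub>v w |w. w \<in> carrier_vec l} \<longleftrightarrow> (\<exists>w\<in>carrier_vec l. v = S *\<^sub>v w)" for v
      by auto
    ultimately show ?thesis unfolding sub by simp
  qed
  finally show ?thesis .
qed

lemma cols_form_kernel_basis_dim:
  fixes S K :: "'a :: field mat"
  assumes S: "S \<in> carrier_mat n l" and K: "K \<in> carrier_mat m n" and b: "cols_form_kernel_basis S K"
  shows "kernel_dim K = l"
proof -
  interpret kernel m n K by unfold_locales (rule K)
  have "distinct (cols S)" "basis (set (cols S))" using b K by (auto simp: cols_form_kernel_basis_def)
  then have "dim = card (set (cols S))" by (intro Ker.dim_basis) auto
  then show ?thesis using \<open>distinct (cols S)\<close> S by (simp add: distinct_card)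
qed

lemma exists_kernel_basis_mat:
  fixes K :: "'a :: field mat"
  assumes K: "K \<in> carrier_mat m n"
  shows "\<exists>S. S \<in> carrier_mat n (kernel_dim K) \<and> cols_form_kernel_basis S K"
proof -
  interpret kernel m n K by unfold_locales (rule K)
  obtain B where B: "finite B" "basis B" using kernel_basis_exists[OF K] by auto
  then obtain vs where vs: "set vs = B" "distinct vs" using finite_distinct_list by blast
  have "set vs \<subseteq> carrier_vec n"
    using B(2) vs mat_kernel_carrier[OF K] by (auto simp: Ker.basis_def)
  then have c: "cols (mat_of_cols n vs) = vs" by simp
  have b: "cols_form_kernel_basis (mat_of_cols n vs) K"
    using B vs K by (auto simp: cols_form_kernel_basis_def c)
  have S: "mat_of_cols n vs \<in> carrier_mat n (length vs)" by simp
  show ?thesis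
    by (rule exI[of _ "mat_of_cols n vs"]) (use b S cols_form_kernel_basis_dim[OF S K b] in metis)
qed

section \<open>Primary decomposition\<close>

lemma euclidean_bezout:
  fixes f g :: "'a :: euclidean_ring"
  assumes "coprime f g"
  shows "\<exists>u v. u * f + v * g = 1"
  using assms
proof (induction "euclidean_size g" arbitrary: f g rule: less_induct)
  case less
  show ?case
  proof (cases "g = 0")
    case True
    with less.prems obtain u where "f * u = 1" by (auto simp: coprime_def elim!: dvdE[of f 1] dest: spec[of _ f])
    then show ?thesis by (auto simp: True mult.commute)
  next
    case False
    have "coprime g (f mod g)"
    proof (rule coprimeI)
      fix d assume d: "d dvd g" "d dvd f mod g"
      then have "d dvd f" by (simp add: dvd_mod_iff)
      then show "is_unit d" using coprime_common_divisor[OF less.prems _ d(1)] by blast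
    qed
    with less.hyps[of "f mod g" g] False mod_size_less[of g f]
    obtain u v where "u * g + v * (f mod g) = 1" by auto
    then have "v * f + (u - v * (f div g)) * g = 1"
      by (simp add: minus_div_mult_eq_mod[symmetric] algebra_simps)
    then show ?thesis by blast
  qed
qed

text \<open>Coprimality in the form of a Bezout identity: the ideals of f and g together generate
  the whole ring.\<close>

definition comaximal :: "'a :: comm_ring_1 \<Rightarrow> 'a \<Rightarrow> bool" where
  "comaximal f g \<longleftrightarrow> (\<exists>u v. u * f + v * g = 1)"

lemma comaximal_sym: "comaximal f g \<Longrightarrow> comaximal g f"
  unfolding comaximal_def by (metis add.commute)

lemma comaximal_one [simp]: "comaximal 1 g"
  unfolding comaximal_def by (rule exI[of _ 1], rule exI[of _ 0]) simp

text \<open>Multiply the two Bezout identities and collect everything except u u' f f' as a multiple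
  of g.\<close>

lemma comaximal_mult:
  assumes "comaximal f g" "comaximal f' g"
  shows "comaximal (f * f') g"
proof -
  from assms obtain u v u' v' where "u * f + v * g = 1" "u' * f' + v' * g = 1"
    unfolding comaximal_def by blast
  then have "(u * f + v * g) * (u' * f' + v' * g) = 1" by simp
  then have "(u * u') * (f * f') + (u * f * v' + v * (u' * f' + v' * g)) * g = 1"
    by (simp add: algebra_simps)
  then show ?thesis unfolding comaximal_def by blast
qed

lemma comaximal_power: "comaximal f g \<Longrightarrow> comaximal (f ^ k) g"
  by (induction k) (auto intro: comaximal_mult)

lemma comaximal_prod:
  "(\<And>i. i \<in> I \<Longrightarrow> comaximal (f i) g) \<Longrightarrow> comaximal (\<Prod>i\<in>I. f i) g"
  by (induction I rule: infinite_finite_induct) (auto intro: comaximal_mult)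

text \<open>Multiply the Bezout identity by x: each of the two summands is divisible by f *
  g.\<close>

lemma comaximal_mult_dvd:
  assumes "comaximal f g" "f dvd x" "g dvd x"
  shows "f * g dvd x"
proof -
  obtain u v where "u * f + v * g = 1" using assms(1) by (auto simp: comaximal_def)
  then have x: "x = u * (f * x) + v * (x * g)"
    by (metis distrib_right mult.assoc mult.commute mult_1)
  have "f * g dvd f * x" "f * g dvd x * g" using assms(2,3) by (auto intro: mult_dvd_mono)
  then have "f * g dvd u * (f * x) + v * (x * g)" by (rule dvd_add[OF dvd_mult dvd_mult])
  then show ?thesis using x by simp
qed

lemma comaximal_prod_dvd:
  assumes "finite I" "\<And>i j. i \<in> I \<Longrightarrow> j \<in> I \<Longrightarrow> i \<noteq> j \<Longrightarrow> comaximal (f i) (f j)"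
    and "\<And>i. i \<in> I \<Longrightarrow> f i dvd x"
  shows "(\<Prod>i\<in>I. f i) dvd x"
  using assms
proof (induction I)
  case empty
  then show ?case by simp
next
  case (insert a I)
  have "comaximal (f a) (\<Prod>i\<in>I. f i)"
    by (rule comaximal_sym, rule comaximal_prod) (use insert in auto)
  then have "f a * (\<Prod>i\<in>I. f i) dvd x"
    by (rule comaximal_mult_dvd) (use insert in auto)
  then show ?case using insert by simp
qed

text \<open>A common divisor that is not a unit would be associated to both polynomials; they would
  divide each other and coincide, being monic.\<close>

lemma comaximal_irreducible:
  fixes p q :: "'a :: field poly"
  assumes p: "irreducible p" "lead_coeff p = 1" and q: "irreducible q" "lead_coeff q = 1" and ne: "p \<noteq> q"
  shows "comaximal p q"
proof -
  have "coprime p q"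
  proof (rule coprimeI)
    fix d assume d: "d dvd p" "d dvd q"
    show "is_unit d"
    proof (rule ccontr)
      assume "\<not> is_unit d"
      then have "p dvd d" "q dvd d" using irreducibleD' p(1) q(1) d by blast+
      then have "p dvd q" "q dvd p" using d by (blast intro: dvd_trans)+
      then have "p = q" using p(2) q(2) by (intro poly_dvd_antisym) auto
      with ne show False by simp
    qed
  qed
  then show ?thesis unfolding comaximal_def by (rule euclidean_bezout)
qed

lemma irreducible_factorization_comaximal:
  assumes "irreducible_factorization q R p \<mu>" "r < R" "s < R" "r \<noteq> s"
  shows "comaximal (p r ^ \<mu> r) (p s ^ \<mu> s)"
proof -
  have "p r \<noteq> p s" using assms by (auto simp: irreducible_factorization_def inj_on_def)
  then have "comaximal (p r) (p s)"
    using assms by (intro comaximal_irreducible) (auto simp: irreducible_factorization_def)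
  then show ?thesis by (rule comaximal_power[OF comaximal_sym[OF comaximal_power[OF comaximal_sym]]])
qed

lemma poly_mat_sum:
  fixes M :: "'a :: comm_ring_1 mat"
  assumes M: "M \<in> carrier_mat n n" and "i < n" "j < n"
  shows "poly_mat (\<Sum>x\<in>X. f x) M $$ (i, j) = (\<Sum>x\<in>X. poly_mat (f x) M $$ (i, j))"
proof -
  have "poly_mat 0 M $$ (i, j) = 0" using assms by (simp add: poly_mat_0[OF M])
  moreover have "poly_mat (p + q) M $$ (i, j) = poly_mat p M $$ (i, j) + poly_mat q M $$ (i, j)" for p q
    unfolding poly_mat_add[OF M] using assms by simp
  ultimately show ?thesis by (induction X rule: infinite_finite_induct) auto
qed

text \<open>If g = h f then g(M) N = h(M) (f(M) N). For N = 1 this concerns annihilation of M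
  itself, for N = S_r annihilation on the subspace spanned by the columns of S_r.\<close>

lemma poly_mat_dvd_zero:
  fixes M :: "'a :: comm_ring_1 mat"
  assumes M: "M \<in> carrier_mat n n" and N: "N \<in> carrier_mat n k"
    and z: "poly_mat f M * N = 0\<^sub>m n k" and "f dvd g"
  shows "poly_mat g M * N = 0\<^sub>m n k"
proof -
  obtain h where h: "g = h * f" using \<open>f dvd g\<close> by (metis dvd_def mult.commute)
  have "poly_mat g M * N = poly_mat h M * (poly_mat f M * N)"
    unfolding h poly_mat_mult[OF M]
    by (rule assoc_mult_mat[OF poly_mat_carrier[OF M] poly_mat_carrier[OF M] N])
  then show ?thesis using z right_mult_zero_mat[OF poly_mat_carrier[OF M, of h]] by simp
qed

lemma mat_inv_unique:
  fixes A :: "'a :: field mat"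
  assumes A: "A \<in> carrier_mat n n" and B: "B \<in> carrier_mat n n" and AB: "A * B = 1\<^sub>m n"
  shows "mat_inv A = B" "invertible_mat A"
proof -
  have BA: "B * A = 1\<^sub>m n" by (rule mat_mult_left_right_inverse[OF A B AB])
  have "A \<in> Units (ring_mat TYPE('a) n ())"
    using A B AB BA by (auto simp: Units_def ring_mat_def)
  with mat_inverse(1)[OF A] obtain C where C: "mat_inverse A = Some C" by fastforce
  with mat_inverse(2)[OF A] have "A * C = 1\<^sub>m n" "C \<in> carrier_mat n n" by auto
  then have "C = (B * A) * C" using BA by simp
  also have "\<dots> = B * (A * C)" by (rule assoc_mult_mat[OF B A \<open>C \<in> carrier_mat n n\<close>])
  finally have "C = B" using B \<open>A * C = 1\<^sub>m n\<close> by simp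
  then show "mat_inv A = B" using C by (simp add: mat_inv_def)
  show "invertible_mat A"
    using A B AB BA unfolding invertible_mat_def inverts_mat_def by auto
qed

lemma invertible_mat_obtain_inverse:
  fixes A :: "'a :: field mat"
  assumes "invertible_mat A" "A \<in> carrier_mat m n"
  obtains B where "m = n" "B \<in> carrier_mat n n" "A * B = 1\<^sub>m n" "B * A = 1\<^sub>m n" "mat_inv A = B"
proof -
  have mn: "m = n" using assms by (auto simp: invertible_mat_def)
  obtain B where B: "A * B = 1\<^sub>m n" "B * A = 1\<^sub>m (dim_row B)"
    using assms unfolding invertible_mat_def inverts_mat_def by (auto simp: mn)
  have "dim_col B = n" using arg_cong[OF B(1), of dim_col] by simp
  moreover have "dim_row B = n" using arg_cong[OF B(2), of dim_col] assms(2) by simp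
  ultimately have "B \<in> carrier_mat n n" by auto
  moreover from this have "mat_inv A = B" using mat_inv_unique(1)[of A n B] assms(2) B mn by simp
  ultimately show ?thesis using that B mn by auto
qed

text \<open>Each column of E lies in the kernel, hence is a combination of the columns of S; the
  coefficient vectors form Y. For E the projection onto a primary subspace, Y is a block row of the
  inverse of [S_0 ... S_(R-1)].\<close>

lemma kernel_basis_factor:
  fixes S K E :: "'a :: field mat"
  assumes S: "S \<in> carrier_mat n l" and K: "K \<in> carrier_mat m n" and b: "cols_form_kernel_basis S K"
    and E: "E \<in> carrier_mat n k" and KE: "K * E = 0\<^sub>m m k"
  shows "\<exists>Y. Y \<in> carrier_mat l k \<and> S * Y = E"
proof -
  have "\<exists>w. w \<in> carrier_vec l \<and> col E j = S *\<^sub>v w" if j: "j < k" for j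
  proof -
    have "K *\<^sub>v col E j = col (K * E) j" using col_mult2[OF K E j] by simp
    also have "\<dots> = 0\<^sub>v m" using KE j by simp
    finally have "K *\<^sub>v col E j = 0\<^sub>v m" .
    moreover have "col E j \<in> carrier_vec n" using E by auto
    ultimately show ?thesis using b unfolding cols_form_kernel_basis_iff[OF S K] by blast
  qed
  then obtain w where w: "\<And>j. j < k \<Longrightarrow> w j \<in> carrier_vec l \<and> col E j = S *\<^sub>v w j" by metis
  define Y where "Y = mat l k (\<lambda>(i, j). w j $ i)"
  have Y: "Y \<in> carrier_mat l k" by (simp add: Y_def)
  have "S * Y = E"
  proof (rule eq_matI)
    fix i j assume "i < dim_row E" "j < dim_col E"
    then have ij: "i < n" "j < k" using E by auto
    have "col Y j = w j" using w[OF ij(2)] ij by (intro eq_vecI) (auto simp: Y_def)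
    then have "(S * Y) $$ (i, j) = (S *\<^sub>v w j) $ i" using S Y ij by simp
    also have "\<dots> = E $$ (i, j)" using w[OF ij(2)] E ij by (metis index_col carrier_matD)
    finally show "(S * Y) $$ (i, j) = E $$ (i, j)" .
  qed (use S Y E in auto)
  with Y show ?thesis by blast
qed

lemma diag_block_mat_one:
  "diag_block_mat (map (\<lambda>r. 1\<^sub>m (l r)) rs) = 1\<^sub>m (sum_list (map l rs))"
  by (induction rs) (auto simp: Let_def)

lemma sum_list_upt: "(\<Sum>r\<leftarrow>[0..<R]. f r) = (\<Sum>r<R. f r)"
  by (simp add: interv_sum_list_conv_sum_set_nat atLeast0LessThan)

section \<open>Primary decompositions: existence and transport along a similarity\<close>

lemma primary_decomposition_iff:
  fixes M :: "'a :: field mat"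
  assumes M: "M \<in> carrier_mat n n"
  shows "primary_decomposition M R p \<mu> S T \<longleftrightarrow>
    (\<forall>r<R. S r \<in> carrier_mat n (primary_dim M (p r) (\<mu> r)) \<and>
      T r \<in> carrier_mat (primary_dim M (p r) (\<mu> r)) (primary_dim M (p r) (\<mu> r)) \<and>
      cols_form_kernel_basis (S r) (poly_mat (p r ^ \<mu> r) M) \<and> M * S r = S r * T r) \<and>
    invertible_mat (hcat n (map S [0..<R])) \<and>
    M = hcat n (map S [0..<R]) * diag_block_mat (map T [0..<R]) * mat_inv (hcat n (map S [0..<R]))"
  unfolding primary_decomposition_def Let_def carrier_matD(1)[OF M] poly_mat_power[OF M] by (rule refl)

text \<open>The projections onto the subspaces Null(p_r(M)^mu_r) are polynomials in M given by the
  Chinese remainder theorem. Factoring the r-th one as S_r Y_r, with S_r a basis of the kernel,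
  produces the inverse of S block by block.\<close>

lemma primary_decomposition_exists:
  fixes M :: "'a :: field mat"
  assumes M: "M \<in> carrier_mat n n" and q: "is_min_poly M q"
    and fact: "irreducible_factorization q R p \<mu>"
  shows "\<exists>S T. primary_decomposition M R p \<mu> S T \<and> (\<forall>r<R. is_min_poly (T r) (p r ^ \<mu> r))"
proof -
  let ?rs = "[0..<R]"
  define P where "P r = p r ^ \<mu> r" for r
  define Q where "Q r = (\<Prod>s\<in>{..<R}-{r}. P s)" for r
  define K where "K r = poly_mat (p r) M ^\<^sub>m \<mu> r" for r
  define l where "l r = primary_dim M (p r) (\<mu> r)" for r
  have K: "K r = poly_mat (P r) M" for r by (simp add: K_def P_def poly_mat_power[OF M])
  have Kc: "K r \<in> carrier_mat n n" for r unfolding K by (rule poly_mat_carrier[OF M])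
  have com: "comaximal (P r) (P s)" if "r < R" "s < R" "r \<noteq> s" for r s
    unfolding P_def by (rule irreducible_factorization_comaximal[OF fact that])
  have qPQ: "q = P r * Q r" if "r < R" for r
    using fact that by (auto simp: irreducible_factorization_def P_def Q_def prod.remove)
  have qM: "poly_mat q M = 0\<^sub>m n n" using q M by (simp add: is_min_poly_def)
  have "\<forall>r. \<exists>u v. r < R \<longrightarrow> u * P r + v * Q r = 1"
  proof
    fix r
    show "\<exists>u v. r < R \<longrightarrow> u * P r + v * Q r = 1"
    proof (cases "r < R")
      case True
      then have "comaximal (Q r) (P r)" unfolding Q_def by (intro comaximal_prod com) auto
      then show ?thesis using comaximal_sym unfolding comaximal_def by blast
    qed blast
  qed
  then obtain u v where uv: "\<And>r. r < R \<Longrightarrow> u r * P r + v r * Q r = 1" by metis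
  \<comment> \<open>Idempotents of the Chinese remainder theorem: \<open>e r\<close> is 1 modulo
    \<open>P r\<close> and 0 modulo every other \<open>P s\<close>.\<close>
  define e where "e r = v r * Q r" for r
  define E where "E r = poly_mat (e r) M" for r
  have Ec: "E r \<in> carrier_mat n n" for r unfolding E_def by (rule poly_mat_carrier[OF M])
  have PQ: "P s dvd Q r" if "s < R" "s \<noteq> r" for r s
    unfolding Q_def using that by (intro dvd_prodI) auto
  have Pe: "P s dvd e r" if "s < R" "s \<noteq> r" for r s
    unfolding e_def using PQ[OF that] by simp
  have e1: "1 - e r = u r * P r" if "r < R" for r
    using uv[OF that] by (simp add: e_def algebra_simps)
  \<comment> \<open>The sum is 1 modulo each \<open>P s\<close>, hence modulo their product
    \<open>q\<close>; evaluated at \<open>M\<close>, the projections add up to the identity.\<close>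
  have "q dvd (\<Sum>r<R. e r) - 1"
  proof -
    have "P s dvd (\<Sum>r<R. e r) - 1" if s: "s < R" for s
    proof -
      have "(\<Sum>r<R. e r) - 1 = (\<Sum>r\<in>{..<R}-{s}. e r) - (1 - e s)"
        using s by (simp add: sum.remove[of "{..<R}" s])
      moreover have "P s dvd (\<Sum>r\<in>{..<R}-{s}. e r)" using s Pe by (intro dvd_sum) auto
      ultimately show ?thesis using e1[OF s] by (simp add: dvd_diff)
    qed
    then have "(\<Prod>s<R. P s) dvd (\<Sum>r<R. e r) - 1" by (intro comaximal_prod_dvd com) auto
    then show ?thesis using fact by (simp add: irreducible_factorization_def P_def)
  qed
  then have "poly_mat ((\<Sum>r<R. e r) - 1) M * 1\<^sub>m n = 0\<^sub>m n n"
    by (rule poly_mat_dvd_zero[OF M one_carrier_mat, rotated]) (simp add: qM)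
  then have Z: "poly_mat (\<Sum>r<R. e r) M - 1\<^sub>m n = 0\<^sub>m n n"
    using M by (simp add: poly_mat_diff[OF M] poly_mat_1[OF M])
  have sumE: "(\<Sum>r<R. E r $$ (i, j)) = 1\<^sub>m n $$ (i, j)" if "i < n" "j < n" for i j
    using arg_cong[OF Z, of "\<lambda>X. X $$ (i, j)"] that M poly_mat_sum[OF M that, of e "{..<R}"]
    by (simp add: E_def)
  \<comment> \<open>The factor \<open>Q r\<close> of \<open>e r\<close> completes \<open>P r\<close>
    to \<open>q\<close>, so the columns of \<open>E r\<close> lie in the r-th kernel and
    \<open>E r\<close> factors through \<open>S r\<close>.\<close>
  have KE: "K r * E r = 0\<^sub>m n n" if "r < R" for r
  proof -
    have "q dvd P r * e r" using qPQ[OF that] by (simp add: e_def mult.left_commute)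
    then have "poly_mat (P r * e r) M * 1\<^sub>m n = 0\<^sub>m n n"
      by (rule poly_mat_dvd_zero[OF M one_carrier_mat, rotated]) (simp add: qM)
    then show ?thesis using M Kc Ec by (simp add: K E_def poly_mat_mult[OF M])
  qed
  have "\<forall>r. \<exists>S. S \<in> carrier_mat n (l r) \<and> cols_form_kernel_basis S (K r)"
    using exists_kernel_basis_mat[OF Kc] by (auto simp: l_def primary_dim_def K_def)
  then obtain S where S: "\<And>r. S r \<in> carrier_mat n (l r)" "\<And>r. cols_form_kernel_basis (S r) (K r)"
    by metis
  have injS: "injective_mat (S r)" and KS: "K r * S r = 0\<^sub>m n (l r)" for r
    using S(2)[of r] unfolding cols_form_kernel_basis_iff[OF S(1) Kc] by auto
  have "\<forall>r. \<exists>Y. r < R \<longrightarrow> Y \<in> carrier_mat (l r) n \<and> S r * Y = E r"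
    using kernel_basis_factor[OF S(1) Kc S(2) Ec KE] by blast
  then obtain Y where Y: "\<And>r. r < R \<Longrightarrow> Y r \<in> carrier_mat (l r) n" "\<And>r. r < R \<Longrightarrow> S r * Y r = E r"
    by metis
  have ES0: "E r * S s = 0\<^sub>m n (l s)" if "s < R" "s \<noteq> r" for r s
    unfolding E_def by (rule poly_mat_dvd_zero[OF M S(1) _ Pe[OF that]]) (simp add: K[symmetric] KS)
  have ES1: "E r * S r = S r" if "r < R" for r
  proof -
    have "P r dvd 1 - e r" using e1[OF that] by simp
    then have "poly_mat (1 - e r) M * S r = 0\<^sub>m n (l r)"
      by (rule poly_mat_dvd_zero[OF M S(1), rotated]) (simp add: K[symmetric] KS)
    then have "S r - E r * S r = 0\<^sub>m n (l r)"
      using S(1)[of r] Ec[of r]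
      by (simp add: poly_mat_diff[OF M] poly_mat_1[OF M] E_def[symmetric] minus_mult_distrib_mat[of _ n n])
    then show ?thesis
      using S(1)[of r] Ec[of r]
      by (intro eq_matI) (auto dest!: arg_cong[of _ _ "\<lambda>X. X $$ (_, _)"] simp: mat_eq_iff)
  qed
  \<comment> \<open>Cancelling the injective \<open>S r\<close> turns the action of
    \<open>E r\<close> on the bases into biorthogonality of \<open>Y\<close> and
    \<open>S\<close>.\<close>
  have YS0: "Y r * S s = 0\<^sub>m (l r) (l s)" if rs: "r < R" "s < R" "r \<noteq> s" for r s
  proof -
    have "S r * (Y r * S s) = E r * S s"
      using assoc_mult_mat[OF S(1) Y(1)[OF rs(1)] S(1)] Y(2)[OF rs(1)] by simp
    also have "\<dots> = 0\<^sub>m n (l s)" using rs by (intro ES0) auto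
    finally show ?thesis
      by (rule injective_mat_mult_zero[OF S(1) _ injS, rotated]) (use Y(1)[OF rs(1)] S(1)[of s] in simp)
  qed
  have YS1: "Y r * S r = 1\<^sub>m (l r)" if r: "r < R" for r
  proof (rule injective_mat_cancel[OF S(1) _ _ injS])
    show "S r * (Y r * S r) = S r * 1\<^sub>m (l r)"
      using assoc_mult_mat[OF S(1) Y(1)[OF r] S(1), of r] Y(2)[OF r] ES1[OF r] S(1)[of r] by simp
  qed (use Y(1)[OF r] S(1)[of r] in auto)
  define SS where "SS = hcat n (map S ?rs)"
  define W where "W = transpose_mat (hcat n (map (\<lambda>r. transpose_mat (Y r)) ?rs))"
  let ?L = "sum_list (map l ?rs)"
  have SSc: "SS \<in> carrier_mat n ?L" unfolding SS_def by (rule hcat_map_carrier) (rule S(1))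
  have Wc: "W \<in> carrier_mat ?L n"
    unfolding W_def transpose_carrier_mat by (rule hcat_map_carrier) (use Y(1) in auto)
  have "SS * W = 1\<^sub>m n"
  proof (rule eq_matI)
    fix i j assume "i < dim_row (1\<^sub>m n :: 'a mat)" "j < dim_col (1\<^sub>m n :: 'a mat)"
    then have ij: "i < n" "j < n" by auto
    have "(SS * W) $$ (i, j) = (\<Sum>r\<leftarrow>?rs. (S r * transpose_mat (transpose_mat (Y r))) $$ (i, j))"
      unfolding SS_def W_def by (rule hcat_mult_transpose_hcat[where l = l]) (use S(1) Y(1) ij in auto)
    also have "\<dots> = (\<Sum>r<R. E r $$ (i, j))" unfolding sum_list_upt by (intro sum.cong) (auto simp: Y(2))
    finally show "(SS * W) $$ (i, j) = 1\<^sub>m n $$ (i, j)" using sumE[OF ij] by simp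
  qed (use SSc Wc in auto)
  have "W * SS = diag_block_mat (map (\<lambda>r. transpose_mat (transpose_mat (Y r)) * S r) ?rs)"
    unfolding SS_def W_def
    by (rule transpose_hcat_mult_hcat[where k = l and l = l]) (use S(1) Y(1) YS0 in auto)
  also have "map (\<lambda>r. transpose_mat (transpose_mat (Y r)) * S r) ?rs = map (\<lambda>r. 1\<^sub>m (l r)) ?rs"
    using YS1 by auto
  finally have WSS: "W * SS = 1\<^sub>m ?L" unfolding diag_block_mat_one .
  \<comment> \<open>Here the kernel dimensions are seen to add up to \<open>n\<close>: only square
    matrices have a two-sided inverse.\<close>
  have Ln: "?L = n" using inverse_pair_square[OF SSc Wc \<open>SS * W = 1\<^sub>m n\<close> WSS] by simp
  note inv = mat_inv_unique[OF SSc[unfolded Ln] Wc[unfolded Ln] \<open>SS * W = 1\<^sub>m n\<close>]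
  \<comment> \<open>The compression of \<open>M\<close> to the r-th subspace. Since
    \<open>E r\<close> commutes with \<open>M\<close> and fixes \<open>S r\<close>, it satisfies
    \<open>M * S r = S r * T r\<close>.\<close>
  define T where "T r = Y r * (M * S r)" for r
  have Tc: "T r \<in> carrier_mat (l r) (l r)" if "r < R" for r
    unfolding T_def using Y(1)[OF that] M S(1)[of r] by simp
  have MS: "M * S r = S r * T r" if r: "r < R" for r
  proof -
    have "S r * T r = E r * (M * S r)"
      unfolding T_def using assoc_mult_mat[OF S(1) Y(1)[OF r] mult_carrier_mat[OF M S(1)]] Y(2)[OF r] by simp
    also have "\<dots> = E r * M * S r" using assoc_mult_mat[OF Ec M S(1)] by simp
    also have "E r * M = M * E r"
      using poly_mat_commute[OF M, of "e r" "[:0, 1:]"] by (simp add: poly_mat_X[OF M] E_def)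
    also have "M * E r * S r = M * S r" using assoc_mult_mat[OF M Ec S(1)] ES1[OF r] by simp
    finally show ?thesis by simp
  qed
  have fTS: "poly_mat f M * S r = S r * poly_mat f (T r)" if r: "r < R" for f r
    by (rule poly_mat_intertwine[OF M Tc[OF r] S(1) MS[OF r]])
  have "M = SS * diag_block_mat (map T ?rs) * W"
  proof -
    have "SS * diag_block_mat (map T ?rs) = hcat n (map (\<lambda>r. S r * T r) ?rs)"
      unfolding SS_def by (rule hcat_mult_diag[where k = l and l = l]) (use S(1) Tc in auto)
    also have "map (\<lambda>r. S r * T r) ?rs = map (\<lambda>r. M * S r) ?rs" using MS by auto
    also have "hcat n \<dots> = M * SS" unfolding SS_def by (rule mult_hcat[symmetric, OF M S(1)])
    finally have "SS * diag_block_mat (map T ?rs) * W = M * (SS * W)"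
      using assoc_mult_mat[OF M SSc Wc] by simp
    then show ?thesis using M \<open>SS * W = 1\<^sub>m n\<close> by simp
  qed
  then have "primary_decomposition M R p \<mu> S T"
    unfolding primary_decomposition_iff[OF M] SS_def[symmetric] l_def[symmetric] P_def[symmetric] K[symmetric] inv(1)
    using S Tc MS inv(2) by blast
  moreover have "is_min_poly (T r) (p r ^ \<mu> r)" if r: "r < R" for r
    unfolding is_min_poly_def
  proof (intro conjI allI impI)
    show "lead_coeff (p r ^ \<mu> r) = 1"
      using fact r by (simp add: irreducible_factorization_def lead_coeff_power)
    have "S r * poly_mat (P r) (T r) = 0\<^sub>m n (l r)"
      using fTS[OF r, of "P r"] KS[of r] by (simp add: K)
    then have "poly_mat (P r) (T r) = 0\<^sub>m (l r) (l r)"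
      by (rule injective_mat_mult_zero[OF S(1) poly_mat_carrier[OF Tc[OF r]] injS])
    then show "poly_mat (p r ^ \<mu> r) (T r) = 0\<^sub>m (dim_row (T r)) (dim_row (T r))"
      using Tc[OF r] by (simp add: P_def)
  next
    \<comment> \<open>If \<open>f\<close> annihilates block r, then \<open>f * Q r\<close>
      annihilates \<open>M\<close>: \<open>f\<close> deals with block r and \<open>Q r\<close> with
      all others. Comparing degrees with \<open>q = P r * Q r\<close> bounds the degree of
      \<open>f\<close> from below.\<close>
    fix f assume f: "lead_coeff f = 1 \<and> poly_mat f (T r) = 0\<^sub>m (dim_row (T r)) (dim_row (T r))"
    then have fS: "poly_mat f M * S r = 0\<^sub>m n (l r)"
      using fTS[OF r, of f] Tc[OF r] S(1)[of r] by simp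
    have z: "poly_mat (f * Q r) M * S s = 0\<^sub>m n (l s)" if s: "s < R" for s
    proof (cases "s = r")
      case True
      show ?thesis unfolding True by (rule poly_mat_dvd_zero[OF M S(1) fS]) simp
    next
      case False
      show ?thesis
        by (rule poly_mat_dvd_zero[OF M S(1), of "P s"]) (use PQ[OF s False] KS in \<open>auto simp: K\<close>)
    qed
    have "poly_mat (f * Q r) M * SS = hcat n (map (\<lambda>s. poly_mat (f * Q r) M * S s) ?rs)"
      unfolding SS_def by (rule mult_hcat[OF poly_mat_carrier[OF M] S(1)])
    also have "map (\<lambda>s. poly_mat (f * Q r) M * S s) ?rs = map (\<lambda>s. 0\<^sub>m n (l s)) ?rs"
      using z by auto
    finally have "poly_mat (f * Q r) M * SS = 0\<^sub>m n ?L" unfolding hcat_zero .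
    then have "poly_mat (f * Q r) M * SS * W = 0\<^sub>m n n" using Wc by simp
    then have "poly_mat (f * Q r) M * (SS * W) = 0\<^sub>m n n"
      using assoc_mult_mat[OF poly_mat_carrier[OF M] SSc Wc] by simp
    then have "poly_mat (f * Q r) M = 0\<^sub>m n n"
      unfolding \<open>SS * W = 1\<^sub>m n\<close> right_mult_one_mat[OF poly_mat_carrier[OF M]] .
    moreover have lq: "lead_coeff q = 1" using q by (simp add: is_min_poly_def)
    have lP: "lead_coeff (P r) = 1"
      using fact r by (simp add: P_def irreducible_factorization_def lead_coeff_power)
    have "lead_coeff (Q r) = 1" using lq lP qPQ[OF r] by (simp add: lead_coeff_mult)
    moreover from this have "lead_coeff (f * Q r) = 1" using f by (simp add: lead_coeff_mult)
    ultimately have "degree q \<le> degree (f * Q r)" using q M by (simp add: is_min_poly_def)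
    moreover have "f \<noteq> 0" "Q r \<noteq> 0" "P r \<noteq> 0"
      using f \<open>lead_coeff (Q r) = 1\<close> lP by auto
    ultimately show "degree (p r ^ \<mu> r) \<le> degree f"
      using qPQ[OF r] by (simp add: degree_mult_eq P_def)
  qed
  ultimately show ?thesis by blast
qed

text \<open>From M1 = P * M2 * Q, the matrix Q intertwines f(M1) with f(M2) for every f, so the
  columns of Q * S_r form a basis of the r-th kernel of M2, with the very same T_r. This is what
  makes T_1r = T_2r possible in statement 5.\<close>

lemma primary_decomposition_similar:
  fixes M1 M2 :: "'a :: field mat"
  assumes M1: "M1 \<in> carrier_mat n n" and sim: "similar_mat M1 M2"
    and dec: "primary_decomposition M1 R p \<mu> S T"
  shows "\<exists>S'. primary_decomposition M2 R p \<mu> S' T"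
    and "r < R \<Longrightarrow> primary_dim M2 (p r) (\<mu> r) = primary_dim M1 (p r) (\<mu> r)"
proof -
  obtain P Q where PQ: "P \<in> carrier_mat n n" "Q \<in> carrier_mat n n" "P * Q = 1\<^sub>m n" "Q * P = 1\<^sub>m n"
    and M2: "M2 \<in> carrier_mat n n" and M1_eq: "M1 = P * M2 * Q"
  proof -
    obtain P Q where "similar_mat_wit M1 M2 P Q" using sim unfolding similar_mat_def by blast
    from similar_mat_witD2[OF M1 this] that show thesis by blast
  qed
  have cancelQP: "Q * (P * X) = X" if "X \<in> carrier_mat n k" for X k
    using assoc_mult_mat[OF PQ(2,1) that] PQ(4) that by simp
  have "Q * M1 = Q * (P * (M2 * Q))" using M1_eq assoc_mult_mat[OF PQ(1) M2 PQ(2)] by simp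
  then have QM: "M2 * Q = Q * M1" using cancelQP[of "M2 * Q" n] M2 PQ(2) by simp
  have pQ: "poly_mat f M2 * Q = Q * poly_mat f M1" for f
    by (rule poly_mat_intertwine[OF M2 M1 PQ(2) QM])
  let ?l = "\<lambda>r. primary_dim M1 (p r) (\<mu> r)"
  let ?K1 = "\<lambda>r. poly_mat (p r ^ \<mu> r) M1" and ?K2 = "\<lambda>r. poly_mat (p r ^ \<mu> r) M2"
  have S: "S r \<in> carrier_mat n (?l r)" "T r \<in> carrier_mat (?l r) (?l r)"
    "cols_form_kernel_basis (S r) (?K1 r)" "M1 * S r = S r * T r" if "r < R" for r
    using dec[unfolded primary_decomposition_iff[OF M1]] that by blast+
  define S' where "S' r = Q * S r" for r
  have S': "S' r \<in> carrier_mat n (?l r)" if "r < R" for r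
    using S(1)[OF that] PQ(2) by (simp add: S'_def)
  note c1 = poly_mat_carrier[OF M1] and c2 = poly_mat_carrier[OF M2]
  have b: "cols_form_kernel_basis (S' r) (?K2 r)" if r: "r < R" for r
    unfolding cols_form_kernel_basis_iff[OF S'[OF r] c2]
  proof (intro conjI ballI impI)
    from S(3)[OF r] have KS: "?K1 r * S r = 0\<^sub>m n (?l r)" and inj: "injective_mat (S r)"
      and ker: "\<And>v. v \<in> carrier_vec n \<Longrightarrow> ?K1 r *\<^sub>v v = 0\<^sub>v n \<Longrightarrow> \<exists>w\<in>carrier_vec (?l r). v = S r *\<^sub>v w"
      unfolding cols_form_kernel_basis_iff[OF S(1)[OF r] c1] by auto
    have "?K2 r * S' r = ?K2 r * Q * S r"
      unfolding S'_def using assoc_mult_mat[OF c2 PQ(2) S(1)[OF r]] by simp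
    also have "\<dots> = Q * (?K1 r * S r)" unfolding pQ using assoc_mult_mat[OF PQ(2) c1 S(1)[OF r]] by simp
    finally show "?K2 r * S' r = 0\<^sub>m n (?l r)" using KS PQ(2) by simp
    have "injective_mat Q" by (rule injective_mat_left_inverse[OF PQ(2,1,3)])
    then show "injective_mat (S' r)"
      unfolding S'_def by (rule injective_mat_mult[OF PQ(2) S(1)[OF r] _ inj])
    fix v assume v: "v \<in> carrier_vec n" "?K2 r *\<^sub>v v = 0\<^sub>v n"
    have Pv: "P *\<^sub>v v \<in> carrier_vec n" using PQ(1) v by simp
    \<comment> \<open>A vector of the kernel for \<open>M2\<close> is pulled back by
      \<open>P\<close>, expressed in the basis for \<open>M1\<close> and pushed forward by
      \<open>Q\<close>.\<close>
    have vQ: "v = Q *\<^sub>v (P *\<^sub>v v)"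
      using assoc_mult_mat_vec[OF PQ(2,1) v(1)] PQ(4) v(1) by simp
    have "Q *\<^sub>v (?K1 r *\<^sub>v (P *\<^sub>v v)) = (Q * ?K1 r) *\<^sub>v (P *\<^sub>v v)"
      using assoc_mult_mat_vec[OF PQ(2) c1 Pv] by simp
    also have "\<dots> = ?K2 r *\<^sub>v (Q *\<^sub>v (P *\<^sub>v v))"
      unfolding pQ[symmetric] using assoc_mult_mat_vec[OF c2 PQ(2) Pv] by simp
    also have "\<dots> = 0\<^sub>v n" using v vQ by simp
    finally have "Q *\<^sub>v (?K1 r *\<^sub>v (P *\<^sub>v v)) = 0\<^sub>v n" .
    then have "?K1 r *\<^sub>v (P *\<^sub>v v) = 0\<^sub>v n"
      by (rule injective_matD[OF \<open>injective_mat Q\<close> PQ(2), rotated])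
        (use mult_mat_vec_carrier[OF c1 Pv] in simp)
    with ker[OF Pv] obtain w where w: "w \<in> carrier_vec (?l r)" "P *\<^sub>v v = S r *\<^sub>v w" by blast
    then have "v = S' r *\<^sub>v w"
      unfolding S'_def using vQ assoc_mult_mat_vec[OF PQ(2) S(1)[OF r] w(1)] by simp
    then show "\<exists>w\<in>carrier_vec (?l r). v = S' r *\<^sub>v w" using w(1) by blast
  qed
  show dims: "primary_dim M2 (p r) (\<mu> r) = ?l r" if r: "r < R" for r
    using cols_form_kernel_basis_dim[OF S'[OF r] c2 b[OF r]]
    by (simp add: primary_dim_def poly_mat_power[OF M2])
  have MS': "M2 * S' r = S' r * T r" if r: "r < R" for r
  proof -
    have "M2 * S' r = Q * (M1 * S r)"
      unfolding S'_def using assoc_mult_mat[OF M2 PQ(2) S(1)[OF r]] assoc_mult_mat[OF PQ(2) M1 S(1)[OF r]] QM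
      by simp
    also have "\<dots> = S' r * T r"
      unfolding S'_def S(4)[OF r] using assoc_mult_mat[OF PQ(2) S(1,2)[OF r]] by simp
    finally show ?thesis .
  qed
  let ?rs = "[0..<R]"
  let ?SS = "hcat n (map S ?rs)" and ?D = "diag_block_mat (map T ?rs)"
  let ?L = "sum_list (map ?l ?rs)"
  have SSc: "?SS \<in> carrier_mat n ?L" by (rule hcat_map_carrier) (use S(1) in auto)
  have Dc: "?D \<in> carrier_mat ?L ?L" by (rule diag_block_map_carrier) (use S(2) in auto)
  have iv: "invertible_mat ?SS" and m1: "M1 = ?SS * ?D * mat_inv ?SS"
    using dec[unfolded primary_decomposition_iff[OF M1]] by blast+
  obtain W where n: "n = ?L" and W0: "W \<in> carrier_mat ?L ?L" "?SS * W = 1\<^sub>m ?L" "mat_inv ?SS = W"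
    by (rule invertible_mat_obtain_inverse[OF iv SSc])
  have W: "n = ?L" "W \<in> carrier_mat n n" "?SS * W = 1\<^sub>m n"
    using n W0(1,2) by metis+
  have m1: "M1 = ?SS * ?D * W" using m1 unfolding W0(3) .
  have SSc: "?SS \<in> carrier_mat n n" and Dc: "?D \<in> carrier_mat n n" using SSc Dc W(1) by metis+
  have SS': "hcat n (map S' ?rs) = Q * ?SS"
    unfolding S'_def by (rule mult_hcat[symmetric, OF PQ(2)]) (use S(1) in auto)
  have "Q * ?SS * (W * P) = Q * (?SS * (W * P))"
    using assoc_mult_mat[OF PQ(2) SSc, of "W * P" n] W(2) PQ(1) by simp
  also have "?SS * (W * P) = P" using assoc_mult_mat[OF SSc W(2) PQ(1)] W(3) PQ(1) by simp
  finally have one: "Q * ?SS * (W * P) = 1\<^sub>m n" using PQ(4) by simp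
  note inv = mat_inv_unique[OF _ _ one]
  have "M2 = M2 * Q * P" using assoc_mult_mat[OF M2 PQ(2,1)] PQ(4) M2 by simp
  also have "\<dots> = Q * (?SS * ?D * W) * P" using QM m1 by simp
  also have "\<dots> = Q * ?SS * ?D * (W * P)"
  proof -
    have "Q * (?SS * ?D * W) = Q * ?SS * ?D * W"
      using assoc_mult_mat[OF PQ(2) mult_carrier_mat[OF SSc Dc] W(2)] assoc_mult_mat[OF PQ(2) SSc Dc] by simp
    then show ?thesis
      using assoc_mult_mat[OF mult_carrier_mat[OF mult_carrier_mat[OF PQ(2) SSc] Dc] W(2) PQ(1)] by simp
  qed
  finally have M2_eq: "M2 = Q * ?SS * ?D * (W * P)" .
  have inv': "mat_inv (Q * ?SS) = W * P" "invertible_mat (Q * ?SS)"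
    by (rule inv; use PQ SSc W(2) in simp)+
  have "primary_decomposition M2 R p \<mu> S' T"
    unfolding primary_decomposition_iff[OF M2] SS' inv'(1)
  proof (intro conjI allI impI)
    fix r assume r: "r < R"
    show "S' r \<in> carrier_mat n (primary_dim M2 (p r) (\<mu> r))" unfolding dims[OF r] by (rule S'[OF r])
    show "T r \<in> carrier_mat (primary_dim M2 (p r) (\<mu> r)) (primary_dim M2 (p r) (\<mu> r))"
      unfolding dims[OF r] by (rule S(2)[OF r])
  qed (fact b MS' inv'(2) M2_eq)+
  then show "\<exists>S'. primary_decomposition M2 R p \<mu> S' T" by blast
qed

section \<open>Similarity of a matrix to its transpose\<close>

lemma similar_mat_transpose:
  fixes A B :: "'a :: comm_semiring_1 mat"
  assumes "similar_mat A B"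
  shows "similar_mat (transpose_mat A) (transpose_mat B)"
proof -
  obtain n P Q where c: "A \<in> carrier_mat n n" "B \<in> carrier_mat n n" "P \<in> carrier_mat n n" "Q \<in> carrier_mat n n"
    and PQ: "P * Q = 1\<^sub>m n" "Q * P = 1\<^sub>m n" and A: "A = P * B * Q"
    using similar_matD[OF assms] by auto
  have "transpose_mat A = transpose_mat Q * (transpose_mat B * transpose_mat P)"
    unfolding A transpose_mult[OF mult_carrier_mat[OF c(3,2)] c(4)] transpose_mult[OF c(3,2)] ..
  also have "\<dots> = transpose_mat Q * transpose_mat B * transpose_mat P"
    by (rule assoc_mult_mat[symmetric]) (use c in auto)
  finally have "transpose_mat A = transpose_mat Q * transpose_mat B * transpose_mat P" .
  moreover have "transpose_mat Q * transpose_mat P = 1\<^sub>m n"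
    using arg_cong[OF PQ(1), of transpose_mat] unfolding transpose_mult[OF c(3,4)] by simp
  moreover have "transpose_mat P * transpose_mat Q = 1\<^sub>m n"
    using arg_cong[OF PQ(2), of transpose_mat] unfolding transpose_mult[OF c(4,3)] by simp
  ultimately show ?thesis
    by (intro similar_matI[of _ _ "transpose_mat Q" "transpose_mat P" n]) (use c in auto)
qed

text \<open>Reversing the order of the basis turns a Jordan block into its transpose.\<close>

lemma similar_mat_transpose_jordan_block:
  fixes a :: "'a :: comm_semiring_1"
  shows "similar_mat (transpose_mat (jordan_block n a)) (jordan_block n a)"
proof -
  define P :: "'a mat" where "P = mat n n (\<lambda>(i, j). if j = n - 1 - i then 1 else 0)"
  have P: "P \<in> carrier_mat n n" by (simp add: P_def)
  have left: "(P * X) $$ (i, j) = X $$ (n - 1 - i, j)"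
    if X: "X \<in> carrier_mat n n" and ij: "i < n" "j < n" for X i j
  proof -
    have "(P * X) $$ (i, j) = (\<Sum>k = 0..<n. (if k = n - 1 - i then 1 else 0) * X $$ (k, j))"
      using X ij by (simp add: P_def scalar_prod_def)
    also have "\<dots> = (\<Sum>k = 0..<n. if k = n - 1 - i then X $$ (k, j) else 0)"
      by (intro sum.cong) auto
    finally show ?thesis using ij by (simp add: sum.delta)
  qed
  have right: "(X * P) $$ (i, j) = X $$ (i, n - 1 - j)"
    if X: "X \<in> carrier_mat n n" and ij: "i < n" "j < n" for X i j
  proof -
    have "(X * P) $$ (i, j) = (\<Sum>k = 0..<n. X $$ (i, k) * (if j = n - 1 - k then 1 else 0))"
      using X ij by (simp add: P_def scalar_prod_def)
    also have "\<dots> = (\<Sum>k = 0..<n. if k = n - 1 - j then X $$ (i, k) else 0)"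
      using ij by (intro sum.cong) auto
    finally show ?thesis using ij by (simp add: sum.delta)
  qed
  have "P * P = 1\<^sub>m n"
  proof (rule eq_matI)
    fix i j assume "i < dim_row (1\<^sub>m n :: 'a mat)" "j < dim_col (1\<^sub>m n :: 'a mat)"
    then show "(P * P) $$ (i, j) = 1\<^sub>m n $$ (i, j)"
      using left[OF P, of i j] by (auto simp: P_def)
  qed (use P in auto)
  moreover have "transpose_mat (jordan_block n a) = P * jordan_block n a * P"
  proof (rule eq_matI)
    fix i j assume "i < dim_row (P * jordan_block n a * P)" "j < dim_col (P * jordan_block n a * P)"
    then have ij: "i < n" "j < n" using P by auto
    then have "(P * jordan_block n a * P) $$ (i, j) = jordan_block n a $$ (n - 1 - i, n - 1 - j)"
      using P by (subst right, simp, simp, simp, subst left) auto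
    then show "transpose_mat (jordan_block n a) $$ (i, j) = (P * jordan_block n a * P) $$ (i, j)"
      using ij by auto
  qed (use P in auto)
  ultimately show ?thesis by (intro similar_matI[of _ _ P P n]) (use P in auto)
qed

lemma transpose_diag_block_mat:
  "transpose_mat (diag_block_mat As) = diag_block_mat (map transpose_mat As)"
proof (induction As)
  case (Cons A As)
  let ?B = "diag_block_mat As"
  have "transpose_mat (four_block_mat A (0\<^sub>m (dim_row A) (dim_col ?B)) (0\<^sub>m (dim_row ?B) (dim_col A)) ?B) =
      four_block_mat (transpose_mat A) (0\<^sub>m (dim_col A) (dim_row ?B)) (0\<^sub>m (dim_col ?B) (dim_row A)) (transpose_mat ?B)"
    by (subst transpose_four_block_mat[of _ "dim_row A" "dim_col A" _ "dim_col ?B" _ "dim_row ?B"]) auto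
  then show ?case
    unfolding list.map diag_block_mat.simps Let_def Cons.IH[symmetric] index_transpose_mat .
qed simp

text \<open>The chain A^T ~ J^T ~ J ~ A with J the Jordan form; the middle link is made block by
  block.\<close>

lemma similar_mat_transpose_complex:
  fixes A :: "complex mat"
  assumes A: "A \<in> carrier_mat n n"
  shows "similar_mat (transpose_mat A) A"
proof -
  obtain n_as where "jordan_nf A n_as"
    using char_poly_factorized[OF A] jordan_nf_exists[OF A] by blast
  then have AJ: "similar_mat A (jordan_matrix n_as)" by (simp add: jordan_nf_def)
  let ?J = "\<lambda>(n, a). jordan_block n a :: complex mat"
  let ?Ms = "map (\<lambda>na. (transpose_mat (?J na), ?J na)) n_as"
  have "similar_mat (diag_block_mat (map fst ?Ms)) (diag_block_mat (map snd ?Ms))"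
    by (rule similar_diag_mat_block_mat) (auto simp: similar_mat_transpose_jordan_block)
  moreover have "diag_block_mat (map fst ?Ms) = transpose_mat (jordan_matrix n_as)"
    unfolding jordan_matrix_def transpose_diag_block_mat by (simp add: comp_def)
  moreover have "diag_block_mat (map snd ?Ms) = jordan_matrix n_as"
    unfolding jordan_matrix_def by (simp add: comp_def)
  ultimately have "similar_mat (transpose_mat (jordan_matrix n_as)) (jordan_matrix n_as)" by simp
  with AJ show ?thesis
    using similar_mat_transpose[OF AJ] similar_mat_trans similar_mat_sym by blast
qed

section \<open>Descent of similarity from the complex numbers to the ground field\<close>

lemma similar_mat_intertwine:
  fixes A B :: "'a :: field mat"
  assumes "A \<in> carrier_mat n n" "B \<in> carrier_mat n n" "P \<in> carrier_mat n n" "invertible_mat P"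
    and AP: "A * P = P * B"
  shows "similar_mat A B"
proof -
  obtain Q where Q: "Q \<in> carrier_mat n n" "P * Q = 1\<^sub>m n" "Q * P = 1\<^sub>m n"
    by (rule invertible_mat_obtain_inverse[OF assms(4,3)]) blast
  have "P * B * Q = A * (P * Q)"
    unfolding AP[symmetric] by (rule assoc_mult_mat) (use assms Q in auto)
  then have "A = P * B * Q" using Q(2) assms(1) by simp
  then show ?thesis by (intro similar_matI[of _ _ P Q n]) (use assms Q in auto)
qed

lemma invertible_mat_det_nonzero:
  fixes A :: "'a :: field mat"
  assumes A: "A \<in> carrier_mat n n" and "det A \<noteq> 0"
  shows "invertible_mat A"
proof -
  have "A \<in> Units (ring_mat TYPE('a) n ())" by (rule det_non_zero_imp_unit[OF assms])
  then obtain B where "B \<in> carrier_mat n n" "A * B = 1\<^sub>m n" by (auto simp: Units_def ring_mat_def)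
  then show ?thesis by (rule mat_inv_unique(2)[OF A])
qed

text \<open>If the complex matrix U + iV intertwines two real matrices, so does U + xV for every real x, and
  the determinant of U + xV is a polynomial in x that does not vanish at i.\<close>

lemma similar_mat_real_of_complex:
  fixes A B :: "real mat"
  assumes A: "A \<in> carrier_mat n n" and B: "B \<in> carrier_mat n n"
    and sim: "similar_mat (map_mat complex_of_real A) (map_mat complex_of_real B)"
  shows "similar_mat A B"
proof -
  let ?c = "map_mat complex_of_real"
  obtain P Q where PQ: "P \<in> carrier_mat n n" "Q \<in> carrier_mat n n" "P * Q = 1\<^sub>m n" "Q * P = 1\<^sub>m n"
    and eq: "?c A = P * ?c B * Q"
  proof -
    obtain P Q where "similar_mat_wit (?c A) (?c B) P Q" using sim unfolding similar_mat_def by blast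
    moreover have "?c A \<in> carrier_mat n n" using A by simp
    ultimately show thesis using similar_mat_witD2[of "?c A" n n "?c B" P Q] that by blast
  qed
  have Bc: "?c B \<in> carrier_mat n n" using B by simp
  have "?c A * P = P * ?c B * (Q * P)"
    unfolding eq by (rule assoc_mult_mat) (use PQ Bc in auto)
  then have AP: "?c A * P = P * ?c B" using PQ Bc by simp
  define U V where "U = map_mat Re P" and "V = map_mat Im P"
  have UV: "U \<in> carrier_mat n n" "V \<in> carrier_mat n n" using PQ(1) by (auto simp: U_def V_def)
  have AU: "A * U = U * B"
  proof (rule eq_matI)
    fix i j assume "i < dim_row (U * B)" "j < dim_col (U * B)"
    then have ij: "i < n" "j < n" using UV B by auto
    have "Re ((?c A * P) $$ (i, j)) = (A * U) $$ (i, j)"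
      using ij A PQ(1) by (simp add: U_def scalar_prod_def)
    moreover have "Re ((P * ?c B) $$ (i, j)) = (U * B) $$ (i, j)"
      using ij B PQ(1) by (simp add: U_def scalar_prod_def)
    ultimately show "(A * U) $$ (i, j) = (U * B) $$ (i, j)" using AP by simp
  qed (use A B UV in auto)
  have AV: "A * V = V * B"
  proof (rule eq_matI)
    fix i j assume "i < dim_row (V * B)" "j < dim_col (V * B)"
    then have ij: "i < n" "j < n" using UV B by auto
    have "Im ((?c A * P) $$ (i, j)) = (A * V) $$ (i, j)"
      using ij A PQ(1) by (simp add: V_def scalar_prod_def)
    moreover have "Im ((P * ?c B) $$ (i, j)) = (V * B) $$ (i, j)"
      using ij B PQ(1) by (simp add: V_def scalar_prod_def)
    ultimately show "(A * V) $$ (i, j) = (V * B) $$ (i, j)" using AP by simp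
  qed (use A B UV in auto)
  define N where "N = mat n n (\<lambda>ij. [:complex_of_real (U $$ ij), complex_of_real (V $$ ij):])"
  have ev: "poly (det N) z = det (map_mat (\<lambda>p. poly p z) N)" for z
  proof -
    have "comm_ring_hom (\<lambda>p. poly p z)" by unfold_locales auto
    then show ?thesis by (rule comm_ring_hom.hom_det[symmetric])
  qed
  have "map_mat (\<lambda>p. poly p \<i>) N = P"
    using PQ(1) by (intro eq_matI) (auto simp: N_def U_def V_def complex_eq_iff)
  moreover have "det P \<noteq> 0"
    using det_mult[OF PQ(1,2)] PQ(3) by auto
  ultimately have "det N \<noteq> 0" using ev[of \<i>] by auto
  then have fin: "finite {z. poly (det N) z = 0}" by (rule poly_roots_finite)
  have "\<exists>x. poly (det N) (complex_of_real x) \<noteq> 0"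
  proof (rule ccontr)
    assume "\<not> ?thesis"
    then have "range complex_of_real \<subseteq> {z. poly (det N) z = 0}" by auto
    then have "finite (range complex_of_real)" using fin by (rule finite_subset)
    then have "finite (UNIV :: real set)" by (rule finite_imageD) (simp add: inj_on_def)
    then show False by (simp add: infinite_UNIV_char_0)
  qed
  then obtain x where x: "poly (det N) (complex_of_real x) \<noteq> 0" by blast
  define W where "W = U + x \<cdot>\<^sub>m V"
  have W: "W \<in> carrier_mat n n" using UV by (simp add: W_def)
  have "map_mat (\<lambda>p. poly p (complex_of_real x)) N = ?c W"
    using UV by (intro eq_matI) (auto simp: N_def W_def)
  then have "complex_of_real (det W) \<noteq> 0" using x ev[of "complex_of_real x"] by simp
  then have "det W \<noteq> 0" by simp
  then have "invertible_mat W" by (rule invertible_mat_det_nonzero[OF W])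
  moreover have "A * W = W * B"
  proof -
    have "A * W = A * U + x \<cdot>\<^sub>m (A * V)"
      unfolding W_def using A UV by (subst mult_add_distrib_mat[of _ n n]) auto
    also have "\<dots> = W * B"
      unfolding W_def AU AV using B UV by (subst add_mult_distrib_mat[of _ n n]) auto
    finally show ?thesis .
  qed
  ultimately show ?thesis by (rule similar_mat_intertwine[OF A B W])
qed

lemma similar_mat_transpose_real:
  fixes A :: "real mat"
  assumes A: "A \<in> carrier_mat n n"
  shows "similar_mat (transpose_mat A) A"
proof (rule similar_mat_real_of_complex)
  have "map_mat complex_of_real (transpose_mat A) = transpose_mat (map_mat complex_of_real A)"
    by (intro eq_matI) auto
  then show "similar_mat (map_mat complex_of_real (transpose_mat A)) (map_mat complex_of_real A)"
    using similar_mat_transpose_complex[of "map_mat complex_of_real A" n] A by simp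
qed (use A in auto)

text \<open>The inverse of h is a ring homomorphism and carries the similarity witnesses back. The
  class \<open>real_or_complex\<close> gives access to its field only through such an h.\<close>

lemma similar_mat_transfer:
  fixes h :: "'a :: field \<Rightarrow> 'b :: field" and A B :: "'a mat"
  assumes bij: "bij h" and add: "\<forall>x y. h (x + y) = h x + h y" and mult: "\<forall>x y. h (x * y) = h x * h y"
    and A: "A \<in> carrier_mat n n" and B: "B \<in> carrier_mat n n"
    and sim: "similar_mat (map_mat h A) (map_mat h B)"
  shows "similar_mat A B"
proof -
  define g where "g = inv_into UNIV h"
  have gh: "g (h x) = x" and hg: "h (g y) = y" for x y
    using bij by (auto simp: g_def bij_is_inj inv_f_f bij_is_surj surj_f_inv_f)
  have g: "g (y + z) = g y + g z" "g (y * z) = g y * g z" for y z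
    by (metis add mult gh hg)+
  have g0: "g 0 = 0" using g(1)[of 0 0] by (metis add.right_neutral add_left_cancel)
  \<comment> \<open>The assumptions on \<open>h\<close> speak of sums and products, so
    \<open>g 1 = 1\<close> has to be derived: \<open>g 1\<close> is idempotent and different from
    0.\<close>
  have "g 1 \<noteq> 0"
  proof
    assume "g 1 = 0"
    then have "g 1 = g 0" using g0 by simp
    then have "(1 :: 'b) = 0" by (metis hg)
    then show False by simp
  qed
  then have g1: "g 1 = 1" using g(2)[of 1 1] by simp
  interpret semiring_hom g by unfold_locales (simp_all add: g g0 g1)
  obtain P Q where PQ: "P \<in> carrier_mat n n" "Q \<in> carrier_mat n n" "P * Q = 1\<^sub>m n" "Q * P = 1\<^sub>m n"
    and eq: "map_mat h A = P * map_mat h B * Q"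
  proof -
    obtain P Q where "similar_mat_wit (map_mat h A) (map_mat h B) P Q"
      using sim unfolding similar_mat_def by blast
    moreover have "map_mat h A \<in> carrier_mat n n" using A by simp
    ultimately show thesis using similar_mat_witD2[of "map_mat h A" n n "map_mat h B" P Q] that by blast
  qed
  have ghm: "map_mat g (map_mat h X) = X" for X by (intro eq_matI) (auto simp: gh)
  have one: "map_mat g (1\<^sub>m n) = 1\<^sub>m n" by (intro eq_matI) (auto simp: g0 g1)
  have hB: "map_mat h B \<in> carrier_mat n n" using B by simp
  have "A = map_mat g P * B * map_mat g Q"
    using arg_cong[OF eq, of "map_mat g"]
    unfolding mat_hom_mult[OF mult_carrier_mat[OF PQ(1) hB] PQ(2)] mat_hom_mult[OF PQ(1) hB] ghm .
  moreover have "map_mat g P * map_mat g Q = 1\<^sub>m n" "map_mat g Q * map_mat g P = 1\<^sub>m n"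
    using PQ(3,4) one mat_hom_mult[OF PQ(1,2)] mat_hom_mult[OF PQ(2,1)] by auto
  ultimately show ?thesis
    by (intro similar_matI[of _ _ "map_mat g P" "map_mat g Q" n]) (use A B PQ in auto)
qed

lemma similar_mat_transpose_self:
  fixes A :: "'a :: real_or_complex mat"
  assumes A: "A \<in> carrier_mat n n"
  shows "similar_mat (transpose_mat A) A"
proof -
  have tr: "map_mat h (transpose_mat A) = transpose_mat (map_mat h A)" for h :: "'a \<Rightarrow> 'b"
    by (intro eq_matI) auto
  have AT: "transpose_mat A \<in> carrier_mat n n" using A by simp
  from real_or_complex show ?thesis
  proof (elim disjE exE conjE)
    fix h :: "'a \<Rightarrow> real"
    assume h: "bij h" "\<forall>x y. h (x + y) = h x + h y" "\<forall>x y. h (x * y) = h x * h y"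
    show ?thesis
      by (rule similar_mat_transfer[OF h AT A]) (use A in \<open>simp add: tr similar_mat_transpose_real[of _ n]\<close>)
  next
    fix h :: "'a \<Rightarrow> complex"
    assume h: "bij h" "\<forall>x y. h (x + y) = h x + h y" "\<forall>x y. h (x * y) = h x * h y"
    show ?thesis
      by (rule similar_mat_transfer[OF h AT A]) (use A in \<open>simp add: tr similar_mat_transpose_complex[of _ n]\<close>)
  qed
qed

section \<open>Coupled blocks\<close>

text \<open>Slice by slice, f(M1)^T A_i = A_i f(M2) = 0. In terms of the unfolding U this reads U
  f(M1) = 0, and U is injective. The opposite implication is the same lemma for the transposed
  slices.\<close>

lemma annihilating_poly_transfer:
  fixes M1 M2 :: "'a :: field mat"
  assumes \<A>: "\<A> \<in> carrier_tensor3 n1 n2 n3" and inj: "injective_mat (unfold_23_1 n1 \<A>)"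
    and M1: "M1 \<in> carrier_mat n1 n1" and M2: "M2 \<in> carrier_mat n2 n2"
    and eq: "\<And>i. i < n3 \<Longrightarrow> transpose_mat M1 * \<A> ! i = \<A> ! i * M2"
    and z: "poly_mat f M2 = 0\<^sub>m n2 n2"
  shows "poly_mat f M1 = 0\<^sub>m n1 n1"
proof -
  let ?F = "transpose_mat (poly_mat f M1)"
  have F: "?F \<in> carrier_mat n1 n1" using poly_mat_carrier[OF M1] by simp
  have "?F * \<A> ! i = 0\<^sub>m n1 n1 * \<A> ! i" if i: "i < n3" for i
  proof -
    note Ai = carrier_tensor3_nth[OF \<A> i]
    have "poly_mat f (transpose_mat M1) * \<A> ! i = \<A> ! i * poly_mat f M2"
      by (rule poly_mat_intertwine[OF _ M2 Ai eq[OF i]]) (use M1 in simp)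
    then show ?thesis using Ai z by (simp add: poly_mat_transpose[OF M1])
  qed
  then have "\<A> \<bullet>\<^sub>1 ?F = \<A> \<bullet>\<^sub>1 0\<^sub>m n1 n1"
    using carrier_tensor3_length[OF \<A>] by (intro nth_equalityI) (auto simp: mode1_prod_def)
  then have "unfold_23_1 n1 \<A> * transpose_mat ?F = unfold_23_1 n1 \<A> * transpose_mat (0\<^sub>m n1 n1)"
    using unfold_23_1_mode1_prod[OF \<A> F] unfold_23_1_mode1_prod[OF \<A> zero_carrier_mat, of n1] by simp
  then have "transpose_mat ?F = transpose_mat (0\<^sub>m n1 n1)"
    by (rule injective_mat_cancel[OF unfold_23_1_carrier[OF \<A>] _ _ inj, rotated 2]) (use F in auto)
  then show ?thesis by simp
qed

text \<open>X is the inverse transpose, cut at the widths of S. The two products of a matrix with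
  its inverse become biorthogonality of the X_r and S_s, and a resolution of the identity into the
  S_r X_r^T.\<close>

lemma block_inverse:
  fixes S :: "nat \<Rightarrow> 'a :: field mat"
  assumes S: "\<And>r. r < R \<Longrightarrow> S r \<in> carrier_mat n (l r)"
    and inv: "invertible_mat (hcat n (map S [0..<R]))"
  obtains X where "\<And>r. r < R \<Longrightarrow> X r \<in> carrier_mat n (l r)"
    and "hcat n (map X [0..<R]) = mat_inv (transpose_mat (hcat n (map S [0..<R])))"
    and "\<And>r s. r < R \<Longrightarrow> s < R \<Longrightarrow>
      transpose_mat (X r) * S s = (if r = s then 1\<^sub>m (l r) else 0\<^sub>m (l r) (l s))"
    and "hcat n (map S [0..<R]) * transpose_mat (hcat n (map X [0..<R])) = 1\<^sub>m n"
proof -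
  let ?S = "hcat n (map S [0..<R])" and ?L = "sum_list (map l [0..<R])"
  have Sc: "?S \<in> carrier_mat n ?L" by (rule hcat_map_carrier) (use S in auto)
  obtain W where nL: "n = ?L" and W0: "W \<in> carrier_mat ?L ?L" "?S * W = 1\<^sub>m ?L" "W * ?S = 1\<^sub>m ?L"
    by (rule invertible_mat_obtain_inverse[OF inv Sc])
  have Sc': "?S \<in> carrier_mat n n" using Sc nL by metis
  have W: "W \<in> carrier_mat n n" "?S * W = 1\<^sub>m n" "W * ?S = 1\<^sub>m n"
    using W0 nL by metis+
  have "transpose_mat ?S * transpose_mat W = 1\<^sub>m n"
    using transpose_mult[OF W(1) Sc'] W(3) by simp
  then have inv: "mat_inv (transpose_mat ?S) = transpose_mat W"
    by (rule mat_inv_unique(1)[rotated 2]) (use Sc' W(1) in auto)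
  have "transpose_mat W \<in> carrier_mat n ?L" using W0(1) nL by simp
  then obtain X where X: "\<forall>r\<in>set [0..<R]. X r \<in> carrier_mat n (l r)"
    and XW: "hcat n (map X [0..<R]) = transpose_mat W"
    using hcat_split[of "[0..<R]" "transpose_mat W" n l] by auto
  have one: "transpose_mat (hcat n (map X [0..<R])) * ?S = 1\<^sub>m ?L"
    unfolding XW using W0(3) by simp
  show thesis
  proof (rule that[of X])
    show "transpose_mat (X r) * S s = (if r = s then 1\<^sub>m (l r) else 0\<^sub>m (l r) (l s))"
      if "r < R" "s < R" for r s
      by (rule transpose_hcat_mult_hcat_one[OF _ _ _ one]) (use that X S in auto)
    show "?S * transpose_mat (hcat n (map X [0..<R])) = 1\<^sub>m n"
      unfolding XW using W(2) by simp
  qed (use X XW inv in auto)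
qed

text \<open>S_r X_r^T is the projection onto the r-th block subspace along the others, so a matrix
  that kills the other subspaces is unchanged by it. Both sides are compared on each block and the
  invertible matrix of all blocks is cancelled.\<close>

lemma block_projection:
  fixes S X :: "nat \<Rightarrow> 'a :: field mat"
  assumes S: "\<And>r. r < R \<Longrightarrow> S r \<in> carrier_mat n (l r)" and X: "\<And>r. r < R \<Longrightarrow> X r \<in> carrier_mat n (l r)"
    and XS: "\<And>r s. r < R \<Longrightarrow> s < R \<Longrightarrow>
      transpose_mat (X r) * S s = (if r = s then 1\<^sub>m (l r) else 0\<^sub>m (l r) (l s))"
    and one: "hcat n (map S [0..<R]) * transpose_mat (hcat n (map X [0..<R])) = 1\<^sub>m n"
    and N: "N \<in> carrier_mat k n" and r: "r < R"
    and NS: "\<And>s. s < R \<Longrightarrow> s \<noteq> r \<Longrightarrow> N * S s = 0\<^sub>m k (l s)"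
  shows "N * S r * transpose_mat (X r) = N"
proof -
  let ?S = "hcat n (map S [0..<R])" and ?W = "transpose_mat (hcat n (map X [0..<R]))"
  let ?N = "N * S r * transpose_mat (X r)"
  let ?L = "sum_list (map l [0..<R])"
  have Sc: "?S \<in> carrier_mat n ?L" by (rule hcat_map_carrier) (use S in auto)
  have Wc: "?W \<in> carrier_mat ?L n" unfolding transpose_carrier_mat by (rule hcat_map_carrier) (use X in auto)
  have NSc: "N * S r \<in> carrier_mat k (l r)" using N S[OF r] by simp
  have Nc: "?N \<in> carrier_mat k n" using NSc X[OF r] by simp
  have "?N * S s = N * S s" if s: "s < R" for s
  proof -
    have "?N * S s = N * S r * (transpose_mat (X r) * S s)"
      by (rule assoc_mult_mat[OF NSc _ S[OF s]]) (use X[OF r] in simp)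
    then show ?thesis using XS[OF r s] NS[OF s] NSc right_mult_zero_mat[OF NSc, of "l s"] by (cases "s = r") auto
  qed
  then have m: "map (\<lambda>s. ?N * S s) [0..<R] = map (\<lambda>s. N * S s) [0..<R]" by simp
  have "?N * ?S = hcat k (map (\<lambda>s. ?N * S s) [0..<R])"
    by (rule mult_hcat[OF Nc, where l = l]) (use S in auto)
  also have "\<dots> = N * ?S"
    unfolding m by (rule mult_hcat[OF N, where l = l, symmetric]) (use S in auto)
  finally have "?N * ?S = N * ?S" .
  then have "?N * ?S * ?W = N * ?S * ?W" by simp
  then show ?thesis
    unfolding assoc_mult_mat[OF Nc Sc Wc] assoc_mult_mat[OF N Sc Wc] one
      right_mult_one_mat[OF Nc] right_mult_one_mat[OF N] .
qed

text \<open>Insert the resolution of the identity, the sum of the S_r X_r^T, to the right of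
  B.\<close>

lemma block_sum:
  fixes S X :: "nat \<Rightarrow> 'a :: field mat"
  assumes S: "\<And>r. r < R \<Longrightarrow> S r \<in> carrier_mat n (l r)" and X: "\<And>r. r < R \<Longrightarrow> X r \<in> carrier_mat n (l r)"
    and one: "hcat n (map S [0..<R]) * transpose_mat (hcat n (map X [0..<R])) = 1\<^sub>m n"
    and B: "B \<in> carrier_mat m n" and "i < m" "j < n"
  shows "B $$ (i, j) = (\<Sum>r<R. (B * S r * transpose_mat (X r)) $$ (i, j))"
proof -
  let ?S = "hcat n (map S [0..<R])" and ?W = "transpose_mat (hcat n (map X [0..<R]))"
  let ?L = "sum_list (map l [0..<R])"
  have Sc: "?S \<in> carrier_mat n ?L" by (rule hcat_map_carrier) (use S in auto)
  have Wc: "?W \<in> carrier_mat ?L n" unfolding transpose_carrier_mat by (rule hcat_map_carrier) (use X in auto)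
  have "B = B * ?S * ?W" unfolding assoc_mult_mat[OF B Sc Wc] one using B by simp
  also have "B * ?S = hcat m (map (\<lambda>r. B * S r) [0..<R])"
    by (rule mult_hcat[OF B]) (use S in auto)
  finally have "B $$ (i, j) = (hcat m (map (\<lambda>r. B * S r) [0..<R]) * ?W) $$ (i, j)" by simp
  also have "\<dots> = (\<Sum>r\<leftarrow>[0..<R]. (B * S r * transpose_mat (X r)) $$ (i, j))"
    by (rule hcat_mult_transpose_hcat[where l = l]) (use assms in \<open>auto intro!: mult_carrier_mat[OF B]\<close>)
  finally show ?thesis unfolding sum_list_upt .
qed

text \<open>The unfolding factors as (U S) (C X^T) through dimension l. The left factor is
  injective, and for invertible C the right factor has the right inverse S C'. The r-th term of A is
  the case C = 1, that of B the case where C is the r-th primary block.\<close>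

lemma rank_mode1_block:
  fixes X S C :: "'a :: field mat"
  assumes \<A>: "\<A> \<in> carrier_tensor3 n1 n2 n3" and inj: "injective_mat (unfold_23_1 n1 \<A>)"
    and X: "X \<in> carrier_mat n1 l" and S: "S \<in> carrier_mat n1 l" and C: "C \<in> carrier_mat l l"
    and XS: "transpose_mat X * S = 1\<^sub>m l"
  shows "mat_rank (unfold_23_1 n1 (\<A> \<bullet>\<^sub>1 (X * transpose_mat C * transpose_mat S))) \<le> l"
    and "C' \<in> carrier_mat l l \<Longrightarrow> C * C' = 1\<^sub>m l \<Longrightarrow>
      mat_rank (unfold_23_1 n1 (\<A> \<bullet>\<^sub>1 (X * transpose_mat C * transpose_mat S))) = l"
proof -
  let ?U = "unfold_23_1 n1 \<A>" and ?k = "sum_list (map dim_col \<A>)"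
  note U = unfold_23_1_carrier[OF \<A>]
  have XT: "transpose_mat X \<in> carrier_mat l n1" using X by simp
  have "transpose_mat (X * transpose_mat C * transpose_mat S) = S * (C * transpose_mat X)"
    using transpose_mult[of "X * transpose_mat C" n1 l "transpose_mat S" n1]
      transpose_mult[of X n1 l "transpose_mat C" l] X S C by simp
  moreover have "X * transpose_mat C * transpose_mat S \<in> carrier_mat n1 n1" using X S C by simp
  ultimately have *: "unfold_23_1 n1 (\<A> \<bullet>\<^sub>1 (X * transpose_mat C * transpose_mat S)) =
      ?U * S * (C * transpose_mat X)"
    using unfold_23_1_mode1_prod[OF \<A>] assoc_mult_mat[OF U S mult_carrier_mat[OF C XT]] by simp
  have US: "?U * S \<in> carrier_mat ?k l" using U S by simp
  have CX: "C * transpose_mat X \<in> carrier_mat l n1" using C X by simp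
  show "mat_rank (unfold_23_1 n1 (\<A> \<bullet>\<^sub>1 (X * transpose_mat C * transpose_mat S))) \<le> l"
    unfolding * by (rule mat_rank_mult_le[OF US CX])
  assume C': "C' \<in> carrier_mat l l" "C * C' = 1\<^sub>m l"
  have "injective_mat S" by (rule injective_mat_left_inverse[OF S XT XS])
  then have "injective_mat (?U * S)" by (rule injective_mat_mult[OF U S inj])
  moreover have "C * transpose_mat X * (S * C') = 1\<^sub>m l"
  proof -
    have "C * transpose_mat X * (S * C') = C * (transpose_mat X * (S * C'))"
      by (rule assoc_mult_mat[OF C XT mult_carrier_mat[OF S C'(1)]])
    also have "transpose_mat X * (S * C') = C'"
      using assoc_mult_mat[OF XT S C'(1)] XS C'(1) by simp
    finally show ?thesis using C'(2) by simp
  qed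
  ultimately show "mat_rank (unfold_23_1 n1 (\<A> \<bullet>\<^sub>1 (X * transpose_mat C * transpose_mat S))) = l"
    unfolding * by (intro mat_rank_mult_eq[OF US CX, of "S * C'"]) (use S C' in auto)
qed

text \<open>A monic irreducible p other than X is comaximal with X, and so is p^k. Evaluated at T,
  the identity u p^k + v X = 1 becomes T v(T) = 1.\<close>

lemma primary_block_invertible:
  fixes T :: "'a :: field mat"
  assumes T: "T \<in> carrier_mat l l" and p: "irreducible p" "lead_coeff p = 1" "p \<noteq> [:0, 1:]"
    and z: "poly_mat (p ^ k) T = 0\<^sub>m l l"
  shows "\<exists>T'. T' \<in> carrier_mat l l \<and> T * T' = 1\<^sub>m l"
proof -
  have "irreducible ([:0, 1:] :: 'a poly)" by (rule irreducible_linear_field_poly) simp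
  then have "comaximal p [:0, 1:]" by (intro comaximal_irreducible) (use p in auto)
  then obtain u v where uv: "u * p ^ k + v * [:0, 1:] = 1"
    using comaximal_power unfolding comaximal_def by blast
  have "poly_mat (u * p ^ k) T + poly_mat (v * [:0, 1:]) T = 1\<^sub>m l"
    unfolding poly_mat_add[OF T, symmetric] uv by (rule poly_mat_1[OF T])
  moreover have "poly_mat (u * p ^ k) T = 0\<^sub>m l l"
    unfolding poly_mat_mult[OF T] z using right_mult_zero_mat[OF poly_mat_carrier[OF T]] by simp
  moreover have "poly_mat (v * [:0, 1:]) T = T * poly_mat v T"
    unfolding mult.commute[of v] poly_mat_mult[OF T] poly_mat_X[OF T] ..
  ultimately have "T * poly_mat v T = 1\<^sub>m l"
    using mult_carrier_mat[OF T poly_mat_carrier[OF T, of v]] by simp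
  then show ?thesis using poly_mat_carrier[OF T] by blast
qed

text \<open>A homogeneous Sylvester equation with coprime annihilating polynomials. Since g(T2) = 0,
  (u f)(T2) is the identity, so D = D (u f)(T2) = (u f)(T1) D = 0.\<close>

lemma comaximal_intertwine_zero:
  fixes T1 T2 :: "'a :: field mat"
  assumes T1: "T1 \<in> carrier_mat l1 l1" and T2: "T2 \<in> carrier_mat l2 l2" and D: "D \<in> carrier_mat l1 l2"
    and TD: "T1 * D = D * T2" and f: "poly_mat f T1 = 0\<^sub>m l1 l1" and g: "poly_mat g T2 = 0\<^sub>m l2 l2"
    and "comaximal f g"
  shows "D = 0\<^sub>m l1 l2"
proof -
  obtain u v where uv: "u * f + v * g = 1" using \<open>comaximal f g\<close> unfolding comaximal_def by blast
  have "poly_mat (u * f) T2 + poly_mat (v * g) T2 = 1\<^sub>m l2"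
    unfolding poly_mat_add[OF T2, symmetric] uv by (rule poly_mat_1[OF T2])
  moreover have "poly_mat (v * g) T2 = 0\<^sub>m l2 l2"
    unfolding poly_mat_mult[OF T2] g using right_mult_zero_mat[OF poly_mat_carrier[OF T2]] by simp
  ultimately have "poly_mat (u * f) T2 = 1\<^sub>m l2" using poly_mat_carrier[OF T2, of "u * f"] by simp
  then have "D = D * poly_mat (u * f) T2" using D by simp
  also have "\<dots> = poly_mat (u * f) T1 * D"
    by (rule poly_mat_intertwine[OF T1 T2 D TD, symmetric])
  also have "poly_mat (u * f) T1 = 0\<^sub>m l1 l1"
    unfolding poly_mat_mult[OF T1] f using right_mult_zero_mat[OF poly_mat_carrier[OF T1]] by simp
  finally show ?thesis using D by simp
qed

section \<open>Assembling the terms of the two tensors\<close>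

lemma sum_tensor3_eqI:
  assumes \<A>: "\<A> \<in> carrier_tensor3 n1 n2 n3"
    and eq: "\<And>i j k. i < n3 \<Longrightarrow> j < n1 \<Longrightarrow> k < n2 \<Longrightarrow> (\<A> ! i) $$ (j, k) = (\<Sum>r<R. (F r ! i) $$ (j, k))"
  shows "\<A> = sum_tensor3 n1 n2 n3 R F"
proof (rule nth_equalityI)
  show "length \<A> = length (sum_tensor3 n1 n2 n3 R F)"
    using carrier_tensor3_length[OF \<A>] by (simp add: sum_tensor3_def)
  fix i assume "i < length \<A>"
  then have i: "i < n3" using carrier_tensor3_length[OF \<A>] by simp
  then have "sum_tensor3 n1 n2 n3 R F ! i = mat n1 n2 (\<lambda>jk. \<Sum>r<R. (F r ! i) $$ jk)"
    by (simp add: sum_tensor3_def)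
  also have "\<dots> = \<A> ! i"
    using carrier_tensor3_nth[OF \<A> i] eq[OF i] by (intro eq_matI) auto
  finally show "\<A> ! i = sum_tensor3 n1 n2 n3 R F ! i" by simp
qed

lemma sum_tensor3_cong:
  "(\<And>r. r < R \<Longrightarrow> F r = G r) \<Longrightarrow> sum_tensor3 n1 n2 n3 R F = sum_tensor3 n1 n2 n3 R G"
  by (simp add: sum_tensor3_def)

text \<open>Statements 2, 3, 6 and 7 with abstract block sizes \<open>l1\<close> and
  \<open>l2\<close>. They rest on M S_r = S_r T_r, the invertibility of S, the annihilation of the
  T_r by pairwise comaximal powers, and the injective unfoldings.\<close>

lemma coupled_block_decomposition:
  fixes \<A> \<B> :: "'a :: field tensor3" and M1 M2 :: "'a mat" and l1 l2 :: "nat \<Rightarrow> nat"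
  assumes \<A>: "\<A> \<in> carrier_tensor3 n1 n2 n3" and \<B>: "\<B> \<in> carrier_tensor3 n1 n2 n3"
    and inj1: "injective_mat (unfold_23_1 n1 \<A>)" and inj2: "injective_mat (unfold_13_2 n2 \<A>)"
    and M1: "M1 \<in> carrier_mat n1 n1" and M2: "M2 \<in> carrier_mat n2 n2"
    and B1: "\<And>i. i < n3 \<Longrightarrow> \<B> ! i = transpose_mat M1 * \<A> ! i"
    and B2: "\<And>i. i < n3 \<Longrightarrow> \<B> ! i = \<A> ! i * M2"
    and S1: "\<And>r. r < R \<Longrightarrow> S1 r \<in> carrier_mat n1 (l1 r)" and T1: "\<And>r. r < R \<Longrightarrow> T1 r \<in> carrier_mat (l1 r) (l1 r)"
    and S2: "\<And>r. r < R \<Longrightarrow> S2 r \<in> carrier_mat n2 (l2 r)" and T2: "\<And>r. r < R \<Longrightarrow> T2 r \<in> carrier_mat (l2 r) (l2 r)"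
    and MS1: "\<And>r. r < R \<Longrightarrow> M1 * S1 r = S1 r * T1 r" and MS2: "\<And>r. r < R \<Longrightarrow> M2 * S2 r = S2 r * T2 r"
    and inv1: "invertible_mat (hcat n1 (map S1 [0..<R]))" and inv2: "invertible_mat (hcat n2 (map S2 [0..<R]))"
    and fact: "irreducible_factorization q R p \<mu>"
    and pT1: "\<And>r. r < R \<Longrightarrow> poly_mat (p r ^ \<mu> r) (T1 r) = 0\<^sub>m (l1 r) (l1 r)"
    and pT2: "\<And>r. r < R \<Longrightarrow> poly_mat (p r ^ \<mu> r) (T2 r) = 0\<^sub>m (l2 r) (l2 r)"
  shows "(\<exists>D X1 X2.
                 let S1' = hcat n1 (map S1 [0..<R]); S2' = hcat n2 (map S2 [0..<R]);
                     \<A>' = (\<lambda>r. D r \<bullet>\<^sub>1 X1 r \<bullet>\<^sub>2 X2 r);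
                     \<B>' = (\<lambda>r. (D r \<bullet>\<^sub>1 transpose_mat (T1 r)) \<bullet>\<^sub>1 X1 r \<bullet>\<^sub>2 X2 r) in
                 (\<forall>r<R. D r \<in> carrier_tensor3 (l1 r) (l2 r) n3) \<and>
                 (\<forall>i<n3. transpose_mat S1' * (\<A> ! i) * S2' =
                         diag_block_mat (map (\<lambda>r. D r ! i) [0..<R])) \<and>
                 (\<forall>i<n3. \<forall>r<R. transpose_mat (T1 r) * (D r ! i) = (D r ! i) * T2 r) \<and>

                 (\<forall>r<R. X1 r \<in> carrier_mat n1 (l1 r) \<and> X2 r \<in> carrier_mat n2 (l2 r)) \<and>
                 hcat n1 (map X1 [0..<R]) = mat_inv (transpose_mat S1') \<and>
                 hcat n2 (map X2 [0..<R]) = mat_inv (transpose_mat S2') \<and>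
                 \<A> = sum_tensor3 n1 n2 n3 R \<A>' \<and>
                 \<B> = sum_tensor3 n1 n2 n3 R \<B>' \<and>
                 (\<forall>r<R. is_ml_rank n1 n2 (\<A>' r) (l1 r) (l2 r)) \<and>
                 (\<forall>r<R. mat_rank (unfold_23_1 n1 (\<B>' r)) \<le> l1 r \<and>
                        mat_rank (unfold_13_2 n2 (\<B>' r)) \<le> l2 r \<and>
                        (p r \<noteq> [:0, 1:] \<longrightarrow> is_ml_rank n1 n2 (\<B>' r) (l1 r) (l2 r))) \<and>
                 (\<forall>r<R. D r \<bullet>\<^sub>1 transpose_mat (T1 r) = D r \<bullet>\<^sub>2 transpose_mat (T2 r)) \<and>

                 (\<forall>r<R. \<forall>c. T1 r = c \<cdot>\<^sub>m 1\<^sub>m (l1 r) \<or> T2 r = c \<cdot>\<^sub>m 1\<^sub>m (l2 r) \<longrightarrow>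
                        \<B>' r = smult_tensor3 c (\<A>' r)) \<and>

                 (\<forall>c. (\<forall>r<R. T1 r = c r \<cdot>\<^sub>m 1\<^sub>m (l1 r) \<or> T2 r = c r \<cdot>\<^sub>m 1\<^sub>m (l2 r)) \<longrightarrow>
                      (\<forall>r<R. is_ml_rank n1 n2 (\<A>' r) (l1 r) (l2 r)) \<and>
                      \<A> = sum_tensor3 n1 n2 n3 R \<A>' \<and>
                      \<B> = sum_tensor3 n1 n2 n3 R (\<lambda>r. smult_tensor3 (c r) (\<A>' r))))"
proof -
  obtain X1 where X1: "\<And>r. r < R \<Longrightarrow> X1 r \<in> carrier_mat n1 (l1 r)"
    and X1_inv: "hcat n1 (map X1 [0..<R]) = mat_inv (transpose_mat (hcat n1 (map S1 [0..<R])))"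
    and XS1: "\<And>r s. r < R \<Longrightarrow> s < R \<Longrightarrow>
      transpose_mat (X1 r) * S1 s = (if r = s then 1\<^sub>m (l1 r) else 0\<^sub>m (l1 r) (l1 s))"
    and one1: "hcat n1 (map S1 [0..<R]) * transpose_mat (hcat n1 (map X1 [0..<R])) = 1\<^sub>m n1"
    using block_inverse[OF S1 inv1] by blast
  obtain X2 where X2: "\<And>r. r < R \<Longrightarrow> X2 r \<in> carrier_mat n2 (l2 r)"
    and X2_inv: "hcat n2 (map X2 [0..<R]) = mat_inv (transpose_mat (hcat n2 (map S2 [0..<R])))"
    and XS2: "\<And>r s. r < R \<Longrightarrow> s < R \<Longrightarrow>
      transpose_mat (X2 r) * S2 s = (if r = s then 1\<^sub>m (l2 r) else 0\<^sub>m (l2 r) (l2 s))"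
    and one2: "hcat n2 (map S2 [0..<R]) * transpose_mat (hcat n2 (map X2 [0..<R])) = 1\<^sub>m n2"
    using block_inverse[OF S2 inv2] by blast
  define D where "D r = map (\<lambda>A. transpose_mat (S1 r) * A * S2 r) \<A>" for r
  have len: "length \<A> = n3" by (rule carrier_tensor3_length[OF \<A>])
  note A = carrier_tensor3_nth[OF \<A>]
  have S1T: "transpose_mat (S1 r) \<in> carrier_mat (l1 r) n1" if "r < R" for r using S1[OF that] by simp
  have S2T: "transpose_mat (S2 r) \<in> carrier_mat (l2 r) n2" if "r < R" for r using S2[OF that] by simp
  have X1T: "transpose_mat (X1 r) \<in> carrier_mat (l1 r) n1" if "r < R" for r using X1[OF that] by simp
  have X2T: "transpose_mat (X2 r) \<in> carrier_mat (l2 r) n2" if "r < R" for r using X2[OF that] by simp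
  have T1T: "transpose_mat (T1 r) \<in> carrier_mat (l1 r) (l1 r)" if "r < R" for r using T1[OF that] by simp
  have T2T: "transpose_mat (T2 r) \<in> carrier_mat (l2 r) (l2 r)" if "r < R" for r using T2[OF that] by simp
  have M1T: "transpose_mat M1 \<in> carrier_mat n1 n1" using M1 by simp
  have SA: "transpose_mat (S1 r) * \<A> ! i \<in> carrier_mat (l1 r) n2" if "r < R" "i < n3" for r i
    by (rule mult_carrier_mat[OF S1T[OF that(1)] A[OF that(2)]])
  have AS: "\<A> ! i * S2 r \<in> carrier_mat n1 (l2 r)" if "r < R" "i < n3" for r i
    by (rule mult_carrier_mat[OF A[OF that(2)] S2[OF that(1)]])
  have Dn: "D r ! i = transpose_mat (S1 r) * \<A> ! i * S2 r" if "i < n3" for r i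
    using that len by (simp add: D_def)
  have Dc: "D r ! i \<in> carrier_mat (l1 r) (l2 r)" if "r < R" "i < n3" for r i
    unfolding Dn[OF that(2)] by (rule mult_carrier_mat[OF SA[OF that] S2[OF that(1)]])
  have Dlen: "length (D r) = n3" for r using len by (simp add: D_def)
  \<comment> \<open>Stated for all pairs of blocks: for \<open>r = s\<close> it is the relation
    claimed in statement 2, for different \<open>r\<close> and \<open>s\<close> it makes the block
    vanish. The chain carries \<open>T2 s\<close> to the left as \<open>M2\<close>, then as
    \<open>transpose_mat M1\<close>, then as \<open>transpose_mat (T1 r)\<close>.\<close>
  have intertwine: "transpose_mat (T1 r) * (transpose_mat (S1 r) * \<A> ! i * S2 s) =
      (transpose_mat (S1 r) * \<A> ! i * S2 s) * T2 s" if r: "r < R" and s: "s < R" and i: "i < n3" for r s i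
  proof -
    have "(transpose_mat (S1 r) * \<A> ! i * S2 s) * T2 s = transpose_mat (S1 r) * \<A> ! i * (M2 * S2 s)"
      unfolding MS2[OF s] by (rule assoc_mult_mat[OF SA[OF r i] S2[OF s] T2[OF s]])
    also have "\<dots> = transpose_mat (S1 r) * \<A> ! i * M2 * S2 s"
      by (rule assoc_mult_mat[OF SA[OF r i] M2 S2[OF s], symmetric])
    also have "transpose_mat (S1 r) * \<A> ! i * M2 = transpose_mat (S1 r) * (transpose_mat M1 * \<A> ! i)"
      unfolding B1[OF i, symmetric] B2[OF i] by (rule assoc_mult_mat[OF S1T[OF r] A[OF i] M2])
    also have "\<dots> = transpose_mat (S1 r) * transpose_mat M1 * \<A> ! i"
      by (rule assoc_mult_mat[OF S1T[OF r] M1T A[OF i], symmetric])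
    also have "transpose_mat (S1 r) * transpose_mat M1 = transpose_mat (T1 r) * transpose_mat (S1 r)"
      using arg_cong[OF MS1[OF r], of transpose_mat]
      unfolding transpose_mult[OF M1 S1[OF r]] transpose_mult[OF S1[OF r] T1[OF r]] .
    also have "transpose_mat (T1 r) * transpose_mat (S1 r) * \<A> ! i =
        transpose_mat (T1 r) * (transpose_mat (S1 r) * \<A> ! i)"
      by (rule assoc_mult_mat[OF T1T[OF r] S1T[OF r] A[OF i]])
    also have "\<dots> * S2 s = transpose_mat (T1 r) * (transpose_mat (S1 r) * \<A> ! i * S2 s)"
      by (rule assoc_mult_mat[OF T1T[OF r] SA[OF r i] S2[OF s]])
    finally show ?thesis by simp
  qed
  have off: "transpose_mat (S1 r) * \<A> ! i * S2 s = 0\<^sub>m (l1 r) (l2 s)"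
    if r: "r < R" and s: "s < R" and ne: "r \<noteq> s" and i: "i < n3" for r s i
  proof (rule comaximal_intertwine_zero[OF T1T[OF r] T2[OF s] _ intertwine[OF r s i] _ pT2[OF s]])
    show "transpose_mat (S1 r) * \<A> ! i * S2 s \<in> carrier_mat (l1 r) (l2 s)"
      by (rule mult_carrier_mat[OF SA[OF r i] S2[OF s]])
    show "poly_mat (p r ^ \<mu> r) (transpose_mat (T1 r)) = 0\<^sub>m (l1 r) (l1 r)"
      unfolding poly_mat_transpose[OF T1[OF r]] pT1[OF r] by simp
    show "comaximal (p r ^ \<mu> r) (p s ^ \<mu> s)"
      by (rule irreducible_factorization_comaximal[OF fact r s ne])
  qed
  \<comment> \<open>By \<open>off\<close>, the row block
    \<open>transpose_mat (S1 r) * \<A> ! i\<close> kills \<open>S2 s\<close> for every other s, so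
    the projection \<open>S2 r * transpose_mat (X2 r)\<close> leaves it unchanged.\<close>
  have left: "D r ! i * transpose_mat (X2 r) = transpose_mat (S1 r) * \<A> ! i" if r: "r < R" and i: "i < n3" for r i
    unfolding Dn[OF i]
    by (rule block_projection[OF S2 X2 XS2 one2 SA[OF r i] r]) (use off r i in auto)
  have right: "X1 r * D r ! i = \<A> ! i * S2 r" if r: "r < R" and i: "i < n3" for r i
  proof -
    \<comment> \<open>\<open>block_projection\<close> multiplies from the right, so the mirror image
      of \<open>left\<close> is obtained by transposing.\<close>
    let ?N = "transpose_mat (\<A> ! i * S2 r)"
    have N: "?N \<in> carrier_mat (l2 r) n1" using AS[OF r i] by simp
    have NS: "?N * S1 s = transpose_mat (transpose_mat (S1 s) * \<A> ! i * S2 r)" if s: "s < R" for s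
    proof -
      have "transpose_mat (S1 s) * \<A> ! i * S2 r = transpose_mat (S1 s) * (\<A> ! i * S2 r)"
        by (rule assoc_mult_mat[OF S1T[OF s] A[OF i] S2[OF r]])
      then show ?thesis using transpose_mult[OF S1T[OF s] AS[OF r i]] by simp
    qed
    have "?N * S1 r * transpose_mat (X1 r) = ?N"
      by (rule block_projection[OF S1 X1 XS1 one1 N r]) (use NS off r i in auto)
    then have "transpose_mat (D r ! i) * transpose_mat (X1 r) = ?N"
      unfolding NS[OF r] Dn[OF i] .
    then have "transpose_mat (X1 r * D r ! i) = ?N" using transpose_mult[OF X1[OF r] Dc[OF r i]] by simp
    then have "transpose_mat (transpose_mat (X1 r * D r ! i)) = transpose_mat ?N" by simp
    then show ?thesis by simp
  qed
  have TD: "transpose_mat (T1 r) * D r ! i = D r ! i * T2 r" if "r < R" "i < n3" for r i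
    unfolding Dn[OF that(2)] by (rule intertwine[OF that(1,1,2)])
  define \<A>' where "\<A>' r = D r \<bullet>\<^sub>1 X1 r \<bullet>\<^sub>2 X2 r" for r
  define \<B>' where "\<B>' r = (D r \<bullet>\<^sub>1 transpose_mat (T1 r)) \<bullet>\<^sub>1 X1 r \<bullet>\<^sub>2 X2 r" for r
  have len': "length (\<A>' r) = n3" "length (\<B>' r) = n3" for r
    by (simp_all add: \<A>'_def \<B>'_def mode1_prod_def mode2_prod_def Dlen)
  have A'n: "\<A>' r ! i = X1 r * D r ! i * transpose_mat (X2 r)" if "i < n3" for r i
    using that Dlen by (simp add: \<A>'_def mode1_prod_def mode2_prod_def)
  have B'n: "\<B>' r ! i = X1 r * (transpose_mat (T1 r) * D r ! i) * transpose_mat (X2 r)" if "i < n3" for r i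
    using that Dlen by (simp add: \<B>'_def mode1_prod_def mode2_prod_def)
  have A'1: "\<A>' r ! i = X1 r * transpose_mat (S1 r) * \<A> ! i" if r: "r < R" and i: "i < n3" for r i
    unfolding A'n[OF i] assoc_mult_mat[OF X1[OF r] Dc[OF r i] X2T[OF r]] left[OF r i]
    by (rule assoc_mult_mat[OF X1[OF r] S1T[OF r] A[OF i], symmetric])
  have A'2: "\<A>' r ! i = \<A> ! i * S2 r * transpose_mat (X2 r)" if r: "r < R" and i: "i < n3" for r i
    unfolding A'n[OF i] right[OF r i] ..
  have B'1: "\<B>' r ! i = X1 r * transpose_mat (T1 r) * transpose_mat (S1 r) * \<A> ! i"
    if r: "r < R" and i: "i < n3" for r i
  proof -
    have XT: "X1 r * transpose_mat (T1 r) \<in> carrier_mat n1 (l1 r)" by (rule mult_carrier_mat[OF X1[OF r] T1T[OF r]])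
    have "\<B>' r ! i = X1 r * transpose_mat (T1 r) * D r ! i * transpose_mat (X2 r)"
      unfolding B'n[OF i] assoc_mult_mat[OF X1[OF r] T1T[OF r] Dc[OF r i]] ..
    also have "\<dots> = X1 r * transpose_mat (T1 r) * (transpose_mat (S1 r) * \<A> ! i)"
      unfolding assoc_mult_mat[OF XT Dc[OF r i] X2T[OF r]] left[OF r i] ..
    also have "\<dots> = X1 r * transpose_mat (T1 r) * transpose_mat (S1 r) * \<A> ! i"
      by (rule assoc_mult_mat[OF XT S1T[OF r] A[OF i], symmetric])
    finally show ?thesis .
  qed
  have B'2: "\<B>' r ! i = \<A> ! i * S2 r * T2 r * transpose_mat (X2 r)" if r: "r < R" and i: "i < n3" for r i
    unfolding B'n[OF i] TD[OF r i] assoc_mult_mat[OF X1[OF r] Dc[OF r i] T2[OF r], symmetric] right[OF r i] ..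
  \<comment> \<open>The identity is inserted as middle factor to match the form of
    \<open>rank_mode1_block\<close>.\<close>
  have A'mode1: "\<A>' r = \<A> \<bullet>\<^sub>1 (X1 r * transpose_mat (1\<^sub>m (l1 r)) * transpose_mat (S1 r))" if r: "r < R" for r
    using A'1[OF r] len len' right_mult_one_mat[OF X1[OF r]] by (intro nth_equalityI) (auto simp: mode1_prod_def)
  have B'mode1: "\<B>' r = \<A> \<bullet>\<^sub>1 (X1 r * transpose_mat (T1 r) * transpose_mat (S1 r))" if r: "r < R" for r
    using B'1[OF r] len len' by (intro nth_equalityI) (auto simp: mode1_prod_def)
  have tr2: "transpose_mat (X2 r * transpose_mat C * transpose_mat (S2 r)) = S2 r * C * transpose_mat (X2 r)"
    if r: "r < R" and C: "C \<in> carrier_mat (l2 r) (l2 r)" for r C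
  proof -
    have CT: "transpose_mat C \<in> carrier_mat (l2 r) (l2 r)" using C by simp
    show ?thesis
      unfolding transpose_mult[OF mult_carrier_mat[OF X2[OF r] CT] S2T[OF r]] transpose_mult[OF X2[OF r] CT]
        transpose_transpose
      by (rule assoc_mult_mat[OF S2[OF r] C X2T[OF r], symmetric])
  qed
  have A'mode2: "\<A>' r = \<A> \<bullet>\<^sub>2 (X2 r * transpose_mat (1\<^sub>m (l2 r)) * transpose_mat (S2 r))" if r: "r < R" for r
  proof (rule nth_equalityI)
    fix i assume "i < length (\<A>' r)"
    then have i: "i < n3" by (simp add: len')
    have "\<A>' r ! i = \<A> ! i * (S2 r * 1\<^sub>m (l2 r) * transpose_mat (X2 r))"
      unfolding A'2[OF r i] right_mult_one_mat[OF S2[OF r]] by (rule assoc_mult_mat[OF A[OF i] S2[OF r] X2T[OF r]])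
    then show "\<A>' r ! i = (\<A> \<bullet>\<^sub>2 (X2 r * transpose_mat (1\<^sub>m (l2 r)) * transpose_mat (S2 r))) ! i"
      using i len tr2[OF r one_carrier_mat] by (simp add: mode2_prod_def)
  qed (simp add: len len' mode2_prod_def)
  have B'mode2: "\<B>' r = \<A> \<bullet>\<^sub>2 (X2 r * transpose_mat (T2 r) * transpose_mat (S2 r))" if r: "r < R" for r
  proof (rule nth_equalityI)
    fix i assume "i < length (\<B>' r)"
    then have i: "i < n3" by (simp add: len')
    have "\<B>' r ! i = \<A> ! i * (S2 r * T2 r * transpose_mat (X2 r))"
      unfolding B'2[OF r i] assoc_mult_mat[OF A[OF i] S2[OF r] T2[OF r]]
      by (rule assoc_mult_mat[OF A[OF i] mult_carrier_mat[OF S2[OF r] T2[OF r]] X2T[OF r]])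
    then show "\<B>' r ! i = (\<A> \<bullet>\<^sub>2 (X2 r * transpose_mat (T2 r) * transpose_mat (S2 r))) ! i"
      using i len tr2[OF r T2[OF r]] by (simp add: mode2_prod_def)
  qed (simp add: len len' mode2_prod_def)
  note \<A>T = transpose_carrier_tensor3[OF \<A>]
  note inj2' = inj2[unfolded unfold_13_2_eq]
  have mode2: "unfold_13_2 n2 (\<A> \<bullet>\<^sub>2 N) = unfold_23_1 n2 (map transpose_mat \<A> \<bullet>\<^sub>1 N)"
    if "N \<in> carrier_mat n2 n2" for N
    unfolding unfold_13_2_eq mode1_prod_transpose[OF \<A> that] ..
  have XCS2: "X2 r * transpose_mat C * transpose_mat (S2 r) \<in> carrier_mat n2 n2"
    if "r < R" "C \<in> carrier_mat (l2 r) (l2 r)" for r C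
    by (rule mult_carrier_mat[OF mult_carrier_mat[OF X2[OF that(1)]] S2T[OF that(1)]]) (use that in simp)
  have XS1': "transpose_mat (X1 r) * S1 r = 1\<^sub>m (l1 r)" and XS2': "transpose_mat (X2 r) * S2 r = 1\<^sub>m (l2 r)"
    if "r < R" for r using XS1[OF that that] XS2[OF that that] by simp_all
  have rankA: "is_ml_rank n1 n2 (\<A>' r) (l1 r) (l2 r)" if r: "r < R" for r
    unfolding is_ml_rank_def
  proof
    show "mat_rank (unfold_23_1 n1 (\<A>' r)) = l1 r"
      unfolding A'mode1[OF r]
      by (rule rank_mode1_block(2)[OF \<A> inj1 X1[OF r] S1[OF r] one_carrier_mat XS1'[OF r] one_carrier_mat]) simp
    show "mat_rank (unfold_13_2 n2 (\<A>' r)) = l2 r"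
      unfolding A'mode2[OF r] mode2[OF XCS2[OF r one_carrier_mat]]
      by (rule rank_mode1_block(2)[OF \<A>T inj2' X2[OF r] S2[OF r] one_carrier_mat XS2'[OF r] one_carrier_mat]) simp
  qed
  have rankB: "mat_rank (unfold_23_1 n1 (\<B>' r)) \<le> l1 r" "mat_rank (unfold_13_2 n2 (\<B>' r)) \<le> l2 r"
    if r: "r < R" for r
  proof -
    show "mat_rank (unfold_23_1 n1 (\<B>' r)) \<le> l1 r"
      unfolding B'mode1[OF r]
      by (rule rank_mode1_block(1)[OF \<A> inj1 X1[OF r] S1[OF r] T1[OF r] XS1'[OF r]])
    show "mat_rank (unfold_13_2 n2 (\<B>' r)) \<le> l2 r"
      unfolding B'mode2[OF r] mode2[OF XCS2[OF r T2[OF r]]]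
      by (rule rank_mode1_block(1)[OF \<A>T inj2' X2[OF r] S2[OF r] T2[OF r] XS2'[OF r]])
  qed
  \<comment> \<open>The exact rank needs right inverses of both primary blocks. For
    \<open>p r = [:0, 1:]\<close> these blocks are nilpotent, and the term of \<open>\<B>\<close>
    may even be zero.\<close>
  have rankB_eq: "is_ml_rank n1 n2 (\<B>' r) (l1 r) (l2 r)" if r: "r < R" and p: "p r \<noteq> [:0, 1:]" for r
  proof -
    have irr: "irreducible (p r)" "lead_coeff (p r) = 1" using fact r by (auto simp: irreducible_factorization_def)
    obtain T1' where T1': "T1' \<in> carrier_mat (l1 r) (l1 r)" "T1 r * T1' = 1\<^sub>m (l1 r)"
      using primary_block_invertible[OF T1[OF r] irr p pT1[OF r]] by blast
    obtain T2' where T2': "T2' \<in> carrier_mat (l2 r) (l2 r)" "T2 r * T2' = 1\<^sub>m (l2 r)"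
      using primary_block_invertible[OF T2[OF r] irr p pT2[OF r]] by blast
    have "mat_rank (unfold_23_1 n1 (\<B>' r)) = l1 r"
      unfolding B'mode1[OF r]
      by (rule rank_mode1_block(2)[OF \<A> inj1 X1[OF r] S1[OF r] T1[OF r] XS1'[OF r] T1'])
    moreover have "mat_rank (unfold_13_2 n2 (\<B>' r)) = l2 r"
      unfolding B'mode2[OF r] mode2[OF XCS2[OF r T2[OF r]]]
      by (rule rank_mode1_block(2)[OF \<A>T inj2' X2[OF r] S2[OF r] T2[OF r] XS2'[OF r] T2'])
    ultimately show ?thesis by (simp add: is_ml_rank_def)
  qed
  have sumA: "\<A> = sum_tensor3 n1 n2 n3 R \<A>'"
  proof (rule sum_tensor3_eqI[OF \<A>])
    fix i j k assume i: "i < n3" and jk: "j < n1" "k < n2"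
    have "(\<A> ! i) $$ (j, k) = (\<Sum>r<R. (\<A> ! i * S2 r * transpose_mat (X2 r)) $$ (j, k))"
      by (rule block_sum[OF S2 X2 one2 A[OF i] jk])
    also have "\<dots> = (\<Sum>r<R. (\<A>' r ! i) $$ (j, k))"
      by (rule sum.cong) (auto simp: A'2[OF _ i])
    finally show "(\<A> ! i) $$ (j, k) = (\<Sum>r<R. (\<A>' r ! i) $$ (j, k))" .
  qed
  have sumB: "\<B> = sum_tensor3 n1 n2 n3 R \<B>'"
  proof (rule sum_tensor3_eqI[OF \<B>])
    fix i j k assume i: "i < n3" and jk: "j < n1" "k < n2"
    have BS: "\<B> ! i * S2 r * transpose_mat (X2 r) = \<B>' r ! i" if r: "r < R" for r
      unfolding B'2[OF r i] B2[OF i] assoc_mult_mat[OF A[OF i] M2 S2[OF r]] MS2[OF r]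
        assoc_mult_mat[OF A[OF i] S2[OF r] T2[OF r]] ..
    have "(\<B> ! i) $$ (j, k) = (\<Sum>r<R. (\<B> ! i * S2 r * transpose_mat (X2 r)) $$ (j, k))"
      by (rule block_sum[OF S2 X2 one2 carrier_tensor3_nth[OF \<B> i] jk])
    also have "\<dots> = (\<Sum>r<R. (\<B>' r ! i) $$ (j, k))"
      by (rule sum.cong) (auto simp: BS)
    finally show "(\<B> ! i) $$ (j, k) = (\<Sum>r<R. (\<B>' r ! i) $$ (j, k))" .
  qed
  have scalar: "\<B>' r = smult_tensor3 c (\<A>' r)"
    if r: "r < R" and c: "T1 r = c \<cdot>\<^sub>m 1\<^sub>m (l1 r) \<or> T2 r = c \<cdot>\<^sub>m 1\<^sub>m (l2 r)" for r c
  proof (rule nth_equalityI)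
    fix i assume "i < length (\<B>' r)"
    then have i: "i < n3" by (simp add: len')
    \<comment> \<open>By \<open>TD\<close> the left-hand side is also \<open>D r ! i * T2 r\<close>,
      so a scalar block on either side is enough.\<close>
    have "transpose_mat (T1 r) * D r ! i = c \<cdot>\<^sub>m D r ! i"
      using c
    proof
      assume "T1 r = c \<cdot>\<^sub>m 1\<^sub>m (l1 r)"
      then have "transpose_mat (T1 r) = c \<cdot>\<^sub>m 1\<^sub>m (l1 r)" by (intro eq_matI) auto
      then show ?thesis
        using mult_smult_assoc_mat[OF one_carrier_mat Dc[OF r i], of c] left_mult_one_mat[OF Dc[OF r i]] by simp
    next
      assume "T2 r = c \<cdot>\<^sub>m 1\<^sub>m (l2 r)"
      then show ?thesis
        unfolding TD[OF r i]
        using mult_smult_distrib[OF Dc[OF r i] one_carrier_mat, of c] right_mult_one_mat[OF Dc[OF r i]] by simp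
    qed
    then have "\<B>' r ! i = c \<cdot>\<^sub>m (\<A>' r ! i)"
      unfolding B'n[OF i] A'n[OF i]
      using mult_smult_distrib[OF X1[OF r] Dc[OF r i], of c]
        mult_smult_assoc_mat[OF mult_carrier_mat[OF X1[OF r] Dc[OF r i]] X2T[OF r], of c] by simp
    then show "\<B>' r ! i = smult_tensor3 c (\<A>' r) ! i" using i len' by (simp add: smult_tensor3_def)
  qed (simp add: len' smult_tensor3_def)
  have diag: "transpose_mat (hcat n1 (map S1 [0..<R])) * (\<A> ! i) * hcat n2 (map S2 [0..<R]) =
      diag_block_mat (map (\<lambda>r. D r ! i) [0..<R])" if i: "i < n3" for i
  proof -
    have c1: "hcat n1 (map S1 [0..<R]) \<in> carrier_mat n1 (sum_list (map l1 [0..<R]))"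
      by (rule hcat_map_carrier) (use S1 in auto)
    have c2: "hcat n2 (map S2 [0..<R]) \<in> carrier_mat n2 (sum_list (map l2 [0..<R]))"
      by (rule hcat_map_carrier) (use S2 in auto)
    have as: "transpose_mat (S1 r) * (\<A> ! i * S2 s) = transpose_mat (S1 r) * \<A> ! i * S2 s"
      if "r < R" "s < R" for r s
      by (rule assoc_mult_mat[OF S1T[OF that(1)] A[OF i] S2[OF that(2)], symmetric])
    have "transpose_mat (hcat n1 (map S1 [0..<R])) * (\<A> ! i) * hcat n2 (map S2 [0..<R]) =
        transpose_mat (hcat n1 (map S1 [0..<R])) * (\<A> ! i * hcat n2 (map S2 [0..<R]))"
      by (rule assoc_mult_mat[OF _ A[OF i] c2]) (use c1 in simp)
    also have "\<A> ! i * hcat n2 (map S2 [0..<R]) = hcat n1 (map (\<lambda>r. \<A> ! i * S2 r) [0..<R])"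
      by (rule mult_hcat[OF A[OF i], where l = l2]) (use S2 in auto)
    also have "transpose_mat (hcat n1 (map S1 [0..<R])) * \<dots> =
        diag_block_mat (map (\<lambda>r. transpose_mat (S1 r) * (\<A> ! i * S2 r)) [0..<R])"
      by (rule transpose_hcat_mult_hcat[where k = l1 and l = l2]) (use S1 AS i as off in auto)
    also have "map (\<lambda>r. transpose_mat (S1 r) * (\<A> ! i * S2 r)) [0..<R] = map (\<lambda>r. D r ! i) [0..<R]"
      using as by (simp add: Dn[OF i])
    finally show ?thesis .
  qed
  have Dcar: "D r \<in> carrier_tensor3 (l1 r) (l2 r) n3" if "r < R" for r
    unfolding carrier_tensor3_def using Dlen Dc[OF that] by (auto simp: in_set_conv_nth)
  have modeD: "D r \<bullet>\<^sub>1 transpose_mat (T1 r) = D r \<bullet>\<^sub>2 transpose_mat (T2 r)" if "r < R" for r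
    using TD[OF that] Dlen by (intro nth_equalityI) (auto simp: mode1_prod_def mode2_prod_def)
  have same: "\<B> = sum_tensor3 n1 n2 n3 R (\<lambda>r. smult_tensor3 (c r) (\<A>' r))"
    if "\<forall>r<R. T1 r = c r \<cdot>\<^sub>m 1\<^sub>m (l1 r) \<or> T2 r = c r \<cdot>\<^sub>m 1\<^sub>m (l2 r)" for c
  proof -
    have "sum_tensor3 n1 n2 n3 R \<B>' = sum_tensor3 n1 n2 n3 R (\<lambda>r. smult_tensor3 (c r) (\<A>' r))"
      by (rule sum_tensor3_cong, rule scalar) (use that in auto)
    then show ?thesis by (rule trans[OF sumB])
  qed
  show ?thesis
    unfolding Let_def
    by (rule exI[of _ D], rule exI[of _ X1], rule exI[of _ X2], unfold \<A>'_def[symmetric] \<B>'_def[symmetric],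
        intro conjI allI impI Dcar diag TD X1 X2 X1_inv X2_inv sumA sumB rankA rankB rankB_eq modeD scalar same;
        (assumption | erule allE, erule mp, assumption))
qed

section \<open>From relations between unfoldings to relations between slices\<close>

lemma mode1_prod_carrier:
  "\<A> \<in> carrier_tensor3 n1 n2 n3 \<Longrightarrow> N \<in> carrier_mat m n1 \<Longrightarrow> \<A> \<bullet>\<^sub>1 N \<in> carrier_tensor3 m n2 n3"
  by (auto simp: carrier_tensor3_def mode1_prod_def)

lemma unfold_23_1_eq_multD:
  fixes \<A> \<B> :: "'a :: comm_semiring_0 tensor3"
  assumes \<A>: "\<A> \<in> carrier_tensor3 n1 n2 n3" and \<B>: "\<B> \<in> carrier_tensor3 n1 n2 n3"
    and M: "M \<in> carrier_mat n1 n1" and eq: "unfold_23_1 n1 \<B> = unfold_23_1 n1 \<A> * M" and i: "i < n3"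
  shows "\<B> ! i = transpose_mat M * \<A> ! i"
proof -
  have MT: "transpose_mat M \<in> carrier_mat n1 n1" using M by simp
  have "\<B> = \<A> \<bullet>\<^sub>1 transpose_mat M"
    by (rule unfold_23_1_inject[OF \<B> mode1_prod_carrier[OF \<A> MT]])
      (simp add: eq unfold_23_1_mode1_prod[OF \<A> MT])
  then show ?thesis using i carrier_tensor3_length[OF \<A>] by (simp add: mode1_prod_def)
qed

lemma unfold_13_2_eq_multD:
  fixes \<A> \<B> :: "'a :: comm_semiring_0 tensor3"
  assumes \<A>: "\<A> \<in> carrier_tensor3 n1 n2 n3" and \<B>: "\<B> \<in> carrier_tensor3 n1 n2 n3"
    and M: "M \<in> carrier_mat n2 n2" and eq: "unfold_13_2 n2 \<B> = unfold_13_2 n2 \<A> * M" and i: "i < n3"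
  shows "\<B> ! i = \<A> ! i * M"
proof -
  have MT: "transpose_mat M \<in> carrier_mat n2 n2" using M by simp
  note Ai = carrier_tensor3_nth[OF \<A> i]
  have "map transpose_mat \<B> ! i = transpose_mat M * map transpose_mat \<A> ! i"
    by (rule unfold_23_1_eq_multD[OF transpose_carrier_tensor3[OF \<A>] transpose_carrier_tensor3[OF \<B>] M
          eq[unfolded unfold_13_2_eq] i])
  also have "\<dots> = transpose_mat (\<A> ! i * M)"
    using transpose_mult[OF Ai M] i carrier_tensor3_length[OF \<A>] by simp
  finally have "transpose_mat (\<B> ! i) = transpose_mat (\<A> ! i * M)"
    using i carrier_tensor3_length[OF \<B>] by simp
  then have "transpose_mat (transpose_mat (\<B> ! i)) = transpose_mat (transpose_mat (\<A> ! i * M))" by simp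
  then show ?thesis by simp
qed

text \<open>Both sides are linear in the slices, so the relation passes to every combination of
  them.\<close>

lemma slice_combination_intertwine:
  fixes \<A> :: "'a :: field tensor3"
  assumes \<A>: "\<A> \<in> carrier_tensor3 n1 n2 n3"
    and N: "N \<in> carrier_mat n1 n1" and M: "M \<in> carrier_mat n2 n2"
    and eq: "\<And>i. i < n3 \<Longrightarrow> N * \<A> ! i = \<A> ! i * M"
  shows "N * slice_combination n1 n2 \<A> c = slice_combination n1 n2 \<A> c * M"
proof (rule eq_matI)
  let ?C = "slice_combination n1 n2 \<A> c"
  have C: "?C \<in> carrier_mat n1 n2" by (simp add: slice_combination_def)
  have len: "length \<A> = n3" by (rule carrier_tensor3_length[OF \<A>])
  fix j k assume "j < dim_row (?C * M)" "k < dim_col (?C * M)"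
  then have jk: "j < n1" "k < n2" using C M by auto
  have entry: "?C $$ (a, b) = (\<Sum>i<n3. c i * (\<A> ! i) $$ (a, b))" if "a < n1" "b < n2" for a b
    using that by (simp add: slice_combination_def len)
  have "(N * ?C) $$ (j, k) = (\<Sum>a<n1. \<Sum>i<n3. c i * (N $$ (j, a) * (\<A> ! i) $$ (a, k)))"
    using jk N C by (simp add: scalar_prod_def atLeast0LessThan entry sum_distrib_left mult.left_commute)
  also have "\<dots> = (\<Sum>i<n3. \<Sum>a<n1. c i * (N $$ (j, a) * (\<A> ! i) $$ (a, k)))" by (rule sum.swap)
  also have "\<dots> = (\<Sum>i<n3. c i * (N * \<A> ! i) $$ (j, k))"
  proof (rule sum.cong[OF refl])
    fix i assume "i \<in> {..<n3}"
    then have "\<A> ! i \<in> carrier_mat n1 n2" using carrier_tensor3_nth[OF \<A>] by simp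
    then show "(\<Sum>a<n1. c i * (N $$ (j, a) * (\<A> ! i) $$ (a, k))) = c i * (N * \<A> ! i) $$ (j, k)"
      using jk N by (simp add: scalar_prod_def atLeast0LessThan sum_distrib_left)
  qed
  also have "\<dots> = (\<Sum>i<n3. c i * (\<A> ! i * M) $$ (j, k))" using eq by simp
  also have "\<dots> = (\<Sum>i<n3. \<Sum>b<n2. c i * ((\<A> ! i) $$ (j, b) * M $$ (b, k)))"
  proof (rule sum.cong[OF refl])
    fix i assume "i \<in> {..<n3}"
    then have "\<A> ! i \<in> carrier_mat n1 n2" using carrier_tensor3_nth[OF \<A>] by simp
    then show "c i * (\<A> ! i * M) $$ (j, k) = (\<Sum>b<n2. c i * ((\<A> ! i) $$ (j, b) * M $$ (b, k)))"
      using jk M by (simp add: scalar_prod_def atLeast0LessThan sum_distrib_left)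
  qed
  also have "\<dots> = (\<Sum>b<n2. \<Sum>i<n3. c i * ((\<A> ! i) $$ (j, b) * M $$ (b, k)))" by (rule sum.swap)
  also have "\<dots> = (?C * M) $$ (j, k)"
    using jk M C by (simp add: scalar_prod_def atLeast0LessThan entry sum_distrib_right mult.assoc)
  finally show "(N * ?C) $$ (j, k) = (?C * M) $$ (j, k)" .
qed (use N M in \<open>auto simp: slice_combination_def\<close>)

theorem theorem4p1:
  fixes \<A> \<B> :: "'a :: real_or_complex tensor3"
    and M1 M2 :: "'a mat"
    and I1 I2 I3 :: nat
  assumes "\<A> \<in> carrier_tensor3 I1 I2 I3" and "\<B> \<in> carrier_tensor3 I1 I2 I3"
    and "full_column_rank (unfold_23_1 I1 \<A>)"
    and "full_column_rank (unfold_13_2 I2 \<A>)"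
    and "M1 \<in> carrier_mat I1 I1" and "M2 \<in> carrier_mat I2 I2"
    and "unfold_23_1 I1 \<B> = unfold_23_1 I1 \<A> * M1"
    and "unfold_13_2 I2 \<B> = unfold_13_2 I2 \<A> * M2"
  shows
    "(\<exists>q. is_min_poly M1 q \<and> is_min_poly M2 q \<and>
       (\<forall>R p \<mu>. irreducible_factorization q R p \<mu> \<longrightarrow>
         (let L1 = (\<lambda>r. primary_dim M1 (p r) (\<mu> r)); L2 = (\<lambda>r. primary_dim M2 (p r) (\<mu> r)) in
           (\<forall>S1 T1 S2 T2.
              primary_decomposition M1 R p \<mu> S1 T1 \<and> primary_decomposition M2 R p \<mu> S2 T2 \<and>
              (\<forall>r<R. is_min_poly (T1 r) (p r ^ \<mu> r) \<and> is_min_poly (T2 r) (p r ^ \<mu> r)) \<longrightarrow>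
              (\<exists>D X1 X2.
                 let S1' = hcat I1 (map S1 [0..<R]); S2' = hcat I2 (map S2 [0..<R]);
                     \<A>' = (\<lambda>r. D r \<bullet>\<^sub>1 X1 r \<bullet>\<^sub>2 X2 r);
                     \<B>' = (\<lambda>r. (D r \<bullet>\<^sub>1 transpose_mat (T1 r)) \<bullet>\<^sub>1 X1 r \<bullet>\<^sub>2 X2 r) in
                 (\<forall>r<R. D r \<in> carrier_tensor3 (L1 r) (L2 r) I3) \<and>
                 (\<forall>i<I3. transpose_mat S1' * (\<A> ! i) * S2' =
                         diag_block_mat (map (\<lambda>r. D r ! i) [0..<R])) \<and>
                 (\<forall>i<I3. \<forall>r<R. transpose_mat (T1 r) * (D r ! i) = (D r ! i) * T2 r) \<and>

                 (\<forall>r<R. X1 r \<in> carrier_mat I1 (L1 r) \<and> X2 r \<in> carrier_mat I2 (L2 r)) \<and>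
                 hcat I1 (map X1 [0..<R]) = mat_inv (transpose_mat S1') \<and>
                 hcat I2 (map X2 [0..<R]) = mat_inv (transpose_mat S2') \<and>
                 \<A> = sum_tensor3 I1 I2 I3 R \<A>' \<and>
                 \<B> = sum_tensor3 I1 I2 I3 R \<B>' \<and>
                 (\<forall>r<R. is_ml_rank I1 I2 (\<A>' r) (L1 r) (L2 r)) \<and>
                 (\<forall>r<R. mat_rank (unfold_23_1 I1 (\<B>' r)) \<le> L1 r \<and>
                        mat_rank (unfold_13_2 I2 (\<B>' r)) \<le> L2 r \<and>
                        (p r \<noteq> [:0, 1:] \<longrightarrow> is_ml_rank I1 I2 (\<B>' r) (L1 r) (L2 r))) \<and>
                 (\<forall>r<R. D r \<bullet>\<^sub>1 transpose_mat (T1 r) = D r \<bullet>\<^sub>2 transpose_mat (T2 r)) \<and>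

                 (\<forall>r<R. \<forall>c. T1 r = c \<cdot>\<^sub>m 1\<^sub>m (L1 r) \<or> T2 r = c \<cdot>\<^sub>m 1\<^sub>m (L2 r) \<longrightarrow>
                        \<B>' r = smult_tensor3 c (\<A>' r)) \<and>

                 (\<forall>c. (\<forall>r<R. T1 r = c r \<cdot>\<^sub>m 1\<^sub>m (L1 r) \<or> T2 r = c r \<cdot>\<^sub>m 1\<^sub>m (L2 r)) \<longrightarrow>
                      (\<forall>r<R. is_ml_rank I1 I2 (\<A>' r) (L1 r) (L2 r)) \<and>
                      \<A> = sum_tensor3 I1 I2 I3 R \<A>' \<and>
                      \<B> = sum_tensor3 I1 I2 I3 R (\<lambda>r. smult_tensor3 (c r) (\<A>' r))))) \<and>

           (similar_mat M1 M2 \<longrightarrow>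
              (\<forall>r<R. L1 r = L2 r) \<and>
              (\<exists>S1 T1 S2 T2.
                 primary_decomposition M1 R p \<mu> S1 T1 \<and> primary_decomposition M2 R p \<mu> S2 T2 \<and>
                 (\<forall>r<R. is_min_poly (T1 r) (p r ^ \<mu> r) \<and> is_min_poly (T2 r) (p r ^ \<mu> r)) \<and>
                 (\<forall>r<R. T1 r = T2 r)))))) \<and>
     (I1 = I2 \<and> (\<exists>c. invertible_mat (slice_combination I1 I2 \<A> c)) \<longrightarrow> similar_mat M1 M2)"
proof -
  note \<A> = assms(1) and \<B> = assms(2) and M1 = assms(5) and M2 = assms(6)
  have inj1: "injective_mat (unfold_23_1 I1 \<A>)" and inj2: "injective_mat (unfold_13_2 I2 \<A>)"
    using assms(3,4) by (simp_all add: full_column_rank_iff_injective)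
  have B1: "\<B> ! i = transpose_mat M1 * \<A> ! i" if "i < I3" for i
    by (rule unfold_23_1_eq_multD[OF \<A> \<B> M1 assms(7) that])
  have B2: "\<B> ! i = \<A> ! i * M2" if "i < I3" for i
    by (rule unfold_13_2_eq_multD[OF \<A> \<B> M2 assms(8) that])
  have MA: "transpose_mat M1 * \<A> ! i = \<A> ! i * M2" if "i < I3" for i
    using B1[OF that] B2[OF that] by simp
  \<comment> \<open>The transposed relation is the hypothesis of
    \<open>annihilating_poly_transfer\<close> with \<open>M1\<close> and \<open>M2\<close>
    exchanged.\<close>
  have MAT: "transpose_mat M2 * map transpose_mat \<A> ! i = map transpose_mat \<A> ! i * M1" if i: "i < I3" for i
  proof -
    note Ai = carrier_tensor3_nth[OF \<A> i]
    have "transpose_mat (transpose_mat M1 * \<A> ! i) = transpose_mat (\<A> ! i) * M1"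
      using transpose_mult[OF _ Ai, of "transpose_mat M1" I1] M1 by simp
    moreover have "transpose_mat (\<A> ! i * M2) = transpose_mat M2 * transpose_mat (\<A> ! i)"
      by (rule transpose_mult[OF Ai M2])
    ultimately show ?thesis using MA[OF i] i carrier_tensor3_length[OF \<A>] by simp
  qed
  \<comment> \<open>\<open>is_min_poly\<close> depends on a matrix only through its annihilating
    polynomials, so this equivalence settles statement 1.\<close>
  have ann: "poly_mat f M1 = 0\<^sub>m I1 I1 \<longleftrightarrow> poly_mat f M2 = 0\<^sub>m I2 I2" for f
    using annihilating_poly_transfer[OF \<A> inj1 M1 M2 MA, of f]
      annihilating_poly_transfer[OF transpose_carrier_tensor3[OF \<A>] inj2[unfolded unfold_13_2_eq] M2 M1 MAT, of f]
    by blast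
  obtain q where q1: "is_min_poly M1 q" using exists_min_poly[OF M1] by blast
  then have q2: "is_min_poly M2 q" using M1 M2 by (simp add: is_min_poly_def ann)
  show ?thesis
    unfolding Let_def
  proof (rule conjI, rule exI[of _ q], intro conjI allI impI q1 q2, goal_cases)
    case (1 R p \<mu> S1 T1 S2 T2)
    then have fact: "irreducible_factorization q R p \<mu>"
      and dec1: "primary_decomposition M1 R p \<mu> S1 T1" and dec2: "primary_decomposition M2 R p \<mu> S2 T2"
      and min: "\<forall>r<R. is_min_poly (T1 r) (p r ^ \<mu> r) \<and> is_min_poly (T2 r) (p r ^ \<mu> r)"
      by blast+
    note d1 = dec1[unfolded primary_decomposition_iff[OF M1]] and d2 = dec2[unfolded primary_decomposition_iff[OF M2]]
    have pT1: "poly_mat (p r ^ \<mu> r) (T1 r) = 0\<^sub>m (primary_dim M1 (p r) (\<mu> r)) (primary_dim M1 (p r) (\<mu> r))"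
      if r: "r < R" for r
    proof -
      have "dim_row (T1 r) = primary_dim M1 (p r) (\<mu> r)" using d1 r by (metis carrier_matD(1))
      then show ?thesis using min r unfolding is_min_poly_def by metis
    qed
    have pT2: "poly_mat (p r ^ \<mu> r) (T2 r) = 0\<^sub>m (primary_dim M2 (p r) (\<mu> r)) (primary_dim M2 (p r) (\<mu> r))"
      if r: "r < R" for r
    proof -
      have "dim_row (T2 r) = primary_dim M2 (p r) (\<mu> r)" using d2 r by (metis carrier_matD(1))
      then show ?thesis using min r unfolding is_min_poly_def by metis
    qed
    show ?case
      by (rule coupled_block_decomposition[OF \<A> \<B> inj1 inj2 M1 M2 B1 B2 _ _ _ _ _ _ _ _ fact pT1 pT2,
              unfolded Let_def])
        (use d1 d2 in blast)+
  next
    \<comment> \<open>The dimensions are compared through a decomposition of \<open>M1\<close> whose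
      kernel bases are transported to \<open>M2\<close>.\<close>
    case (2 R p \<mu> r)
    then obtain S T where dec: "primary_decomposition M1 R p \<mu> S T"
      using primary_decomposition_exists[OF M1 q1] by blast
    show ?case using primary_decomposition_similar(2)[OF M1 2(2) dec 2(3)] by simp
  next
    case (3 R p \<mu>)
    then obtain S T where dec: "primary_decomposition M1 R p \<mu> S T"
      and min: "\<forall>r<R. is_min_poly (T r) (p r ^ \<mu> r)"
      using primary_decomposition_exists[OF M1 q1] by blast
    obtain S' where "primary_decomposition M2 R p \<mu> S' T"
      using primary_decomposition_similar(1)[OF M1 3(2) dec] by blast
    with dec min show ?case by blast
  next
    case 4
    show ?case
    proof (intro impI, elim conjE exE)
      fix c assume I: "I1 = I2" and inv: "invertible_mat (slice_combination I1 I2 \<A> c)"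
      let ?C = "slice_combination I1 I2 \<A> c"
      have C: "?C \<in> carrier_mat I1 I2" by (simp add: slice_combination_def)
      have M1T: "transpose_mat M1 \<in> carrier_mat I1 I1" using M1 by simp
      have "similar_mat (transpose_mat M1) M2"
        by (rule similar_mat_intertwine[OF M1T M2[folded I] C[folded I] inv[folded I]])
          (rule slice_combination_intertwine[OF \<A> M1T M2 MA, folded I])
      then show "similar_mat M1 M2"
        by (rule similar_mat_trans[OF similar_mat_sym[OF similar_mat_transpose_self[OF M1]]])
    qed
  qed
qed

end
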